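(* Let $\kappa=0.766$. There is a polynomial-time algorithm that, given a graph $G$, finds a community structure $\mathcal C$ of $G$ satisfying $$Q_G(\mathcal C)>\kappa\, Q_{OPT}-(1-\kappa)$$ and $$Q_G(\mathcal C)>Q_{OPT}-2(1-\kappa),$$ where $Q_{OPT}$ is the maximum modularity over all community structures of $G$.
   Context: A graph is a finite undirected graph $G=(V,E)$ with nonnegative (rational) edge weights; $A=(A_{ij})$ is its symmetric weighted adjacency matrix ($A_{ij}$ is the weight of edge $(i,j)$, and $A_{ij}=0$ if $(i,j)\notin E$), $d_i=\sum_j A_{ij}$ is the weighted degree of $i$, and $M=\tfrac12\sum_i d_i>0$ is the total edge weight. A community structure of $G$ is a partition $\mathcal C$ of $V$ into disjoint nonempty subsets with union $V$ (the number of parts is not prescribed). Its modularity is $$Q_G(\mathcal C)=\frac{1}{2M}\sum_{i,j\in V}\left(A_{ij}-\frac{d_id_j}{2M}\right)\delta_{ij},$$ where the sum is over ordered pairs (including $i=j$) and $\delta_{ij}=1$ if $i$ and $j$ are in the same part of $\mathcal C$, and $\delta_{ij}=0$ otherwise. *)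

theory Defs
  imports
    Complex_Main
    "HOL-Library.Disjoint_Sets"
    "HOL-Library.Log_Nat"
    "HOL-Computational_Algebra.Polynomial"
begin

section \<open>Weighted graphs and modularity\<close>

text \<open>
  Edges are unordered pairs, so the adjacency matrix is symmetric by construction.
  A singleton edge is a loop; loops are not excluded, and a loop contributes its weight once
  to the degree.
\<close>

record 'a wgraph =
  verts :: "'a set"
  edges :: "'a set set"
  weight :: "'a set \<Rightarrow> rat"

definition adj :: "'a wgraph \<Rightarrow> 'a \<Rightarrow> 'a \<Rightarrow> rat" where
  "adj G i j = (if {i, j} \<in> edges G then weight G {i, j} else 0)"

definition wdegree :: "'a wgraph \<Rightarrow> 'a \<Rightarrow> rat" where
  "wdegree G i = (\<Sum>j\<in>verts G. adj G i j)"

definition total_weight :: "'a wgraph \<Rightarrow> rat" where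
  "total_weight G = (\<Sum>i\<in>verts G. wdegree G i) / 2"

definition weighted_graph :: "'a wgraph \<Rightarrow> bool" where
  "weighted_graph G \<longleftrightarrow>
     finite (verts G) \<and>
     (\<forall>e\<in>edges G. \<exists>i\<in>verts G. \<exists>j\<in>verts G. e = {i, j}) \<and>
     (\<forall>e\<in>edges G. 0 \<le> weight G e) \<and>
     0 < total_weight G"

definition community_structure :: "'a wgraph \<Rightarrow> 'a set set \<Rightarrow> bool" where
  "community_structure G C \<longleftrightarrow> partition_on (verts G) C"

definition modularity :: "'a wgraph \<Rightarrow> 'a set set \<Rightarrow> rat" where
  "modularity G C =
     1 / (2 * total_weight G) *
     (\<Sum>i\<in>verts G. \<Sum>j\<in>verts G.
        (adj G i j - wdegree G i * wdegree G j / (2 * total_weight G)) *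
        of_bool (\<exists>X\<in>C. i \<in> X \<and> j \<in> X))"

definition modularity_opt :: "'a wgraph \<Rightarrow> rat" where
  "modularity_opt G = Max (modularity G ` {C. community_structure G C})"


section \<open>Random access machines with logarithmic cost\<close>

text \<open>
  Algorithms are structured programs for a random access machine: every integer address holds
  an integer of unbounded size, and addresses may be computed. Time is the logarithmic
  cost: each access and each arithmetic operation is charged the bit lengths of the numbers it
  handles (including addresses), so the size of every number produced, and of the part of the
  memory in use, is bounded in terms of the elapsed time. Polynomial time on this machine thus
  coincides with polynomial time on Turing machines.
\<close>

type_synonym mem = "int \<Rightarrow> int"

datatype expr =
    Const int
  | Load expr
  | Plus expr expr
  | Minus expr expr
  | Times expr expr
  | Quot expr expr

datatype prog =
    Skip
  | Store expr expr
  | Seq prog prog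
  | Cond expr prog prog
  | While expr prog

text \<open>One bit is added for the sign; in particular every charge is positive.\<close>

definition int_size :: "int \<Rightarrow> nat" where
  "int_size z = nat (bitlen \<bar>z\<bar>) + 1"

fun val :: "expr \<Rightarrow> mem \<Rightarrow> int" where
  "val (Const z) m = z"
| "val (Load a) m = m (val a m)"
| "val (Plus a b) m = val a m + val b m"
| "val (Minus a b) m = val a m - val b m"
| "val (Times a b) m = val a m * val b m"
| "val (Quot a b) m = val a m div val b m"

fun cost :: "expr \<Rightarrow> mem \<Rightarrow> nat" where
  "cost (Const z) m = int_size z"
| "cost (Load a) m = cost a m + int_size (val a m) + int_size (m (val a m))"
| "cost (Plus a b) m = cost a m + cost b m + int_size (val a m) + int_size (val b m)"
| "cost (Minus a b) m = cost a m + cost b m + int_size (val a m) + int_size (val b m)"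
| "cost (Times a b) m = cost a m + cost b m + int_size (val a m) + int_size (val b m)"
| "cost (Quot a b) m = cost a m + cost b m + int_size (val a m) + int_size (val b m)"

text \<open>
  \<open>exec p m t m'\<close>: started in memory \<open>m\<close>, program \<open>p\<close> halts in memory \<open>m'\<close> after time \<open>t\<close>.
  In \<open>Store a e\<close> the address is \<open>a\<close>; a test succeeds if its value is positive.
\<close>

inductive exec :: "prog \<Rightarrow> mem \<Rightarrow> nat \<Rightarrow> mem \<Rightarrow> bool" where
  Skip: "exec Skip m 1 m"
| Store: "exec (Store a e) m
     (cost a m + cost e m + int_size (val a m) + int_size (val e m))
     (m(val a m := val e m))"
| Seq: "exec p m s m1 \<Longrightarrow> exec q m1 t m2 \<Longrightarrow> exec (Seq p q) m (s + t) m2"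
| CondTrue: "0 < val e m \<Longrightarrow> exec p m t m' \<Longrightarrow>
     exec (Cond e p q) m (cost e m + int_size (val e m) + t) m'"
| CondFalse: "\<not> 0 < val e m \<Longrightarrow> exec q m t m' \<Longrightarrow>
     exec (Cond e p q) m (cost e m + int_size (val e m) + t) m'"
| WhileTrue: "0 < val e m \<Longrightarrow> exec p m s m1 \<Longrightarrow> exec (While e p) m1 t m2 \<Longrightarrow>
     exec (While e p) m (cost e m + int_size (val e m) + s + t) m2"
| WhileFalse: "\<not> 0 < val e m \<Longrightarrow> exec (While e p) m (cost e m + int_size (val e m)) m"

inductive_cases exec_SkipE: "exec Skip m t m'"
  and exec_StoreE: "exec (Store a e) m t m'"
  and exec_SeqE: "exec (Seq p q) m t m'"
  and exec_CondE: "exec (Cond e p q) m t m'"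
  and exec_WhileE: "exec (While e p) m t m'"

lemma exec_deterministic:
  "exec p m t m' \<Longrightarrow> exec p m u m'' \<Longrightarrow> u = t \<and> m'' = m'"
proof (induction arbitrary: u m'' rule: exec.induct)
  case Skip
  then show ?case by (rule exec_SkipE) simp
next
  case Store
  then show ?case by (rule exec_StoreE) simp
next
  case Seq
  from Seq.prems show ?case by (rule exec_SeqE) (use Seq.IH in metis)
next
  case CondTrue
  from CondTrue.prems show ?case by (rule exec_CondE) (use CondTrue.hyps CondTrue.IH in metis)+
next
  case CondFalse
  from CondFalse.prems show ?case by (rule exec_CondE) (use CondFalse.hyps CondFalse.IH in metis)+
next
  case WhileTrue
  from WhileTrue.prems show ?case by (rule exec_WhileE) (use WhileTrue.hyps WhileTrue.IH in metis)+
next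
  case WhileFalse
  from WhileFalse.prems show ?case by (rule exec_WhileE) (use WhileFalse.hyps in metis)+
qed

definition load_input :: "int list \<Rightarrow> mem" where
  "load_input xs = (\<lambda>a. if 0 \<le> a \<and> a < int (length xs) then xs ! nat a else 0)"

definition input_size :: "int list \<Rightarrow> nat" where
  "input_size xs = (\<Sum>x\<leftarrow>xs. int_size x)"

text \<open>
  \<open>p\<close> solves, in polynomial time, the search problem with instances \<open>I\<close>, input encoding \<open>enc\<close>
  and acceptance condition \<open>ok\<close> on the instance and the final memory.
\<close>

definition solves_in_polytime ::
    "prog \<Rightarrow> ('i \<Rightarrow> int list) \<Rightarrow> 'i set \<Rightarrow> ('i \<Rightarrow> mem \<Rightarrow> bool) \<Rightarrow> bool" where
  "solves_in_polytime p enc I ok \<longleftrightarrow>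
     (\<exists>b :: nat poly. \<forall>x\<in>I. \<exists>t m.
        exec p (load_input (enc x)) t m \<and> t \<le> poly b (input_size (enc x)) \<and> ok x m)"


section \<open>Graphs as inputs and community structures as outputs\<close>

text \<open>
  As an input, a graph has its vertices numbered \<open>0, \<dots>, n - 1\<close>. It is given by \<open>n\<close> and
  the rows of its adjacency matrix, each entry as numerator and denominator in lowest terms.
\<close>

definition input_graphs :: "nat wgraph set" where
  "input_graphs = {G. weighted_graph G \<and> (\<exists>n. verts G = {..<n})}"

definition encode_graph :: "nat wgraph \<Rightarrow> int list" where
  "encode_graph G =
     (let n = card (verts G) in
      int n # concat [[fst (quotient_of (adj G i j)), snd (quotient_of (adj G i j))].
                      i \<leftarrow> [0..<n], j \<leftarrow> [0..<n]])"

text \<open>On halting, cell \<open>i\<close> contains a label of the community of vertex \<open>i\<close>.\<close>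

definition output_communities :: "nat wgraph \<Rightarrow> mem \<Rightarrow> nat set set" where
  "output_communities G m = (\<lambda>i. {j \<in> verts G. m (int j) = m (int i)}) ` verts G"

end

theory Submission
  imports Defs "HOL-Analysis.Analysis"
begin

text \<open>
  With \<open>w i j = A i j / 2M\<close> and \<open>p i = d i / 2M\<close>, the modularity of a labelling \<open>f\<close> is the value at
  \<open>X i j = of_bool (f i = f j)\<close> of the concave function \<open>R X = \<Sum> w i j * X i j - \<Sum> p i * p j * \<phi> (X i j)\<close>,
  where \<open>\<phi> x = 2/5 x + 3/5 x\<^sup>2\<close>. It is maximised approximately over Gram matrices \<open>X = L L\<^sup>T\<close> of nearly unit
  vectors by local search over lower triangular \<open>L\<close>, with a penalty for the diagonal of \<open>X\<close> and a
  logarithmic barrier for that of \<open>L\<close>: at a nearly stationary \<open>L\<close> the matrix \<open>L\<^sup>T G L\<close>, for the gradient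
  \<open>G\<close>, is close to a small negative multiple of the identity, so \<open>G\<close> is negative semidefinite up to a
  small error and concavity shows near-optimality.

  The vectors are rounded by two random hyperplanes with probability \<open>0.87\<close> and by three otherwise.
  Two vectors at angle \<open>\<theta>\<close> end in the same community with probability
  \<open>c = 0.87 a\<^sup>2 + 0.13 a\<^sup>3\<close>, \<open>a = 1 - \<theta> / \<pi>\<close>, and for \<open>x = cos \<theta>\<close>
  we have \<open>0.766 x + 1/2000 \<le> c \<le> 0.766 \<phi> x + 0.234\<close>; so the expected modularity is at least
  \<open>0.766 R X - 0.234 + 1/2000\<close>, where \<open>1/2000\<close> pays for all errors. To derandomise this, the vectors are
  first moved to the fixed dimension \<open>10^12\<close> by the method of conditional expectations; there, a
  fixed finite family of integral hyperplanes approximates a random one, and all triples are tried.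

  The second inequality follows from the first, since \<open>Q_OPT \<le> 1\<close>.
\<close>

section \<open>A language of bounded loops\<close>

text \<open>Two obstacles shape the proof. A linear \<open>\<phi>\<close> would fail at obtuse
  angles: the collision probability is nonnegative, while \<open>0.766 x + 0.234\<close> is negative
  as x approaches -1. Constraints \<open>X i j \<ge> 0\<close> would repair this but burden the
  local search. Instead the null-model term is charged through \<open>\<phi>\<close>, which is
  convex, equals x at 0 and 1, so that labellings keep their value, and never falls below -1/15. Its
  coefficient 2/5 almost equalises the slopes of the two sides of the upper estimate at a right
  angle, where they nearly meet. The other obstacle is the length of numbers. The factor L, over one
  common denominator, is updated by linear operations only; gradients, potentials and modularities
  have higher degree but occur in tests alone and never enter an array. The logarithm of the barrier
  is never computed, since its derivative along the moves is explicit. For the hyperplanes a mere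
  existence statement is enough: after the reduction their dimension does not depend on the graph,
  so a finite list of them belongs to the program text.\<close>

definition pr :: "nat \<Rightarrow> nat \<Rightarrow> nat" where
  "pr x y = (x + y) * (x + y) + x"

text \<open>The value lies between consecutive squares, since \<open>x < 2 * (x + y) + 1\<close>.
  Unlike a bijective pairing this one needs no division: the machine computes it by a single
  polynomial expression, and the bit length of an address is linear in those of its indices.\<close>

lemma pr_inj: "pr x y = pr x' y' \<longleftrightarrow> x = x' \<and> y = y'"
proof
  assume e: "pr x y = pr x' y'"
  have lt: "pr x y < pr x' y'" if "x + y < x' + y'" for x y x' y' :: nat
  proof -
    have "pr x y < (x + y + 1) * (x + y + 1)" by (simp add: pr_def algebra_simps)
    also have "\<dots> \<le> (x' + y') * (x' + y')" using that by (intro mult_mono) auto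
    also have "\<dots> \<le> pr x' y'" by (simp add: pr_def)
    finally show ?thesis .
  qed
  have "x + y = x' + y'"
    using lt[of x y x' y'] lt[of x' y' x y] e by linarith
  with e show "x = x' \<and> y = y'" by (simp add: pr_def)
qed simp

text \<open>All arrays but 0 go to negative addresses and so never meet the input; cell
  \<open>i\<close> of array 0 is exactly where the label of vertex \<open>i\<close> is read.\<close>

definition adr :: "nat \<Rightarrow> nat \<Rightarrow> nat \<Rightarrow> int" where
  "adr a i j = (if a = 0 then int i else - 1 - int (pr a (pr i j)))"

lemma adr_inj: "a > 0 \<Longrightarrow> adr a i j = adr a' i' j' \<longleftrightarrow> a = a' \<and> i = i' \<and> j = j'"
  by (auto simp: adr_def pr_inj)

lemma adr_inj0: "adr 0 i j = adr a' i' j' \<longleftrightarrow> a' = 0 \<and> i = i'"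
  by (auto simp: adr_def)

datatype lim = LC nat | LN

datatype tm =
    TC int
  | TN
  | TV nat
  | TA nat tm tm
  | TAdd tm tm
  | TSub tm tm
  | TMul tm tm
  | TDiv tm tm
  | TIf tm tm tm
  | TSum nat lim tm

datatype st =
    SSkip
  | SSet nat tm tm tm
  | SSeq st st
  | SIf tm st st
  | SFor nat lim st

type_synonym state = "nat \<Rightarrow> nat \<Rightarrow> nat \<Rightarrow> int"
type_synonym env = "nat \<Rightarrow> nat"

fun ln_of :: "nat \<Rightarrow> lim \<Rightarrow> nat" where
  "ln_of n (LC k) = k"
| "ln_of n LN = n"

fun tv :: "nat \<Rightarrow> env \<Rightarrow> state \<Rightarrow> tm \<Rightarrow> int" where
  "tv n e \<sigma> (TC c) = c"
| "tv n e \<sigma> TN = int n"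
| "tv n e \<sigma> (TV x) = int (e x)"
| "tv n e \<sigma> (TA a i j) = \<sigma> a (nat (tv n e \<sigma> i)) (nat (tv n e \<sigma> j))"
| "tv n e \<sigma> (TAdd s t) = tv n e \<sigma> s + tv n e \<sigma> t"
| "tv n e \<sigma> (TSub s t) = tv n e \<sigma> s - tv n e \<sigma> t"
| "tv n e \<sigma> (TMul s t) = tv n e \<sigma> s * tv n e \<sigma> t"
| "tv n e \<sigma> (TDiv s t) = tv n e \<sigma> s div tv n e \<sigma> t"
| "tv n e \<sigma> (TIf c s t) = (if 0 < tv n e \<sigma> c then tv n e \<sigma> s else tv n e \<sigma> t)"
| "tv n e \<sigma> (TSum x l t) = (\<Sum>i<ln_of n l. tv n (e(x := i)) \<sigma> t)"

fun run :: "nat \<Rightarrow> env \<Rightarrow> st \<Rightarrow> state \<Rightarrow> state" where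
  "run n e SSkip \<sigma> = \<sigma>"
| "run n e (SSet a i j t) \<sigma> =
     \<sigma>(a := (\<sigma> a)(nat (tv n e \<sigma> i) := (\<sigma> a (nat (tv n e \<sigma> i)))(nat (tv n e \<sigma> j) := tv n e \<sigma> t)))"
| "run n e (SSeq s t) \<sigma> = run n e t (run n e s \<sigma>)"
| "run n e (SIf c s t) \<sigma> = (if 0 < tv n e \<sigma> c then run n e s \<sigma> else run n e t \<sigma>)"
| "run n e (SFor x l s) \<sigma> = fold (\<lambda>i. run n (e(x := i)) s) [0..<ln_of n l] \<sigma>"

text \<open>A condition that can be read off the term. \<open>tv\<close> truncates indices by
  \<open>nat\<close>, while the machine uses the integer itself, so the two semantics agree for
  nonnegative indices.\<close>

fun nonneg :: "tm \<Rightarrow> bool" where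
  "nonneg (TC c) \<longleftrightarrow> 0 \<le> c"
| "nonneg TN \<longleftrightarrow> True"
| "nonneg (TV x) \<longleftrightarrow> True"
| "nonneg (TAdd s t) \<longleftrightarrow> nonneg s \<and> nonneg t"
| "nonneg (TMul s t) \<longleftrightarrow> nonneg s \<and> nonneg t"
| "nonneg _ \<longleftrightarrow> False"

lemma nonneg_tv: "nonneg t \<Longrightarrow> 0 \<le> tv n e \<sigma> t"
  by (induction t) auto

text \<open>
  The array \<open>0\<close> is one-dimensional and occupies the addresses \<open>0, 1, \<dots>\<close>; the arrays \<open>1\<close>, \<open>2\<close>, \<open>3\<close>
  are reserved for loop variables, registers and the bound \<open>n\<close> of the loops.
\<close>

definition ok_arr :: "nat \<Rightarrow> tm \<Rightarrow> bool" where
  "ok_arr a j \<longleftrightarrow> a = 0 \<and> j = TC 0 \<or> 4 \<le> a"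

fun wft :: "nat set \<Rightarrow> tm \<Rightarrow> bool" where
  "wft S (TC c) \<longleftrightarrow> True"
| "wft S TN \<longleftrightarrow> True"
| "wft S (TV x) \<longleftrightarrow> x \<in> S"
| "wft S (TA a i j) \<longleftrightarrow> ok_arr a j \<and> nonneg i \<and> nonneg j \<and> wft S i \<and> wft S j"
| "wft S (TAdd s t) \<longleftrightarrow> wft S s \<and> wft S t"
| "wft S (TSub s t) \<longleftrightarrow> wft S s \<and> wft S t"
| "wft S (TMul s t) \<longleftrightarrow> wft S s \<and> wft S t"
| "wft S (TDiv s t) \<longleftrightarrow> wft S s \<and> wft S t"
| "wft S (TIf c s t) \<longleftrightarrow> wft S c \<and> wft S s \<and> wft S t"
| "wft S (TSum x l t) \<longleftrightarrow> x \<notin> S \<and> wft (insert x S) t"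

text \<open>Degree in the sense of bit lengths: a quotient is no longer than its dividend, and tests
  and indices select a value without enlarging it.\<close>

fun deg :: "nat set \<Rightarrow> tm \<Rightarrow> nat" where
  "deg H (TA a i j) = of_bool (a \<in> H)"
| "deg H (TAdd s t) = max (deg H s) (deg H t)"
| "deg H (TSub s t) = max (deg H s) (deg H t)"
| "deg H (TMul s t) = deg H s + deg H t"
| "deg H (TDiv s t) = deg H s"
| "deg H (TIf c s t) = max (deg H s) (deg H t)"
| "deg H (TSum x l t) = deg H t"
| "deg H _ = 0"

text \<open>
  Assigned terms are at most linear in the arrays \<open>H\<close> that the program may change. Hence every
  assignment adds only a bounded number of bits to the largest entry, and the entries stay of
  polynomial length.
\<close>

fun wfs :: "nat set \<Rightarrow> nat set \<Rightarrow> st \<Rightarrow> bool" where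
  "wfs H S SSkip \<longleftrightarrow> True"
| "wfs H S (SSet a i j t) \<longleftrightarrow> a \<in> H \<and> ok_arr a j \<and> nonneg i \<and> nonneg j \<and>
     wft S i \<and> wft S j \<and> wft S t \<and> deg H t \<le> 1"
| "wfs H S (SSeq s t) \<longleftrightarrow> wfs H S s \<and> wfs H S t"
| "wfs H S (SIf c s t) \<longleftrightarrow> wft S c \<and> wfs H S s \<and> wfs H S t"
| "wfs H S (SFor x l s) \<longleftrightarrow> x \<notin> S \<and> wfs H (insert x S) s"

fun lims :: "tm \<Rightarrow> nat set" where
  "lims (TA a i j) = lims i \<union> lims j"
| "lims (TAdd s t) = lims s \<union> lims t"
| "lims (TSub s t) = lims s \<union> lims t"
| "lims (TMul s t) = lims s \<union> lims t"
| "lims (TDiv s t) = lims s \<union> lims t"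
| "lims (TIf c s t) = lims c \<union> lims s \<union> lims t"
| "lims (TSum x l t) = (case l of LC k \<Rightarrow> {k} | LN \<Rightarrow> {}) \<union> lims t"
| "lims _ = {}"

fun limss :: "st \<Rightarrow> nat set" where
  "limss SSkip = {}"
| "limss (SSet a i j t) = lims i \<union> lims j \<union> lims t"
| "limss (SSeq s t) = limss s \<union> limss t"
| "limss (SIf c s t) = lims c \<union> limss s \<union> limss t"
| "limss (SFor x l s) = (case l of LC k \<Rightarrow> {k} | LN \<Rightarrow> {}) \<union> limss s"

lemma finite_lims: "finite (lims t)"
  by (induction t) (auto split: lim.splits)

lemma finite_limss: "finite (limss s)"
  by (induction s) (auto simp: finite_lims split: lim.splits)


section \<open>Sizes\<close>

lemma int_size_pos: "1 \<le> int_size z"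
  by (simp add: int_size_def)

lemma int_size_le_iff: "int_size z \<le> Suc k \<longleftrightarrow> \<bar>z\<bar> < 2 ^ k"
  using bitlen_le_iff_power[of "\<bar>z\<bar>" k] bitlen_nonneg[of "\<bar>z\<bar>"] by (auto simp: int_size_def nat_le_iff)

lemma int_size_mono: "\<bar>y\<bar> \<le> \<bar>z\<bar> \<Longrightarrow> int_size y \<le> int_size z"
  using int_size_pos[of z] int_size_le_iff[of z "int_size z - 1"] int_size_le_iff[of y "int_size z - 1"]
  by auto

lemma less_int_size: "\<bar>z\<bar> < 2 ^ (int_size z - 1)"
  using int_size_le_iff[of z "int_size z - 1"] int_size_pos[of z] by auto

lemma int_size_add: "int_size (y + z) \<le> max (int_size y) (int_size z) + 1"
proof -
  let ?k = "max (int_size y) (int_size z) - 1"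
  have "\<bar>y\<bar> < 2 ^ ?k"
    by (rule less_le_trans[OF less_int_size]) (simp add: power_increasing)
  moreover have "\<bar>z\<bar> < 2 ^ ?k"
    by (rule less_le_trans[OF less_int_size]) (simp add: power_increasing)
  ultimately have "\<bar>y + z\<bar> < 2 ^ Suc ?k" by simp
  then have "int_size (y + z) \<le> Suc (Suc ?k)" by (simp only: int_size_le_iff)
  then show ?thesis using int_size_pos[of y] by linarith
qed

lemma int_size_minus: "int_size (- z) = int_size z"
  by (simp add: int_size_def)

lemma int_size_diff: "int_size (y - z) \<le> max (int_size y) (int_size z) + 1"
  using int_size_add[of y "- z"] by (simp add: int_size_minus)

lemma int_size_mult: "int_size (y * z) \<le> int_size y + int_size z"
proof -
  have "\<bar>y\<bar> * \<bar>z\<bar> \<le> 2 ^ (int_size y - 1) * 2 ^ (int_size z - 1)"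
    using less_int_size[of y] less_int_size[of z] by (intro mult_mono) auto
  also have "\<dots> < 2 ^ Suc ((int_size y - 1) + (int_size z - 1))"
    by (simp add: power_add)
  finally have "int_size (y * z) \<le> Suc (Suc ((int_size y - 1) + (int_size z - 1)))"
    by (simp only: int_size_le_iff abs_mult)
  then show ?thesis using int_size_pos[of y] int_size_pos[of z] by linarith
qed

text \<open>Negative quotients are rounded away from zero, which still does not pass the dividend;
  for divisor 0 the quotient is 0.\<close>

lemma abs_div_le: "\<bar>y div z\<bar> \<le> \<bar>y :: int\<bar>"
proof (cases "z = 0")
  case False
  have pos: "\<bar>y div z\<bar> \<le> \<bar>y\<bar>" if "z > 0" for y z :: int
  proof (cases "y \<ge> 0")
    case True
    with that show ?thesis
      using zdiv_mono2[of y 1 z] by (simp add: pos_imp_zdiv_nonneg_iff)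
  next
    case False
    have "y \<le> y div z" using False that zdiv_mono2_neg[of y 1 z] by simp
    moreover have "y div z \<le> 0" using False that by (simp add: div_nonpos_pos_le0)
    ultimately show ?thesis by simp
  qed
  show ?thesis
  proof (cases "z > 0")
    case True
    then show ?thesis by (rule pos)
  next
    case False
    with \<open>z \<noteq> 0\<close> have "- z > 0" by simp
    from pos[OF this, of "- y"] show ?thesis by simp
  qed
qed simp

lemma int_size_div: "int_size (y div z) \<le> int_size y"
  by (intro int_size_mono abs_div_le)

lemma int_size_sum:
  assumes "\<And>i. i < k \<Longrightarrow> int_size (f i) \<le> K"
  shows "int_size (\<Sum>i<k. f i) \<le> K + int_size (int k)"
proof (cases "k = 0")
  case True
  have "int_size 0 = 1" by (simp add: int_size_def bitlen_def floorlog_def)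
  with True show ?thesis by simp
next
  case False
  have K: "1 \<le> K" using assms[of 0] int_size_pos[of "f 0"] False by simp
  have "\<bar>\<Sum>i<k. f i\<bar> \<le> (\<Sum>i<k. \<bar>f i\<bar>)" by (rule sum_abs)
  also have "\<dots> \<le> (\<Sum>i<k. 2 ^ (K - 1))"
  proof (rule sum_mono)
    fix i assume "i \<in> {..<k}"
    then have "int_size (f i) \<le> Suc (K - 1)" using assms[of i] K by simp
    then show "\<bar>f i\<bar> \<le> 2 ^ (K - 1)" by (simp only: int_size_le_iff less_imp_le)
  qed
  also have "\<dots> = int k * 2 ^ (K - 1)" by simp
  also have "\<dots> < 2 ^ (int_size (int k) - 1) * 2 ^ (K - 1)"
    using less_int_size[of "int k"] by (intro mult_strict_right_mono) auto
  also have "\<dots> = 2 ^ ((int_size (int k) - 1) + (K - 1))" by (simp add: power_add)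
  finally have "int_size (\<Sum>i<k. f i) \<le> Suc ((int_size (int k) - 1) + (K - 1))"
    by (simp only: int_size_le_iff)
  then show ?thesis using K by linarith
qed

text \<open>\<open>B\<close> bounds what cannot grow during a run (loop bound, variables, arrays
  outside \<open>H\<close>), and \<open>B'\<close> the entries of the arrays \<open>H\<close>, which
  can.\<close>

definition bnd :: "nat set \<Rightarrow> nat \<Rightarrow> nat set \<Rightarrow> env \<Rightarrow> state \<Rightarrow> nat \<Rightarrow> nat \<Rightarrow> bool" where
  "bnd H n S e \<sigma> B B' \<longleftrightarrow> 1 \<le> B \<and> int_size (int n) \<le> B \<and> (\<forall>x\<in>S. int_size (int (e x)) \<le> B) \<and>
     (\<forall>a i j. a \<notin> H \<longrightarrow> int_size (\<sigma> a i j) \<le> B) \<and> (\<forall>a i j. a \<in> H \<longrightarrow> int_size (\<sigma> a i j) \<le> B')"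

fun wt :: "tm \<Rightarrow> nat" where
  "wt (TC c) = int_size c"
| "wt TN = 1"
| "wt (TV x) = 1"
| "wt (TA a i j) = 1"
| "wt (TAdd s t) = wt s + wt t + 1"
| "wt (TSub s t) = wt s + wt t + 1"
| "wt (TMul s t) = wt s + wt t"
| "wt (TDiv s t) = wt s"
| "wt (TIf c s t) = wt s + wt t"
| "wt (TSum x l t) = wt t + 1"

lemma bnd_upd:
  assumes "bnd H n S e \<sigma> B B'" "i \<le> ln_of n l" "\<And>k. l = LC k \<Longrightarrow> int_size (int k) \<le> B"
  shows "bnd H n (insert x S) (e(x := i)) \<sigma> B B'"
proof -
  have "int_size (int i) \<le> int_size (int (ln_of n l))"
    using assms(2) by (intro int_size_mono) simp
  also have "\<dots> \<le> B" using assms(1,3) by (cases l) (auto simp: bnd_def)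
  finally show ?thesis using assms(1) by (auto simp: bnd_def)
qed

lemma max_comb:
  fixes B B' :: nat
  assumes "x \<le> d * B' + w * B" "y \<le> d' * B' + w' * B" "1 \<le> B" "z \<le> max x y + 1"
  shows "z \<le> max d d' * B' + (w + w' + 1) * B"
proof -
  define M where "M = max d d' * B'"
  have "d * B' \<le> M" "d' * B' \<le> M" unfolding M_def by (intro mult_right_mono; simp)+
  moreover have "(w + w' + 1) * B = w * B + w' * B + B" by (simp add: algebra_simps)
  moreover have "z \<le> x + 1 \<or> z \<le> y + 1" using assms(4) by (auto simp: max_def split: if_splits)
  ultimately have "z \<le> M + (w + w' + 1) * B" using assms(1-3) by linarith
  then show ?thesis by (simp only: M_def)
qed

text \<open>A sum costs one further bit, a product adds bit lengths, and a loop sum adds the length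
  of its limit. So the changeable arrays enter with factor \<open>deg H t\<close>; for an assigned
  term, of degree at most 1, the new entry exceeds the old bound \<open>B'\<close> by a multiple of
  \<open>B\<close> only.\<close>

lemma int_size_tv:
  assumes "wft S t" "bnd H n S e \<sigma> B B'" "\<And>k. k \<in> lims t \<Longrightarrow> int_size (int k) \<le> B"
  shows "int_size (tv n e \<sigma> t) \<le> deg H t * B' + wt t * B"
  using assms
proof (induction t arbitrary: S e)
  case (TC c)
  then show ?case by (simp add: bnd_def)
next
  case (TAdd s t)
  then show ?case
    using int_size_add[of "tv n e \<sigma> s" "tv n e \<sigma> t"]
    by (simp only: deg.simps wt.simps tv.simps)
      (rule max_comb[OF _ _ _ int_size_add], auto simp: bnd_def)
next
  case (TSub s t)
  then show ?case
    by (simp only: deg.simps wt.simps tv.simps)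
      (rule max_comb[OF _ _ _ int_size_diff], auto simp: bnd_def)
next
  case (TMul s t)
  have "int_size (tv n e \<sigma> s) \<le> deg H s * B' + wt s * B"
    "int_size (tv n e \<sigma> t) \<le> deg H t * B' + wt t * B" using TMul by auto
  then show ?case
    using int_size_mult[of "tv n e \<sigma> s" "tv n e \<sigma> t"] by (simp add: algebra_simps)
next
  case (TDiv s t)
  have "int_size (tv n e \<sigma> s) \<le> deg H s * B' + wt s * B" using TDiv by auto
  then show ?case
    using int_size_div[of "tv n e \<sigma> s" "tv n e \<sigma> t"] by simp
next
  case (TIf c s t)
  have "int_size (tv n e \<sigma> s) \<le> deg H s * B' + wt s * B"
    "int_size (tv n e \<sigma> t) \<le> deg H t * B' + wt t * B" using TIf by auto
  moreover define M where "M = max (deg H s) (deg H t) * B'"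
  have "deg H s * B' \<le> M" "deg H t * B' \<le> M" unfolding M_def by (intro mult_right_mono; simp)+
  moreover have "(wt s + wt t) * B = wt s * B + wt t * B" by (simp add: algebra_simps)
  ultimately have "int_size (tv n e \<sigma> (TIf c s t)) \<le> M + (wt s + wt t) * B"
    by (simp only: tv.simps split: if_split) linarith
  then show ?case by (simp only: M_def deg.simps wt.simps)
next
  case (TSum x l t)
  have lim: "int_size (int (ln_of n l)) \<le> B"
    using TSum.prems by (cases l) (auto simp: bnd_def)
  have "int_size (tv n (e(x := i)) \<sigma> t) \<le> deg H t * B' + wt t * B" if "i < ln_of n l" for i
  proof (rule TSum.IH)
    show "wft (insert x S) t" using TSum.prems by simp
    show "bnd H n (insert x S) (e(x := i)) \<sigma> B B'"
      using TSum.prems that by (intro bnd_upd[where l = l]) auto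
    show "int_size (int k) \<le> B" if "k \<in> lims t" for k using TSum.prems that by simp
  qed
  from int_size_sum[of "ln_of n l" "\<lambda>i. tv n (e(x := i)) \<sigma> t", OF this] lim
  show ?case by (simp add: algebra_simps)
qed (auto simp: bnd_def trans_le_add1)

section \<open>Compilation\<close>

abbreviation regA :: "nat \<Rightarrow> expr" where "regA r \<equiv> Const (adr 2 r 0)"
abbreviation reg :: "nat \<Rightarrow> expr" where "reg r \<equiv> Load (regA r)"
abbreviation varA :: "nat \<Rightarrow> expr" where "varA x \<equiv> Const (adr 1 x 0)"
abbreviation var :: "nat \<Rightarrow> expr" where "var x \<equiv> Load (varA x)"
abbreviation boundA :: "int" where "boundA \<equiv> adr 3 0 0"

definition pr_expr :: "expr \<Rightarrow> expr \<Rightarrow> expr" where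
  "pr_expr x y = Plus (Times (Plus x y) (Plus x y)) x"

definition adr_expr :: "nat \<Rightarrow> expr \<Rightarrow> expr \<Rightarrow> expr" where
  "adr_expr a i j =
     (if a = 0 then i else Minus (Const (- 1)) (pr_expr (Const (int a)) (pr_expr i j)))"

fun lim_expr :: "lim \<Rightarrow> expr" where
  "lim_expr (LC k) = Const (int k)"
| "lim_expr LN = Load (Const boundA)"

definition loop :: "nat \<Rightarrow> lim \<Rightarrow> prog \<Rightarrow> prog" where
  "loop x l p = Seq (Store (varA x) (Const 0))
     (While (Minus (lim_expr l) (var x)) (Seq p (Store (varA x) (Plus (var x) (Const 1)))))"

text \<open>Registers serve as a stack: the result goes to register \<open>r\<close>, and
  intermediate values go to registers above it.\<close>

fun comp :: "tm \<Rightarrow> nat \<Rightarrow> prog" where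
  "comp (TC c) r = Store (regA r) (Const c)"
| "comp TN r = Store (regA r) (Load (Const boundA))"
| "comp (TV x) r = Store (regA r) (var x)"
| "comp (TA a i j) r = Seq (comp i r) (Seq (comp j (Suc r))
     (Store (regA r) (Load (adr_expr a (reg r) (reg (Suc r))))))"
| "comp (TAdd s t) r = Seq (comp s r) (Seq (comp t (Suc r)) (Store (regA r) (Plus (reg r) (reg (Suc r)))))"
| "comp (TSub s t) r = Seq (comp s r) (Seq (comp t (Suc r)) (Store (regA r) (Minus (reg r) (reg (Suc r)))))"
| "comp (TMul s t) r = Seq (comp s r) (Seq (comp t (Suc r)) (Store (regA r) (Times (reg r) (reg (Suc r)))))"
| "comp (TDiv s t) r = Seq (comp s r) (Seq (comp t (Suc r)) (Store (regA r) (Quot (reg r) (reg (Suc r)))))"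
| "comp (TIf c s t) r = Seq (comp c r) (Cond (reg r) (comp s r) (comp t r))"
| "comp (TSum x l t) r = Seq (Store (regA r) (Const 0))
     (loop x l (Seq (comp t (Suc r)) (Store (regA r) (Plus (reg r) (reg (Suc r))))))"

fun comps :: "st \<Rightarrow> prog" where
  "comps SSkip = Skip"
| "comps (SSet a i j t) = Seq (comp i 0) (Seq (comp j 1) (Seq (comp t 2)
     (Store (adr_expr a (reg 0) (reg 1)) (reg 2))))"
| "comps (SSeq s t) = Seq (comps s) (comps t)"
| "comps (SIf c s t) = Seq (comp c 0) (Cond (reg 0) (comps s) (comps t))"
| "comps (SFor x l s) = loop x l (comps s)"

section \<open>Memory layout and the cost of expressions and loops\<close>

definition rep :: "nat \<Rightarrow> nat set \<Rightarrow> env \<Rightarrow> state \<Rightarrow> mem \<Rightarrow> bool" where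
  "rep n S e \<sigma> m \<longleftrightarrow> m boundA = int n \<and> (\<forall>x\<in>S. m (adr 1 x 0) = int (e x)) \<and>
     (\<forall>i. m (adr 0 i 0) = \<sigma> 0 i 0) \<and> (\<forall>a\<ge>4. \<forall>i j. m (adr a i j) = \<sigma> a i j)"

text \<open>Loop variables outside the scope \<open>S\<close> count as scratch, because sums nested
  in a compiled term overwrite them.\<close>

definition scratch :: "nat \<Rightarrow> nat set \<Rightarrow> int set" where
  "scratch r S = {adr 2 r' 0 | r'. r \<le> r'} \<union> {adr 1 x 0 | x. x \<notin> S}"

definition same :: "nat \<Rightarrow> nat set \<Rightarrow> mem \<Rightarrow> mem \<Rightarrow> bool" where
  "same r S m m' \<longleftrightarrow> (\<forall>a. a \<notin> scratch r S \<longrightarrow> m' a = m a)"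

lemma scratch_mono: "r' \<le> r \<Longrightarrow> S' \<subseteq> S \<Longrightarrow> scratch r S \<subseteq> scratch r' S'"
  by (auto simp: scratch_def)

lemma same_refl [simp]: "same r S m m"
  by (simp add: same_def)

lemma same_trans:
  "same r S m m' \<Longrightarrow> same r' S' m' m'' \<Longrightarrow> r0 \<le> r \<Longrightarrow> r0 \<le> r' \<Longrightarrow> S0 \<subseteq> S \<Longrightarrow> S0 \<subseteq> S' \<Longrightarrow>
    same r0 S0 m m''"
  using scratch_mono[of r0 r S0 S] scratch_mono[of r0 r' S0 S'] by (simp add: same_def subset_iff) metis

lemma same_upd: "a \<in> scratch r S \<Longrightarrow> same r S m m' \<Longrightarrow> same r S m (m'(a := v))"
  by (auto simp: same_def)

lemma adr2_scratch [simp]: "adr 2 r' 0 \<in> scratch r S \<longleftrightarrow> r \<le> r'"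
  by (auto simp: scratch_def adr_inj)

lemma adr1_scratch [simp]: "adr (Suc 0) x 0 \<in> scratch r S \<longleftrightarrow> x \<notin> S"
  by (auto simp: scratch_def adr_inj)

lemma adr_scratch:
  "adr 3 0 0 \<notin> scratch r S" "adr 0 i j \<notin> scratch r S" "4 \<le> a \<Longrightarrow> adr a i j \<notin> scratch r S"
  by (auto simp: scratch_def adr_inj adr_inj0)

lemma rep_same: "rep n S e \<sigma> m \<Longrightarrow> same r S m m' \<Longrightarrow> rep n S e \<sigma> m'"
  using adr1_scratch[of _ r S] by (auto simp: rep_def same_def adr_scratch)

lemma rep_upd: "rep n S e \<sigma> m \<Longrightarrow> m (adr 1 x 0) = int i \<Longrightarrow> rep n (insert x S) (e(x := i)) \<sigma> m"
  by (auto simp: rep_def)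

lemma rep_subset: "rep n S e \<sigma> m \<Longrightarrow> S' \<subseteq> S \<Longrightarrow> rep n S' e \<sigma> m"
  by (auto simp: rep_def)

lemma rep_env: "rep n S e \<sigma> m \<Longrightarrow> (\<And>x. x \<in> S \<Longrightarrow> e x = e' x) \<Longrightarrow> rep n S e' \<sigma> m"
  by (auto simp: rep_def)

fun loads :: "nat \<Rightarrow> mem \<Rightarrow> expr \<Rightarrow> bool" where
  "loads K m (Const z) \<longleftrightarrow> True"
| "loads K m (Load a) \<longleftrightarrow> loads K m a \<and> int_size (m (val a m)) \<le> K"
| "loads K m (Plus a b) \<longleftrightarrow> loads K m a \<and> loads K m b"
| "loads K m (Minus a b) \<longleftrightarrow> loads K m a \<and> loads K m b"
| "loads K m (Times a b) \<longleftrightarrow> loads K m a \<and> loads K m b"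
| "loads K m (Quot a b) \<longleftrightarrow> loads K m a \<and> loads K m b"

fun ecost :: "expr \<Rightarrow> nat" where
  "ecost (Const z) = int_size z"
| "ecost (Load a) = 2 * ecost a + 1"
| "ecost (Plus a b) = 2 * (ecost a + ecost b)"
| "ecost (Minus a b) = 2 * (ecost a + ecost b)"
| "ecost (Times a b) = 2 * (ecost a + ecost b)"
| "ecost (Quot a b) = 2 * (ecost a + ecost b)"

text \<open>Cost and size of the value are bounded together, because an operation is charged for the
  sizes of its operands; hence the factors 2 in \<open>ecost\<close>.\<close>

lemma cost_le: "loads K m a \<Longrightarrow> 1 \<le> K \<Longrightarrow> cost a m \<le> ecost a * K \<and> int_size (val a m) \<le> ecost a * K"
proof (induction a)
  case (Const z)
  then show ?case using mult_le_mono2[of 1 K "int_size z"] by simp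
next
  case (Plus a b)
  then show ?case using int_size_add[of "val a m" "val b m"] int_size_pos[of "val a m"] int_size_pos[of "val b m"]
    by (simp add: algebra_simps) linarith
next
  case (Minus a b)
  then show ?case using int_size_diff[of "val a m" "val b m"] int_size_pos[of "val a m"] int_size_pos[of "val b m"]
    by (simp add: algebra_simps) linarith
next
  case (Times a b)
  then show ?case using int_size_mult[of "val a m" "val b m"]
    by (simp add: algebra_simps)
next
  case (Quot a b)
  then show ?case using int_size_div[of "val a m" "val b m"]
    by (simp add: algebra_simps)
qed (auto simp: algebra_simps)

lemma exec_Store':
  assumes "loads K m a" "loads K m b" "1 \<le> K"
  shows "\<exists>T. exec (Store a b) m T (m(val a m := val b m)) \<and> T \<le> 2 * (ecost a + ecost b) * K"
  using cost_le[OF assms(1,3)] cost_le[OF assms(2,3)]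
  by (intro exI[of _ "cost a m + cost b m + int_size (val a m) + int_size (val b m)"] conjI exec.Store)
    (simp add: algebra_simps)

lemma val_adr_expr: "0 \<le> val i m \<Longrightarrow> 0 \<le> val j m \<Longrightarrow> ok_arr a t \<Longrightarrow>
    val (adr_expr a i j) m = adr a (nat (val i m)) (nat (val j m))"
  by (auto simp: adr_expr_def adr_def pr_expr_def pr_def ok_arr_def)

lemma loads_adr_expr: "loads K m i \<Longrightarrow> loads K m j \<Longrightarrow> loads K m (adr_expr a i j)"
  by (auto simp: adr_expr_def pr_expr_def)

lemma val_lim_expr: "rep n S e \<sigma> m \<Longrightarrow> val (lim_expr l) m = int (ln_of n l)"
  by (cases l) (auto simp: rep_def)

text \<open>The invariant is demanded after the loop variable has been increased, so
  \<open>P i\<close> always speaks of a memory at the loop test. The constants contain slack: in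
  units of \<open>?E * K\<close> the test costs at most 10, the initialisation and the increment at
  most 20 each.\<close>

lemma exec_loop:
  assumes P0: "P 0 (m(adr 1 x 0 := 0))"
    and step: "\<And>i m. i < k \<Longrightarrow> P i m \<Longrightarrow> m (adr 1 x 0) = int i \<Longrightarrow>
      \<exists>t m'. exec p m t m' \<and> t \<le> T \<and> m' (adr 1 x 0) = int i \<and> P (Suc i) (m'(adr 1 x 0 := int i + 1))"
    and lim: "\<And>i m. i \<le> k \<Longrightarrow> P i m \<Longrightarrow> val (lim_expr l) m = int k \<and> loads K m (lim_expr l)"
    and K: "int_size (int k) \<le> K"
  shows "\<exists>t m'. exec (loop x l p) m t m' \<and> P k m' \<and> m' (adr 1 x 0) = int k \<and>
    t \<le> (k + 1) * (T + 100 * (ecost (lim_expr l) + ecost (varA x) + 1) * K)"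
proof -
  let ?E = "ecost (lim_expr l) + ecost (varA x) + 1"
  let ?W = "Minus (lim_expr l) (var x)"
  let ?b = "Seq p (Store (varA x) (Plus (var x) (Const 1)))"
  have K1: "1 \<le> K" using K int_size_pos[of "int k"] by linarith
  have sz: "int_size (int i) \<le> K" if "i \<le> k" for i
    using that K int_size_mono[of "int i" "int k"] by auto
  have size0: "int_size 0 = 1" and size1: "int_size 1 = 2"
    by (simp_all add: int_size_def bitlen_def floorlog_def)
  have test: "cost ?W m + int_size (val ?W m) \<le> 10 * ?E * K \<and> val ?W m = int k - int i"
    if "i \<le> k" "P i m" "m (adr 1 x 0) = int i" for i m
    using cost_le[of K m ?W] lim[OF that(1,2)] sz[OF that(1)] that(3) K1
    by (simp add: algebra_simps)
  have main: "\<exists>t m'. exec (While ?W ?b) m t m' \<and> P k m' \<and> m' (adr 1 x 0) = int k \<and>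
      t \<le> (k - i + 1) * (T + 50 * ?E * K)"
    if "i \<le> k" "P i m" "m (adr 1 x 0) = int i" for i m
    using that
  proof (induction "k - i" arbitrary: i m)
    case 0
    then have "i = k" by simp
    with 0 test[OF 0(2-4)] have neg: "\<not> 0 < val ?W m" by simp
    show ?case
      using test[OF 0(2-4)] 0 \<open>i = k\<close>
      by (intro exI[of _ m] exI[of _ "cost ?W m + int_size (val ?W m)"] conjI exec.WhileFalse[OF neg])
        (auto simp: algebra_simps)
  next
    case (Suc d)
    then have "i < k" by simp
    with test[OF Suc(3-5)] have pos: "0 < val ?W m" by simp
    from step[OF \<open>i < k\<close> Suc(4,5)] obtain t m' where
      1: "exec p m t m'" "t \<le> T" "m' (adr 1 x 0) = int i" "P (Suc i) (m'(adr 1 x 0 := int i + 1))"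
      by blast
    have "loads K m' (Plus (var x) (Const 1))" using 1(3) sz[OF Suc(3)] by simp
    from exec_Store'[OF _ this K1, of "varA x"] obtain t2 where
      "exec (Store (varA x) (Plus (var x) (Const 1))) m' t2
        (m'(val (varA x) m' := val (Plus (var x) (Const 1)) m'))"
      "t2 \<le> 2 * (ecost (varA x) + ecost (Plus (var x) (Const 1))) * K" by auto
    then have 2: "exec (Store (varA x) (Plus (var x) (Const 1))) m' t2 (m'(adr 1 x 0 := int i + 1))"
        "t2 \<le> 20 * ?E * K" using 1(3) by (simp_all add: size1 algebra_simps)
    have d: "d = k - Suc i" using Suc by simp
    from Suc(1)[OF d _ 1(4)] \<open>i < k\<close> obtain t3 m'' where
      3: "exec (While ?W ?b) (m'(adr 1 x 0 := int i + 1)) t3 m''" "P k m''" "m'' (adr 1 x 0) = int k"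
        "t3 \<le> (k - Suc i + 1) * (T + 50 * ?E * K)" by auto
    have "cost ?W m + int_size (val ?W m) + (t + t2) + t3 \<le>
        10 * ?E * K + (T + 20 * ?E * K) + (k - Suc i + 1) * (T + 50 * ?E * K)"
      using test[OF Suc(3-5)] 1(2) 2(2) 3(4) by linarith
    also have "\<dots> \<le> (T + 50 * ?E * K) + (k - Suc i + 1) * (T + 50 * ?E * K)"
      by (simp add: algebra_simps)
    also have "\<dots> = (k - i + 1) * (T + 50 * ?E * K)"
      using Suc_diff_Suc[OF \<open>i < k\<close>, symmetric] by simp
    finally show ?case
      using exec.WhileTrue[OF pos exec.Seq[OF 1(1) 2(1)] 3(1)] 3(2,3) by blast
  qed
  from exec_Store'[of K m "varA x" "Const 0"] K1 obtain t1 where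
    "exec (Store (varA x) (Const 0)) m t1 (m(val (varA x) m := val (Const 0) m))"
    "t1 \<le> 2 * (ecost (varA x) + ecost (Const 0)) * K" by auto
  then have 1: "exec (Store (varA x) (Const 0)) m t1 (m(adr 1 x 0 := 0))" "t1 \<le> 20 * ?E * K"
    by (simp_all add: size0 algebra_simps)
  from main[of 0, OF _ P0] obtain t2 m' where
    2: "exec (While ?W ?b) (m(adr 1 x 0 := 0)) t2 m'" "P k m'" "m' (adr 1 x 0) = int k"
      "t2 \<le> (k + 1) * (T + 50 * ?E * K)" by auto
  have "t1 + t2 \<le> 20 * ?E * K + (k + 1) * (T + 50 * ?E * K)" using 1(2) 2(4) by linarith
  also have "\<dots> \<le> (k + 1) * (50 * ?E * K) + (k + 1) * (T + 50 * ?E * K)"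
    by (simp add: algebra_simps)
  also have "\<dots> = (k + 1) * (T + 100 * ?E * K)" by (simp add: algebra_simps)
  finally show ?thesis
    unfolding loop_def using exec.Seq[OF 1(1) 2(1)] 2(2,3) by blast
qed


section \<open>Total correctness with time bounds, and compiled terms\<close>

definition hoare :: "prog \<Rightarrow> mem \<Rightarrow> nat \<Rightarrow> (mem \<Rightarrow> bool) \<Rightarrow> bool" where
  "hoare p m K Q \<longleftrightarrow> (\<exists>t m'. exec p m t m' \<and> t \<le> K \<and> Q m')"

lemma hoare_weaken: "hoare p m K Q \<Longrightarrow> K \<le> K' \<Longrightarrow> (\<And>m'. Q m' \<Longrightarrow> Q' m') \<Longrightarrow> hoare p m K' Q'"
  unfolding hoare_def by (meson le_trans)

lemma hoare_Seq:
  assumes "hoare p m K (\<lambda>m'. hoare q m' K' Q)"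
  shows "hoare (Seq p q) m (K + K') Q"
  using assms unfolding hoare_def by (meson exec.Seq add_mono)

lemma hoare_Store:
  assumes "loads K m a" "loads K m b" "1 \<le> K" "Q (m(val a m := val b m))" "2 * (ecost a + ecost b) * K \<le> K'"
  shows "hoare (Store a b) m K' Q"
  using exec_Store'[OF assms(1-3)] assms(4,5) unfolding hoare_def by (meson le_trans)

lemma hoare_Cond:
  assumes "loads K m c" "1 \<le> K" "0 < val c m \<Longrightarrow> hoare p m K1 Q" "\<not> 0 < val c m \<Longrightarrow> hoare q m K2 Q"
  shows "hoare (Cond c p q) m (2 * ecost c * K + K1 + K2) Q"
proof (cases "0 < val c m")
  case True
  with assms(3) obtain t m' where "exec p m t m'" "t \<le> K1" "Q m'" by (auto simp: hoare_def)
  then show ?thesis unfolding hoare_def using cost_le[OF assms(1,2)] True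
    by (intro exI[of _ m'] exI[of _ "cost c m + int_size (val c m) + t"] conjI exec.CondTrue) auto
next
  case False
  with assms(4) obtain t m' where "exec q m t m'" "t \<le> K2" "Q m'" by (auto simp: hoare_def)
  then show ?thesis unfolding hoare_def using cost_le[OF assms(1,2)] False
    by (intro exI[of _ m'] exI[of _ "cost c m + int_size (val c m) + t"] conjI exec.CondFalse) auto
qed

text \<open>The shape of all bounds: polynomial in \<open>n\<close>, but linear in the size
  \<open>B\<close>. This class is closed under sums, loops and the substitution of one bound for the
  size in another, which is what sequential composition requires.\<close>

definition mono_bd :: "nat \<Rightarrow> nat \<Rightarrow> nat \<Rightarrow> nat \<Rightarrow> nat" where
  "mono_bd C d n B = C * (n + 1) ^ d * B"

lemma mono_bd_le: "C \<le> C' \<Longrightarrow> d \<le> d' \<Longrightarrow> B \<le> B' \<Longrightarrow> mono_bd C d n B \<le> mono_bd C' d' n B'"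
  unfolding mono_bd_def by (intro mult_mono power_increasing) auto

lemma mono_bd_add: "mono_bd C d n B + mono_bd C' d' n B \<le> mono_bd (C + C') (d + d') n B"
  using mono_bd_le[of C C d "d + d'" B B n] mono_bd_le[of C' C' d' "d + d'" B B n]
  by (simp only: mono_bd_def distrib_right) linarith

lemma mono_bd_const: "C * B = mono_bd C 0 n B"
  by (simp add: mono_bd_def)

lemma mono_bd_lim: "(ln_of n l + 1) * mono_bd C d n B \<le>
    mono_bd ((case l of LC k \<Rightarrow> k + 1 | LN \<Rightarrow> 1) * C) (Suc d) n B"
proof (cases l)
  case (LC k)
  have "1 * ((k + 1) * mono_bd C d n B) \<le> (n + 1) * ((k + 1) * mono_bd C d n B)"
    by (rule mult_le_mono1) simp
  also have "\<dots> = mono_bd ((k + 1) * C) (Suc d) n B"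
    unfolding mono_bd_def power_Suc by (simp only: mult_ac)
  finally show ?thesis using LC by simp
qed (simp add: mono_bd_def mult_ac)

lemma bnd_ge1: "bnd H n S e \<sigma> B B' \<Longrightarrow> 1 \<le> B"
  by (simp add: bnd_def)

lemma int_size_tv0:
  assumes "wft S t" "bnd {} n S e \<sigma> B 0" "\<And>k. k \<in> lims t \<Longrightarrow> int_size (int k) \<le> B"
  shows "int_size (tv n e \<sigma> t) \<le> wt t * B"
  using int_size_tv[OF assms] by simp

text \<open>The constants depend on the term alone and not on the input. A term changes no array, so
  one bound \<open>B\<close> covers the whole state.\<close>

definition comp_ok :: "nat set \<Rightarrow> tm \<Rightarrow> nat \<Rightarrow> nat \<Rightarrow> nat \<Rightarrow> bool" where
  "comp_ok S t r C d \<longleftrightarrow> (\<forall>n e \<sigma> m B. rep n S e \<sigma> m \<longrightarrow> bnd {} n S e \<sigma> B 0 \<longrightarrow>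
     (\<forall>k\<in>lims t. int_size (int k) \<le> B) \<longrightarrow>
     hoare (comp t r) m (mono_bd C d n B) (\<lambda>m'. m' (adr 2 r 0) = tv n e \<sigma> t \<and> same r S m m'))"

lemma comp_okD:
  "comp_ok S t r C d \<Longrightarrow> rep n S e \<sigma> m \<Longrightarrow> bnd {} n S e \<sigma> B 0 \<Longrightarrow>
    (\<And>k. k \<in> lims t \<Longrightarrow> int_size (int k) \<le> B) \<Longrightarrow>
    hoare (comp t r) m (mono_bd C d n B) (\<lambda>m'. m' (adr 2 r 0) = tv n e \<sigma> t \<and> same r S m m')"
  by (simp add: comp_ok_def)

lemma same_reg: "same (Suc r) S m m' \<Longrightarrow> m' (adr 2 r 0) = m (adr 2 r 0)"
  by (simp add: same_def)

lemma comp_binary: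
  assumes ok: "comp_ok S s r C d" "comp_ok S t (Suc r) C' d'"
    and wf: "wft S s" "wft S t"
    and rep: "rep n S e \<sigma> m" and b: "bnd {} n S e \<sigma> B 0"
    and lims: "\<And>k. k \<in> lims s \<union> lims t \<Longrightarrow> int_size (int k) \<le> B"
    and fin: "\<And>m'. m' (adr 2 r 0) = tv n e \<sigma> s \<Longrightarrow> m' (adr 2 (Suc r) 0) = tv n e \<sigma> t \<Longrightarrow> same r S m m' \<Longrightarrow>
      int_size (m' (adr 2 r 0)) \<le> (wt s + wt t) * B \<Longrightarrow>
      int_size (m' (adr 2 (Suc r) 0)) \<le> (wt s + wt t) * B \<Longrightarrow>
      hoare p m' (K * B) Q"
  shows "hoare (Seq (comp s r) (Seq (comp t (Suc r)) p)) m (mono_bd (C + C' + K) (d + d') n B) Q"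
proof -
  have sz: "int_size (tv n e \<sigma> s) \<le> (wt s + wt t) * B" "int_size (tv n e \<sigma> t) \<le> (wt s + wt t) * B"
    using int_size_tv0[OF wf(1) b] int_size_tv0[OF wf(2) b] lims
    by (simp_all add: trans_le_add1 trans_le_add2 algebra_simps)
  have "hoare (Seq (comp s r) (Seq (comp t (Suc r)) p)) m
      (mono_bd C d n B + (mono_bd C' d' n B + K * B)) Q"
  proof (rule hoare_Seq, rule hoare_weaken[OF comp_okD[OF ok(1) rep b]])
    fix m1 assume 1: "m1 (adr 2 r 0) = tv n e \<sigma> s \<and> same r S m m1"
    then have "rep n S e \<sigma> m1" using rep rep_same by blast
    show "hoare (Seq (comp t (Suc r)) p) m1 (mono_bd C' d' n B + K * B) Q"
    proof (rule hoare_Seq, rule hoare_weaken[OF comp_okD[OF ok(2) \<open>rep n S e \<sigma> m1\<close> b]])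
      fix m2 assume 2: "m2 (adr 2 (Suc r) 0) = tv n e \<sigma> t \<and> same (Suc r) S m1 m2"
      show "hoare p m2 (K * B) Q"
      proof (rule fin)
        show "m2 (adr 2 r 0) = tv n e \<sigma> s" using 1 2 same_reg by metis
        then show "int_size (m2 (adr 2 r 0)) \<le> (wt s + wt t) * B" using sz by simp
        show "m2 (adr 2 (Suc r) 0) = tv n e \<sigma> t" using 2 by simp
        then show "int_size (m2 (adr 2 (Suc r) 0)) \<le> (wt s + wt t) * B" using sz by simp
        show "same r S m m2" using 1 2 by (auto elim: same_trans)
      qed
    qed (use lims in auto)
  qed (use lims in auto)
  then show ?thesis
  proof (rule hoare_weaken)
    have "mono_bd C d n B + (mono_bd C' d' n B + K * B) = mono_bd C d n B + mono_bd (C') d' n B + mono_bd K 0 n B"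
      by (simp add: mono_bd_def)
    also have "\<dots> \<le> mono_bd (C + C') (d + d') n B + mono_bd K 0 n B"
      using mono_bd_add by simp
    also have "\<dots> \<le> mono_bd (C + C' + K) (d + d' + 0) n B" by (rule mono_bd_add)
    finally show "mono_bd C d n B + (mono_bd C' d' n B + K * B) \<le> mono_bd (C + C' + K) (d + d') n B" by simp
  qed
qed

lemma comp_unary:
  assumes "\<And>n e \<sigma> m B. rep n S e \<sigma> m \<Longrightarrow> bnd {} n S e \<sigma> B 0 \<Longrightarrow>
      loads B m a \<and> val a m = tv n e \<sigma> t"
    and "comp t r = Store (regA r) a"
  shows "comp_ok S t r (2 * (int_size (adr 2 r 0) + ecost a)) 0"
  unfolding comp_ok_def assms(2)
proof (intro allI impI)
  fix n e \<sigma> m B assume *: "rep n S e \<sigma> m" "bnd {} n S e \<sigma> B 0"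
  from assms(1)[OF this] bnd_ge1[OF *(2)]
  show "hoare (Store (regA r) a) m (mono_bd (2 * (int_size (adr 2 r 0) + ecost a)) 0 n B)
      (\<lambda>m'. m' (adr 2 r 0) = tv n e \<sigma> t \<and> same r S m m')"
    by (intro hoare_Store[of B]) (auto simp: mono_bd_def intro: same_upd)
qed

lemma comp_op:
  assumes ok: "comp_ok S s r C d" "comp_ok S t (Suc r) C' d'" and wf: "wft S s" "wft S t"
    and u: "comp u r = Seq (comp s r) (Seq (comp t (Suc r)) (Store (regA r) a))"
    and l: "lims u = lims s \<union> lims t"
    and v: "\<And>n e \<sigma> m S B K. m (adr 2 r 0) = tv n e \<sigma> s \<Longrightarrow> m (adr 2 (Suc r) 0) = tv n e \<sigma> t \<Longrightarrow>
      int_size (m (adr 2 r 0)) \<le> K \<Longrightarrow> int_size (m (adr 2 (Suc r) 0)) \<le> K \<Longrightarrow>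
      rep n S e \<sigma> m \<Longrightarrow> bnd {} n S e \<sigma> B 0 \<Longrightarrow> B \<le> K \<Longrightarrow>
      val a m = tv n e \<sigma> u \<and> loads K m a"
  shows "\<exists>C d. comp_ok S u r C d"
proof -
  define K where "K = 2 * (int_size (adr 2 r 0) + ecost a) * (wt s + wt t + 1)"
  have "comp_ok S u r (C + C' + K) (d + d')"
    unfolding comp_ok_def u
  proof (intro allI impI)
    fix n e \<sigma> m B
    assume rep: "rep n S e \<sigma> m" and b: "bnd {} n S e \<sigma> B 0" and l': "\<forall>k\<in>lims u. int_size (int k) \<le> B"
    show "hoare (Seq (comp s r) (Seq (comp t (Suc r)) (Store (regA r) a))) m
        (mono_bd (C + C' + K) (d + d') n B) (\<lambda>m'. m' (adr 2 r 0) = tv n e \<sigma> u \<and> same r S m m')"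
    proof (rule comp_binary[OF ok wf rep b])
      show "int_size (int k) \<le> B" if "k \<in> lims s \<union> lims t" for k using l' l that by auto
      fix m' assume *: "m' (adr 2 r 0) = tv n e \<sigma> s" "m' (adr 2 (Suc r) 0) = tv n e \<sigma> t" "same r S m m'"
        "int_size (m' (adr 2 r 0)) \<le> (wt s + wt t) * B"
        "int_size (m' (adr 2 (Suc r) 0)) \<le> (wt s + wt t) * B"
      have "rep n S e \<sigma> m'" using rep *(3) rep_same by blast
      then have "val a m' = tv n e \<sigma> u \<and> loads ((wt s + wt t + 1) * B) m' a"
        using * b by (intro v[of _ _ _ _ _ S B]) (auto simp: algebra_simps)
      then show "hoare (Store (regA r) a) m' (K * B) (\<lambda>m'. m' (adr 2 r 0) = tv n e \<sigma> u \<and> same r S m m')"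
        using *(3) bnd_ge1[OF b]
        by (intro hoare_Store[of "(wt s + wt t + 1) * B"]) (auto simp: K_def algebra_simps intro: same_upd)
    qed
  qed
  then show ?thesis by blast
qed

lemma comp_exec: "wft S t \<Longrightarrow> \<exists>C d. comp_ok S t r C d"
proof (induction t arbitrary: S r)
  case (TC c)
  show ?case by (rule exI, rule exI, rule comp_unary) auto
next
  case TN
  show ?case by (rule exI, rule exI, rule comp_unary) (auto simp: rep_def bnd_def)
next
  case (TV x)
  have "comp_ok S (TV x) r (2 * (int_size (adr 2 r 0) + ecost (var x))) 0"
    using TV by (intro comp_unary) (auto simp: rep_def bnd_def)
  then show ?case by blast
next
  case (TA a s t)
  then have wf: "wft S s" "wft S t" and nn: "nonneg s" "nonneg t" and ok: "ok_arr a t" by auto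
  from TA.IH(1)[OF wf(1)] TA.IH(2)[OF wf(2)] obtain C d C' d' where
    IH: "comp_ok S s r C d" "comp_ok S t (Suc r) C' d'" by metis
  show ?case
  proof (rule comp_op[OF IH wf])
    fix n e \<sigma> m S B K
    assume *: "m (adr 2 r 0) = tv n e \<sigma> s" "m (adr 2 (Suc r) 0) = tv n e \<sigma> t"
      "int_size (m (adr 2 r 0)) \<le> K" "int_size (m (adr 2 (Suc r) 0)) \<le> K"
      and rep: "rep n S e \<sigma> m" and b: "bnd {} n S e \<sigma> B 0" and "B \<le> K"
    have adr: "val (adr_expr a (reg r) (reg (Suc r))) m = adr a (nat (tv n e \<sigma> s)) (nat (tv n e \<sigma> t))"
      using ok * nonneg_tv[OF nn(1), of n e \<sigma>] nonneg_tv[OF nn(2), of n e \<sigma>] by (subst val_adr_expr) auto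
    moreover have "m (adr a (nat (tv n e \<sigma> s)) (nat (tv n e \<sigma> t))) = tv n e \<sigma> (TA a s t)"
      using rep ok by (auto simp: rep_def ok_arr_def)
    moreover have "int_size (tv n e \<sigma> (TA a s t)) \<le> K"
      using b \<open>B \<le> K\<close> by (simp add: bnd_def) (meson le_trans)
    ultimately show "val (Load (adr_expr a (reg r) (reg (Suc r)))) m = tv n e \<sigma> (TA a s t) \<and>
        loads K m (Load (adr_expr a (reg r) (reg (Suc r))))"
      using * by (auto intro: loads_adr_expr)
  qed auto
next
  case (TAdd s t)
  then have wf: "wft S s" "wft S t" by auto
  from TAdd.IH(1)[OF wf(1)] TAdd.IH(2)[OF wf(2)] obtain C d C' d' where
    IH: "comp_ok S s r C d" "comp_ok S t (Suc r) C' d'" by metis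
  show ?case by (rule comp_op[OF IH wf]) auto
next
  case (TSub s t)
  then have wf: "wft S s" "wft S t" by auto
  from TSub.IH(1)[OF wf(1)] TSub.IH(2)[OF wf(2)] obtain C d C' d' where
    IH: "comp_ok S s r C d" "comp_ok S t (Suc r) C' d'" by metis
  show ?case by (rule comp_op[OF IH wf]) auto
next
  case (TMul s t)
  then have wf: "wft S s" "wft S t" by auto
  from TMul.IH(1)[OF wf(1)] TMul.IH(2)[OF wf(2)] obtain C d C' d' where
    IH: "comp_ok S s r C d" "comp_ok S t (Suc r) C' d'" by metis
  show ?case by (rule comp_op[OF IH wf]) auto
next
  case (TDiv s t)
  then have wf: "wft S s" "wft S t" by auto
  from TDiv.IH(1)[OF wf(1)] TDiv.IH(2)[OF wf(2)] obtain C d C' d' where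
    IH: "comp_ok S s r C d" "comp_ok S t (Suc r) C' d'" by metis
  show ?case by (rule comp_op[OF IH wf]) auto
next
  case (TIf c s t)
  then have wf: "wft S c" "wft S s" "wft S t" by auto
  from TIf.IH(1)[OF wf(1)] TIf.IH(2)[OF wf(2)] TIf.IH(3)[OF wf(3)] obtain C d C1 d1 C2 d2 where
    IH: "comp_ok S c r C d" "comp_ok S s r C1 d1" "comp_ok S t r C2 d2" by metis
  define K where "K = 2 * ecost (reg r) * (wt c + 1)"
  have "comp_ok S (TIf c s t) r (C + K + C1 + C2) (d + d1 + d2)"
    unfolding comp_ok_def comp.simps
  proof (intro allI impI)
    fix n e \<sigma> m B
    assume rep: "rep n S e \<sigma> m" and b: "bnd {} n S e \<sigma> B 0"
      and l: "\<forall>k\<in>lims (TIf c s t). int_size (int k) \<le> B"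
    let ?Q = "\<lambda>m'. m' (adr 2 r 0) = tv n e \<sigma> (TIf c s t) \<and> same r S m m'"
    have "hoare (Seq (comp c r) (Cond (reg r) (comp s r) (comp t r))) m
        (mono_bd C d n B + (2 * ecost (reg r) * ((wt c + 1) * B) + mono_bd C1 d1 n B + mono_bd C2 d2 n B)) ?Q"
    proof (rule hoare_Seq, rule hoare_weaken[OF comp_okD[OF IH(1) rep b]])
      fix m' assume 1: "m' (adr 2 r 0) = tv n e \<sigma> c \<and> same r S m m'"
      then have rep': "rep n S e \<sigma> m'" using rep rep_same by blast
      have "int_size (tv n e \<sigma> c) \<le> wt c * B" using l by (intro int_size_tv0[OF wf(1) b]) auto
      then show "hoare (Cond (reg r) (comp s r) (comp t r)) m'
          (2 * ecost (reg r) * ((wt c + 1) * B) + mono_bd C1 d1 n B + mono_bd C2 d2 n B) ?Q"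
        using 1 bnd_ge1[OF b] l
        by (intro hoare_Cond)
          (auto intro!: hoare_weaken[OF comp_okD[OF IH(2) rep' b]] hoare_weaken[OF comp_okD[OF IH(3) rep' b]]
             intro: same_trans[where S = S and S' = S and r = r and r' = r])
    qed (use l in auto)
    then show "hoare (Seq (comp c r) (Cond (reg r) (comp s r) (comp t r))) m
        (mono_bd (C + K + C1 + C2) (d + d1 + d2) n B) ?Q"
    proof (rule hoare_weaken)
      have "mono_bd C d n B + (2 * ecost (reg r) * ((wt c + 1) * B) + mono_bd C1 d1 n B + mono_bd C2 d2 n B)
        = mono_bd C d n B + mono_bd K 0 n B + mono_bd C1 d1 n B + mono_bd C2 d2 n B"
        by (simp add: K_def mono_bd_def algebra_simps)
      also have "\<dots> \<le> mono_bd (C + K + C1 + C2) (d + 0 + d1 + d2) n B"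
        by (meson mono_bd_add add_right_mono order_trans)
      finally show "mono_bd C d n B + (2 * ecost (reg r) * ((wt c + 1) * B) + mono_bd C1 d1 n B + mono_bd C2 d2 n B)
        \<le> mono_bd (C + K + C1 + C2) (d + d1 + d2) n B" by simp
    qed
  qed
  then show ?case by blast
next
  case (TSum x l t)
  then have wf: "wft (insert x S) t" and x: "x \<notin> S" by auto
  from TSum.IH[OF wf] obtain C d where IH: "comp_ok (insert x S) t (Suc r) C d" by metis
  let ?p = "Seq (comp t (Suc r)) (Store (regA r) (Plus (reg r) (reg (Suc r))))"
  define E where "E = 2 * (ecost (regA r) + ecost (Plus (reg r) (reg (Suc r)))) * (wt t + 1)"
  define F where "F = 100 * (ecost (lim_expr l) + ecost (varA x) + 1)"
  define G where "G = 2 * (ecost (regA r) + ecost (Const 0))"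
  define c where "c = (case l of LC k \<Rightarrow> k + 1 | LN \<Rightarrow> 1)"
  have "comp_ok S (TSum x l t) r (G + c * (C + E + F)) (Suc d)"
    unfolding comp_ok_def comp.simps
  proof (intro allI impI)
    fix n e \<sigma> m B
    assume rep: "rep n S e \<sigma> m" and b: "bnd {} n S e \<sigma> B 0"
      and lm: "\<forall>k\<in>lims (TSum x l t). int_size (int k) \<le> B"
    let ?k = "ln_of n l"
    let ?f = "\<lambda>i. tv n (e(x := i)) \<sigma> t"
    let ?Q = "\<lambda>m'. m' (adr 2 r 0) = tv n e \<sigma> (TSum x l t) \<and> same r S m m'"
    \<comment> \<open>Register \<open>r\<close> accumulates the partial sum, while the summands are
      computed in register \<open>Suc r\<close>.\<close>
    define P where "P i m' \<longleftrightarrow> same r S m m' \<and> m' (adr 2 r 0) = (\<Sum>j<i. ?f j)" for i m'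
    have B1: "1 \<le> B" using bnd_ge1[OF b] .
    have kB: "int_size (int ?k) \<le> B" using b lm by (cases l) (auto simp: bnd_def)
    have bu: "bnd {} n (insert x S) (e(x := i)) \<sigma> B 0" if "i < ?k" for i
      using b lm that by (intro bnd_upd[where l = l]) auto
    have szt: "int_size (?f i) \<le> wt t * B" if "i < ?k" for i
      using lm by (intro int_size_tv0[OF wf bu[OF that]]) auto
    have szs: "int_size (\<Sum>j<i. ?f j) \<le> (wt t + 1) * B" if "i \<le> ?k" for i
    proof -
      have "int_size (int i) \<le> B" using kB int_size_mono[of "int i" "int ?k"] that by simp
      then show ?thesis using int_size_sum[of i ?f "wt t * B"] szt that by simp
    qed
    have "hoare (loop x l ?p) (m(adr 2 r 0 := 0))
        ((?k + 1) * ((mono_bd C d n B + E * B) + F * B)) (\<lambda>m'. P ?k m')"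
    proof -
      have "\<exists>t' m'. exec (loop x l ?p) (m(adr 2 r 0 := 0)) t' m' \<and> P ?k m' \<and> m' (adr 1 x 0) = int ?k \<and>
          t' \<le> (?k + 1) * ((mono_bd C d n B + E * B) + 100 * (ecost (lim_expr l) + ecost (varA x) + 1) * B)"
      proof (rule exec_loop)
        show "P 0 (m(adr 2 r 0 := 0, adr 1 x 0 := 0))"
          using x by (auto simp: P_def adr_inj intro!: same_upd)
      next
        fix i m1 assume i: "i < ?k" and P: "P i m1" and xi: "m1 (adr 1 x 0) = int i"
        have rep1: "rep n (insert x S) (e(x := i)) \<sigma> m1"
          using P rep xi rep_same rep_upd by (metis P_def)
        have "hoare ?p m1 (mono_bd C d n B + E * B)
            (\<lambda>m'. m' (adr 1 x 0) = int i \<and> P (Suc i) (m'(adr 1 x 0 := int i + 1)))"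
        proof (rule hoare_Seq, rule hoare_weaken[OF comp_okD[OF IH rep1 bu[OF i]]])
          fix m2 assume 2: "m2 (adr 2 (Suc r) 0) = ?f i \<and> same (Suc r) (insert x S) m1 m2"
          have r2: "m2 (adr 2 r 0) = (\<Sum>j<i. ?f j)" using 2 same_reg P P_def by metis
          have x2: "m2 (adr 1 x 0) = int i" using 2 xi by (simp add: same_def)
          have s2: "same r S m m2" using P 2 by (auto simp: P_def intro: same_trans[where r = r and r' = "Suc r"])
          show "hoare (Store (regA r) (Plus (reg r) (reg (Suc r)))) m2 (E * B)
            (\<lambda>m'. m' (adr 1 x 0) = int i \<and> P (Suc i) (m'(adr 1 x 0 := int i + 1)))"
            using r2 x2 s2 2 szt[OF i] szs[of i] i B1 x
            by (intro hoare_Store[of "(wt t + 1) * B"])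
              (auto simp: E_def P_def adr_inj algebra_simps intro!: same_upd)
        qed (use lm in auto)
        then show "\<exists>t' m'. exec ?p m1 t' m' \<and> t' \<le> mono_bd C d n B + E * B \<and>
            m' (adr 1 x 0) = int i \<and> P (Suc i) (m'(adr 1 x 0 := int i + 1))"
          unfolding hoare_def by blast
      next
        fix i m1 assume "P i m1"
        then have "rep n S e \<sigma> m1" using rep rep_same P_def by blast
        then show "val (lim_expr l) m1 = int ?k \<and> loads B m1 (lim_expr l)"
          using val_lim_expr kB by (cases l) (auto simp: rep_def)
      qed (rule kB)
      then show ?thesis unfolding hoare_def F_def by blast
    qed
    then have "hoare (Seq (Store (regA r) (Const 0)) (loop x l ?p)) m
        (G * B + (?k + 1) * ((mono_bd C d n B + E * B) + F * B)) ?Q"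
      using B1 by (intro hoare_Seq hoare_Store[of B])
        (auto simp: G_def P_def elim!: hoare_weaken)
    then show "hoare (Seq (Store (regA r) (Const 0)) (loop x l ?p)) m
        (mono_bd (G + c * (C + E + F)) (Suc d) n B) ?Q"
    proof (rule hoare_weaken)
      have "mono_bd C d n B + E * B + F * B \<le> mono_bd (C + E + F) d n B"
        using mono_bd_add[of C d n B E 0] mono_bd_add[of "C + E" d n B F 0]
        by (simp add: mono_bd_const[symmetric])
      then have "(?k + 1) * (mono_bd C d n B + E * B + F * B) \<le> (?k + 1) * mono_bd (C + E + F) d n B"
        by (rule mult_le_mono2)
      also have "\<dots> \<le> mono_bd (c * (C + E + F)) (Suc d) n B"
        unfolding c_def by (rule mono_bd_lim)
      finally show "G * B + (?k + 1) * (mono_bd C d n B + E * B + F * B) \<le> mono_bd (G + c * (C + E + F)) (Suc d) n B"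
        using mono_bd_add[of G 0 n B "c * (C + E + F)" "Suc d"] by (simp add: mono_bd_const[symmetric])
    qed
  qed
  then show ?case by blast
qed

section \<open>Compiled statements\<close>

lemma mono_bd_nest: "mono_bd C d n (mono_bd C' d' n B) = mono_bd (C * C') (d + d') n B"
  by (simp add: mono_bd_def power_add mult_ac)

lemma bnd_collapse: "bnd H n S e \<sigma> B B' \<Longrightarrow> bnd {} n S e \<sigma> (B + B') 0"
  by (simp add: bnd_def) (meson trans_le_add1 trans_le_add2)

lemma bnd_weaken: "bnd H n S e \<sigma> B B' \<Longrightarrow> B' \<le> B'' \<Longrightarrow> bnd H n S e \<sigma> B B''"
  by (simp add: bnd_def) (meson order_trans)

lemma bnd_env: "bnd H n S e \<sigma> B B' \<Longrightarrow> S' \<subseteq> S \<Longrightarrow> (\<And>x. x \<in> S' \<Longrightarrow> e x = e' x) \<Longrightarrow> bnd H n S' e' \<sigma> B B'"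
  by (simp add: bnd_def subset_iff) metis

lemma rep_var: "rep n S e \<sigma> m \<Longrightarrow> x \<notin> S \<Longrightarrow> rep n S e \<sigma> (m(adr 1 x 0 := v))"
  by (rule rep_same[where r = 0]) (auto intro: same_upd)

lemma rep_set:
  assumes "rep n S e \<sigma> m" "ok_arr a (j :: tm)" "a = 0 \<Longrightarrow> j' = 0"
  shows "rep n S e (\<sigma>(a := (\<sigma> a)(i := (\<sigma> a i)(j' := v)))) (m(adr a i j' := v))"
proof -
  have "adr 3 0 0 \<noteq> adr a i j'" "\<And>x. adr 1 x 0 \<noteq> adr a i j'"
    using assms(2) by (auto simp: adr_inj ok_arr_def)
  then show ?thesis
    using assms by (auto simp: rep_def adr_inj adr_inj0)
qed

text \<open>The growth of \<open>B'\<close> is bounded by a quantity free of \<open>B'\<close>.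
  Repeated polynomially often it therefore stays polynomial, whereas growth proportional to
  \<open>B'\<close> would become exponential in a loop.\<close>

definition comps_ok :: "nat set \<Rightarrow> nat set \<Rightarrow> st \<Rightarrow> nat \<Rightarrow> nat \<Rightarrow> bool" where
  "comps_ok H S s C d \<longleftrightarrow> (\<forall>n e \<sigma> m B B'. rep n S e \<sigma> m \<longrightarrow> bnd H n S e \<sigma> B B' \<longrightarrow>
     (\<forall>k\<in>limss s. int_size (int k) \<le> B) \<longrightarrow>
     bnd H n S e (run n e s \<sigma>) B (B' + mono_bd C d n B) \<and>
     hoare (comps s) m (mono_bd C d n (B + B')) (rep n S e (run n e s \<sigma>)))"

lemma comps_okD:
  assumes "comps_ok H S s C d" "rep n S e \<sigma> m" "bnd H n S e \<sigma> B B'"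
    "\<And>k. k \<in> limss s \<Longrightarrow> int_size (int k) \<le> B"
  shows "bnd H n S e (run n e s \<sigma>) B (B' + mono_bd C d n B)"
    "hoare (comps s) m (mono_bd C d n (B + B')) (rep n S e (run n e s \<sigma>))"
  using assms by (auto simp: comps_ok_def)

text \<open>The growth claim concerns states only, but \<open>comps_ok\<close> has it under
  \<open>rep\<close>; so some memory representing the given state is exhibited. It decodes each
  address, which the injectivity of \<open>adr\<close> permits.\<close>

lemma comps_bnd:
  assumes "comps_ok H S s C d" "bnd H n S e \<sigma> B B'"
    "\<And>k. k \<in> limss s \<Longrightarrow> int_size (int k) \<le> B"
  shows "bnd H n S e (run n e s \<sigma>) B (B' + mono_bd C d n B)"
proof -
  define m :: mem where "m z =
    (if \<exists>i. z = adr 0 i 0 then \<sigma> 0 (nat z) 0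
     else if z = adr 3 0 0 then int n
     else if \<exists>x. z = adr 1 x 0 then int (e (SOME x. z = adr 1 x 0))
     else (case SOME (a, i, j). a > 0 \<and> z = adr a i j of (a, i, j) \<Rightarrow> \<sigma> a i j))" for z
  have "rep n S e \<sigma> m"
    unfolding rep_def
  proof (intro conjI ballI allI impI)
    show "m boundA = int n" by (auto simp: m_def adr_inj)
    show "m (adr 1 x 0) = int (e x)" for x by (auto simp: m_def adr_inj)
    show "m (adr 0 i 0) = \<sigma> 0 i 0" for i by (auto simp: m_def adr_inj0 adr_def)
    fix a i j :: nat assume "4 \<le> a"
    then have "(SOME (a', i', j'). a' > 0 \<and> adr a i j = adr a' i' j') = (a, i, j)"
      by (intro some_equality) (auto simp: adr_inj)
    then show "m (adr a i j) = \<sigma> a i j" using \<open>4 \<le> a\<close> by (auto simp: m_def adr_inj)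
  qed
  from comps_okD(1)[OF assms(1) this assms(2,3)] show ?thesis .
qed

lemma comps_Set:
  assumes wf: "wfs H S (SSet a i j t)"
  shows "\<exists>C d. comps_ok H S (SSet a i j t) C d"
proof -
  from wf have *: "wft S i" "wft S j" "wft S t" "nonneg i" "nonneg j" "ok_arr a j" "deg H t \<le> 1" "a \<in> H"
    by auto
  from comp_exec[OF *(1)] comp_exec[OF *(2)] comp_exec[OF *(3)] obtain C1 d1 C2 d2 C3 d3 where
    ok: "comp_ok S i 0 C1 d1" "comp_ok S j 1 C2 d2" "comp_ok S t 2 C3 d3" by metis
  define w where "w = wt i + wt j + wt t + 1"
  define K where "K = 2 * (ecost (adr_expr a (reg 0) (reg 1)) + ecost (reg 2)) * w"
  have "comps_ok H S (SSet a i j t) (C1 + C2 + C3 + K + wt t) (d1 + d2 + d3)"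
    unfolding comps_ok_def
  proof (intro allI impI conjI)
    fix n e \<sigma> m B B'
    assume rep: "rep n S e \<sigma> m" and b: "bnd H n S e \<sigma> B B'"
      and l: "\<forall>k\<in>limss (SSet a i j t). int_size (int k) \<le> B"
    let ?B = "B + B'"
    have b0: "bnd {} n S e \<sigma> ?B 0" using b by (rule bnd_collapse)
    have l0: "int_size (int k) \<le> ?B" if "k \<in> lims i \<union> lims j \<union> lims t" for k
      using l that by (auto intro: trans_le_add1)
    have "int_size (tv n e \<sigma> t) \<le> deg H t * B' + wt t * B"
      using l by (intro int_size_tv[OF *(3) b]) auto
    also have "\<dots> \<le> B' + wt t * B" using *(7) by simp
    also have "\<dots> \<le> B' + mono_bd (C1 + C2 + C3 + K + wt t) (d1 + d2 + d3) n B"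
      using mono_bd_le[of "wt t" "C1 + C2 + C3 + K + wt t" 0 "d1 + d2 + d3" B B n]
      by (simp add: mono_bd_const[of _ _ n])
    finally have "int_size (tv n e \<sigma> t) \<le> B' + mono_bd (C1 + C2 + C3 + K + wt t) (d1 + d2 + d3) n B" .
    then show "bnd H n S e (run n e (SSet a i j t) \<sigma>) B (B' + mono_bd (C1 + C2 + C3 + K + wt t) (d1 + d2 + d3) n B)"
      using b *(8) by (auto simp: bnd_def trans_le_add1)
    have sz: "int_size (tv n e \<sigma> u) \<le> w * ?B" if "u \<in> {i, j, t}" for u
    proof -
      have "int_size (tv n e \<sigma> u) \<le> wt u * ?B"
        using that * l0 by (intro int_size_tv0[OF _ b0]) auto
      also have "\<dots> \<le> w * ?B" using that by (intro mult_right_mono) (auto simp: w_def)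
      finally show ?thesis .
    qed
    have "hoare (comps (SSet a i j t)) m
      (mono_bd C1 d1 n ?B + (mono_bd C2 d2 n ?B + (mono_bd C3 d3 n ?B + K * ?B)))
      (rep n S e (run n e (SSet a i j t) \<sigma>))"
      unfolding comps.simps
    proof (rule hoare_Seq, rule hoare_weaken[OF comp_okD[OF ok(1) rep b0 l0]])
      fix m1 assume 1: "m1 (adr 2 0 0) = tv n e \<sigma> i \<and> same 0 S m m1"
      then have rep1: "rep n S e \<sigma> m1" using rep rep_same by blast
      show "hoare (Seq (comp j 1) (Seq (comp t 2) (Store (adr_expr a (reg 0) (reg 1)) (reg 2)))) m1
        (mono_bd C2 d2 n ?B + (mono_bd C3 d3 n ?B + K * ?B)) (rep n S e (run n e (SSet a i j t) \<sigma>))"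
      proof (rule hoare_Seq, rule hoare_weaken[OF comp_okD[OF ok(2) rep1 b0 l0]])
        fix m2 assume 2: "m2 (adr 2 1 0) = tv n e \<sigma> j \<and> same 1 S m1 m2"
        then have rep2: "rep n S e \<sigma> m2" using rep1 rep_same by blast
        have m2: "m2 (adr 2 0 0) = tv n e \<sigma> i" using 1 2 by (simp add: same_def)
        show "hoare (Seq (comp t 2) (Store (adr_expr a (reg 0) (reg 1)) (reg 2))) m2
          (mono_bd C3 d3 n ?B + K * ?B) (rep n S e (run n e (SSet a i j t) \<sigma>))"
        proof (rule hoare_Seq, rule hoare_weaken[OF comp_okD[OF ok(3) rep2 b0 l0]])
          fix m3 assume 3: "m3 (adr 2 2 0) = tv n e \<sigma> t \<and> same 2 S m2 m3"
          then have rep3: "rep n S e \<sigma> m3" using rep2 rep_same by blast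
          have m3: "m3 (adr 2 0 0) = tv n e \<sigma> i" "m3 (adr 2 1 0) = tv n e \<sigma> j" "m3 (adr 2 2 0) = tv n e \<sigma> t"
            using m2 2 3 by (simp_all add: same_def)
          have nn: "0 \<le> tv n e \<sigma> i" "0 \<le> tv n e \<sigma> j" using *(4,5) by (auto intro: nonneg_tv)
          have adr: "val (adr_expr a (reg 0) (reg 1)) m3 = adr a (nat (tv n e \<sigma> i)) (nat (tv n e \<sigma> j))"
            using *(6) nn m3 by (subst val_adr_expr) auto
          show "hoare (Store (adr_expr a (reg 0) (reg 1)) (reg 2)) m3 (K * ?B) (rep n S e (run n e (SSet a i j t) \<sigma>))"
          proof (rule hoare_Store[of "w * ?B"])
            show "loads (w * ?B) m3 (adr_expr a (reg 0) (reg 1))" "loads (w * ?B) m3 (reg 2)"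
              using m3 sz by (auto intro!: loads_adr_expr)
            show "1 \<le> w * ?B" using bnd_ge1[OF b] by (simp add: w_def)
            show "rep n S e (run n e (SSet a i j t) \<sigma>)
              (m3(val (adr_expr a (reg 0) (reg 1)) m3 := val (reg 2) m3))"
              unfolding adr using m3(3) *(6) rep_set[OF rep3 *(6)] by (auto simp: ok_arr_def)
            show "2 * (ecost (adr_expr a (reg 0) (reg 1)) + ecost (reg 2)) * (w * ?B) \<le> K * ?B"
              by (simp only: K_def mult.assoc order_refl)
          qed
        qed auto
      qed auto
    qed auto
    then show "hoare (comps (SSet a i j t)) m (mono_bd (C1 + C2 + C3 + K + wt t) (d1 + d2 + d3) n ?B)
      (rep n S e (run n e (SSet a i j t) \<sigma>))"
    proof (rule hoare_weaken)
      have "mono_bd C1 d1 n ?B + (mono_bd C2 d2 n ?B + (mono_bd C3 d3 n ?B + K * ?B)) =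
        mono_bd C1 d1 n ?B + mono_bd C2 d2 n ?B + mono_bd C3 d3 n ?B + mono_bd K 0 n ?B"
        by (simp add: mono_bd_def)
      also have "\<dots> \<le> mono_bd (C1 + C2 + C3 + K) (d1 + d2 + d3 + 0) n ?B"
        by (meson mono_bd_add add_right_mono order_trans)
      also have "\<dots> \<le> mono_bd (C1 + C2 + C3 + K + wt t) (d1 + d2 + d3) n ?B"
        by (rule mono_bd_le) auto
      finally show "mono_bd C1 d1 n ?B + (mono_bd C2 d2 n ?B + (mono_bd C3 d3 n ?B + K * ?B)) \<le>
        mono_bd (C1 + C2 + C3 + K + wt t) (d1 + d2 + d3) n ?B" .
    qed
  qed
  then show ?thesis by blast
qed

lemma mono_bd_absorb: "B + B' + mono_bd C d n B \<le> mono_bd (1 + C) d n (B + B')"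
proof -
  have "mono_bd 1 0 n (B + B') + mono_bd C d n (B + B') \<le> mono_bd (1 + C) (0 + d) n (B + B')"
    by (rule mono_bd_add)
  moreover have "mono_bd C d n B \<le> mono_bd C d n (B + B')" by (rule mono_bd_le) auto
  moreover have "mono_bd 1 0 n (B + B') = B + B'" by (simp add: mono_bd_def)
  ultimately show ?thesis unfolding add_0 by linarith
qed

text \<open>The second statement starts with entries enlarged by the first, so its time bound is a
  nested one; linearity of \<open>mono_bd\<close> in the size keeps it in the same class.\<close>

lemma comps_Seq:
  assumes "comps_ok H S s C d" "comps_ok H S t C' d'"
  shows "\<exists>C d. comps_ok H S (SSeq s t) C d"
proof -
  have "comps_ok H S (SSeq s t) (C + C' * (1 + C)) (d + (d' + d))"
    unfolding comps_ok_def
  proof (intro allI impI conjI)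
    fix n e \<sigma> m B B'
    assume rep: "rep n S e \<sigma> m" and b: "bnd H n S e \<sigma> B B'"
      and l: "\<forall>k\<in>limss (SSeq s t). int_size (int k) \<le> B"
    let ?s = "run n e s \<sigma>"
    have 1: "bnd H n S e ?s B (B' + mono_bd C d n B)"
      "hoare (comps s) m (mono_bd C d n (B + B')) (rep n S e ?s)"
      using comps_okD[OF assms(1) rep b] l by auto
    have lt: "\<And>k. k \<in> limss t \<Longrightarrow> int_size (int k) \<le> B" using l by auto
    have "bnd H n S e (run n e t ?s) B (B' + mono_bd C d n B + mono_bd C' d' n B)"
      using comps_bnd[OF assms(2) 1(1) lt] .
    then show "bnd H n S e (run n e (SSeq s t) \<sigma>) B (B' + mono_bd (C + C' * (1 + C)) (d + (d' + d)) n B)"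
    proof (simp only: run.simps, elim bnd_weaken)
      have "mono_bd C d n B + mono_bd C' d' n B \<le> mono_bd (C + C') (d + d') n B"
        by (rule mono_bd_add)
      also have "\<dots> \<le> mono_bd (C + C' * (1 + C)) (d + (d' + d)) n B"
        by (rule mono_bd_le) auto
      finally show "B' + mono_bd C d n B + mono_bd C' d' n B \<le> B' + mono_bd (C + C' * (1 + C)) (d + (d' + d)) n B"
        by simp
    qed
    have "hoare (comps (SSeq s t)) m
      (mono_bd C d n (B + B') + mono_bd C' d' n (B + (B' + mono_bd C d n B))) (rep n S e (run n e t ?s))"
      unfolding comps.simps
      by (rule hoare_Seq, rule hoare_weaken[OF 1(2) order_refl])
        (rule comps_okD(2)[OF assms(2) _ 1(1) lt])
    then show "hoare (comps (SSeq s t)) m (mono_bd (C + C' * (1 + C)) (d + (d' + d)) n (B + B'))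
      (rep n S e (run n e (SSeq s t) \<sigma>))"
    proof (simp only: run.simps, elim hoare_weaken)
      have "mono_bd C' d' n (B + (B' + mono_bd C d n B)) \<le> mono_bd C' d' n (mono_bd (1 + C) d n (B + B'))"
        using mono_bd_absorb[of B B' C d n] by (intro mono_bd_le) auto
      also have "\<dots> = mono_bd (C' * (1 + C)) (d' + d) n (B + B')" by (rule mono_bd_nest)
      finally show "mono_bd C d n (B + B') + mono_bd C' d' n (B + (B' + mono_bd C d n B)) \<le>
        mono_bd (C + C' * (1 + C)) (d + (d' + d)) n (B + B')"
        using mono_bd_add[of C d n "B + B'" "C' * (1 + C)" "d' + d"] by linarith
    qed auto
  qed
  then show ?thesis by blast
qed

lemma comps_If:
  assumes "wft S c" "comps_ok H S s C d" "comps_ok H S t C' d'"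
  shows "\<exists>C d. comps_ok H S (SIf c s t) C d"
proof -
  from comp_exec[OF assms(1)] obtain C0 d0 where ok: "comp_ok S c 0 C0 d0" by blast
  define K where "K = 2 * ecost (reg 0) * (wt c + 1)"
  let ?C = "C0 + K + C + C'" and ?d = "d0 + d + d'"
  have "comps_ok H S (SIf c s t) ?C ?d"
    unfolding comps_ok_def
  proof (intro allI impI conjI)
    fix n e \<sigma> m B B'
    assume rep: "rep n S e \<sigma> m" and b: "bnd H n S e \<sigma> B B'"
      and l: "\<forall>k\<in>limss (SIf c s t). int_size (int k) \<le> B"
    let ?B = "B + B'"
    have b0: "bnd {} n S e \<sigma> ?B 0" using b by (rule bnd_collapse)
    have l0: "int_size (int k) \<le> ?B" if "k \<in> lims c" for k using l that by (auto intro: trans_le_add1)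
    have ls: "\<And>k. k \<in> limss s \<Longrightarrow> int_size (int k) \<le> B" and lt: "\<And>k. k \<in> limss t \<Longrightarrow> int_size (int k) \<le> B"
      using l by auto
    have le: "mono_bd C d n B \<le> mono_bd ?C ?d n B" "mono_bd C' d' n B \<le> mono_bd ?C ?d n B"
      by (rule mono_bd_le; simp)+
    show "bnd H n S e (run n e (SIf c s t) \<sigma>) B (B' + mono_bd ?C ?d n B)"
      using comps_bnd[OF assms(2) b ls] comps_bnd[OF assms(3) b lt] le
      by (auto elim!: bnd_weaken)
    have sz: "int_size (tv n e \<sigma> c) \<le> (wt c + 1) * ?B"
      using int_size_tv0[OF assms(1) b0 l0] by simp
    have "hoare (comps (SIf c s t)) m
      (mono_bd C0 d0 n ?B + (2 * ecost (reg 0) * ((wt c + 1) * ?B) + mono_bd C d n ?B + mono_bd C' d' n ?B))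
      (rep n S e (run n e (SIf c s t) \<sigma>))"
      unfolding comps.simps
    proof (rule hoare_Seq, rule hoare_weaken[OF comp_okD[OF ok rep b0 l0]])
      fix m1 assume 1: "m1 (adr 2 0 0) = tv n e \<sigma> c \<and> same 0 S m m1"
      then have rep1: "rep n S e \<sigma> m1" using rep rep_same by blast
      show "hoare (Cond (reg 0) (comps s) (comps t)) m1
        (2 * ecost (reg 0) * ((wt c + 1) * ?B) + mono_bd C d n ?B + mono_bd C' d' n ?B)
        (rep n S e (run n e (SIf c s t) \<sigma>))"
        using 1 sz bnd_ge1[OF b0] comps_okD(2)[OF assms(2) rep1 b ls] comps_okD(2)[OF assms(3) rep1 b lt]
        by (intro hoare_Cond) auto
    qed auto
    then show "hoare (comps (SIf c s t)) m (mono_bd ?C ?d n ?B) (rep n S e (run n e (SIf c s t) \<sigma>))"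
    proof (rule hoare_weaken)
      have "mono_bd C0 d0 n ?B + (2 * ecost (reg 0) * ((wt c + 1) * ?B) + mono_bd C d n ?B + mono_bd C' d' n ?B)
        = mono_bd C0 d0 n ?B + mono_bd K 0 n ?B + mono_bd C d n ?B + mono_bd C' d' n ?B"
        by (simp add: K_def mono_bd_def algebra_simps)
      also have "\<dots> \<le> mono_bd (C0 + K + C + C') (d0 + 0 + d + d') n ?B"
        by (meson mono_bd_add add_right_mono order_trans)
      finally show "mono_bd C0 d0 n ?B + (2 * ecost (reg 0) * ((wt c + 1) * ?B) + mono_bd C d n ?B + mono_bd C' d' n ?B)
        \<le> mono_bd ?C ?d n ?B" by simp
    qed
  qed
  then show ?thesis by blast
qed

lemma comps_For:
  assumes ok: "comps_ok H (insert x S) s C d" and x: "x \<notin> S"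
  shows "\<exists>C d. comps_ok H S (SFor x l s) C d"
proof -
  define c where "c = (case l of LC k \<Rightarrow> k + 1 | LN \<Rightarrow> 1)"
  define F where "F = 100 * (ecost (lim_expr l) + ecost (varA x) + 1)"
  define C1 where "C1 = C * (1 + c * C)"
  define d1 where "d1 = d + Suc d"
  let ?C = "c * C + c * (C1 + F)" and ?d = "Suc d + Suc d1"
  have "comps_ok H S (SFor x l s) ?C ?d"
    unfolding comps_ok_def
  proof (intro allI impI conjI)
    fix n e \<sigma> m B B'
    assume rep: "rep n S e \<sigma> m" and b: "bnd H n S e \<sigma> B B'"
      and lm: "\<forall>k\<in>limss (SFor x l s). int_size (int k) \<le> B"
    let ?k = "ln_of n l" and ?B = "B + B'"
    let ?\<sigma> = "\<lambda>i. fold (\<lambda>i. run n (e(x := i)) s) [0..<i] \<sigma>"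
    have ls: "\<And>k. k \<in> limss s \<Longrightarrow> int_size (int k) \<le> B" using lm by auto
    have kB: "int_size (int ?k) \<le> B" using b lm by (cases l) (auto simp: bnd_def)
    have bu: "bnd H n (insert x S) (e(x := i)) \<tau> B B''"
      if "bnd H n S e \<tau> B B''" "i < ?k" for \<tau> B'' i
      using that lm by (intro bnd_upd[where l = l]) auto
    \<comment> \<open>Every iteration adds the same amount, because that amount does not depend on
      the current bound of the changeable arrays.\<close>
    have bi: "bnd H n S e (?\<sigma> i) B (B' + i * mono_bd C d n B)" if "i \<le> ?k" for i
      using that
    proof (induction i)
      case (Suc i)
      have "bnd H n S e (?\<sigma> i) B (B' + i * mono_bd C d n B)" by (rule Suc.IH) (use Suc.prems in linarith)
      then have "bnd H n (insert x S) (e(x := i)) (?\<sigma> i) B (B' + i * mono_bd C d n B)"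
        by (rule bu) (use Suc in simp)
      from comps_bnd[OF ok this ls]
      have "bnd H n S e (run n (e(x := i)) s (?\<sigma> i)) B (B' + i * mono_bd C d n B + mono_bd C d n B)"
        using x by (auto elim!: bnd_env)
      then show ?case by (simp add: algebra_simps del: fun_upd_apply)
    qed (use b in simp)
    have kC: "?k * mono_bd C d n B \<le> mono_bd (c * C) (Suc d) n B"
      using mono_bd_lim[of n l C d B] by (simp add: c_def)
    have bi': "bnd H n S e (?\<sigma> i) B (B' + mono_bd (c * C) (Suc d) n B)" if "i \<le> ?k" for i
    proof (rule bnd_weaken[OF bi[OF that]])
      have "i * mono_bd C d n B \<le> ?k * mono_bd C d n B" using that by (rule mult_le_mono1)
      then show "B' + i * mono_bd C d n B \<le> B' + mono_bd (c * C) (Suc d) n B" using kC by linarith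
    qed
    have "mono_bd (c * C) (Suc d) n B \<le> mono_bd ?C ?d n B" by (rule mono_bd_le) auto
    with bi'[of ?k] show "bnd H n S e (run n e (SFor x l s) \<sigma>) B (B' + mono_bd ?C ?d n B)"
      by (auto elim!: bnd_weaken)
    have "\<exists>t m'. exec (loop x l (comps s)) m t m' \<and> rep n S e (?\<sigma> ?k) m' \<and> m' (adr 1 x 0) = int ?k \<and>
      t \<le> (?k + 1) * (mono_bd C1 d1 n ?B + 100 * (ecost (lim_expr l) + ecost (varA x) + 1) * B)"
    proof (rule exec_loop)
      show "rep n S e (?\<sigma> 0) (m(adr 1 x 0 := 0))" using rep x by (simp add: rep_var del: One_nat_def)
    next
      fix i m1 assume i: "i < ?k" and r: "rep n S e (?\<sigma> i) m1" and xi: "m1 (adr 1 x 0) = int i"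
      have "hoare (comps s) m1 (mono_bd C d n (B + (B' + mono_bd (c * C) (Suc d) n B)))
        (rep n (insert x S) (e(x := i)) (run n (e(x := i)) s (?\<sigma> i)))"
        using i by (intro comps_okD(2)[OF ok rep_upd[OF r xi] bu[OF bi'] ls]) auto
      moreover have "mono_bd C d n (B + (B' + mono_bd (c * C) (Suc d) n B)) \<le> mono_bd C1 d1 n ?B"
        unfolding C1_def d1_def mono_bd_nest[symmetric]
        using mono_bd_absorb[of B B' "c * C" "Suc d" n] by (intro mono_bd_le) auto
      moreover have "rep n S e (?\<sigma> (Suc i)) (m'(adr 1 x 0 := v)) \<and> m' (adr 1 x 0) = int i"
        if "rep n (insert x S) (e(x := i)) (run n (e(x := i)) s (?\<sigma> i)) m'" for m' v
      proof
        have "rep n S (e(x := i)) (?\<sigma> (Suc i)) m'" using rep_subset[OF that, of S] by auto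
        then have "rep n S e (?\<sigma> (Suc i)) m'" by (rule rep_env) (use x in auto)
        then show "rep n S e (?\<sigma> (Suc i)) (m'(adr 1 x 0 := v))" using x by (rule rep_var)
        show "m' (adr 1 x 0) = int i" using that by (simp add: rep_def)
      qed
      ultimately show "\<exists>t m'. exec (comps s) m1 t m' \<and> t \<le> mono_bd C1 d1 n ?B \<and> m' (adr 1 x 0) = int i \<and>
        rep n S e (?\<sigma> (Suc i)) (m'(adr 1 x 0 := int i + 1))"
        unfolding hoare_def by (meson le_trans)
    next
      fix i m1 assume "rep n S e (?\<sigma> i) m1"
      then show "val (lim_expr l) m1 = int ?k \<and> loads B m1 (lim_expr l)"
        using val_lim_expr kB by (cases l) (auto simp: rep_def)
    qed (rule kB)
    then have "hoare (loop x l (comps s)) m ((?k + 1) * (mono_bd C1 d1 n ?B + F * B)) (rep n S e (?\<sigma> ?k))"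
      unfolding hoare_def F_def by blast
    then show "hoare (comps (SFor x l s)) m (mono_bd ?C ?d n ?B) (rep n S e (run n e (SFor x l s) \<sigma>))"
      unfolding comps.simps run.simps
    proof (rule hoare_weaken)
      have "mono_bd C1 d1 n ?B + F * B \<le> mono_bd C1 d1 n ?B + mono_bd F 0 n ?B"
        by (simp add: mono_bd_def)
      also have "\<dots> \<le> mono_bd (C1 + F) (d1 + 0) n ?B" by (rule mono_bd_add)
      finally have "(?k + 1) * (mono_bd C1 d1 n ?B + F * B) \<le> (?k + 1) * mono_bd (C1 + F) d1 n ?B"
        by (simp only: add_0_right mult_le_mono2)
      also have "\<dots> \<le> mono_bd (c * (C1 + F)) (Suc d1) n ?B" unfolding c_def by (rule mono_bd_lim)
      also have "\<dots> \<le> mono_bd ?C ?d n ?B" by (rule mono_bd_le) auto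
      finally show "(?k + 1) * (mono_bd C1 d1 n ?B + F * B) \<le> mono_bd ?C ?d n ?B" .
    qed
  qed
  then show ?thesis by blast
qed

lemma comps_exec: "wfs H S s \<Longrightarrow> \<exists>C d. comps_ok H S s C d"
proof (induction s arbitrary: S)
  case SSkip
  have "comps_ok H S SSkip 1 0"
    unfolding comps_ok_def
  proof (intro allI impI conjI)
    fix n e \<sigma> m B B' assume "rep n S e \<sigma> m" and b: "bnd H n S e \<sigma> B B'"
    then show "hoare (comps SSkip) m (mono_bd 1 0 n (B + B')) (rep n S e (run n e SSkip \<sigma>))"
      using bnd_ge1[OF b] unfolding hoare_def by (auto simp: mono_bd_def intro!: exI exec.Skip)
    show "bnd H n S e (run n e SSkip \<sigma>) B (B' + mono_bd 1 0 n B)"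
      using b by (auto elim: bnd_weaken)
  qed
  then show ?case by blast
next
  case (SSet a i j t)
  then show ?case by (rule comps_Set)
next
  case (SSeq s t)
  then have "wfs H S s" "wfs H S t" by auto
  with SSeq.IH comps_Seq show ?case by blast
next
  case (SIf c s t)
  then have "wft S c" "wfs H S s" "wfs H S t" by auto
  with SIf.IH comps_If show ?case by blast
next
  case (SFor x l s)
  then have "wfs H (insert x S) s" "x \<notin> S" by auto
  with SFor.IH comps_For show ?case by blast
qed


section \<open>The complete program and its running time\<close>

definition copy_out :: "nat \<Rightarrow> st" where
  "copy_out b = SFor 0 LN (SSet 0 (TV 0) (TC 0) (TA b (TV 0) (TC 0)))"

text \<open>The output is copied by a statement of its own with \<open>H = {0}\<close>. In the main
  statement array 0 lies outside \<open>H\<close>, so input entries have degree 0 and may be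
  multiplied into other arrays.\<close>

definition program :: "st \<Rightarrow> nat \<Rightarrow> prog" where
  "program s b = Seq (Store (Const boundA) (Load (Const 0))) (Seq (comps s) (comps (copy_out b)))"

definition init :: "int list \<Rightarrow> state" where
  "init xs a i j = (if a = 0 then load_input xs (int i) else 0)"

lemma run_copy_out:
  assumes "b \<noteq> 0" "i < n"
  shows "run n e (copy_out b) \<sigma> 0 i 0 = \<sigma> b i 0"
proof -
  have "fold (\<lambda>i. run n (e(0 := i)) (SSet 0 (TV 0) (TC 0) (TA b (TV 0) (TC 0)))) [0..<k] \<sigma> b i 0 = \<sigma> b i 0 \<and>
    (i < k \<longrightarrow> fold (\<lambda>i. run n (e(0 := i)) (SSet 0 (TV 0) (TC 0) (TA b (TV 0) (TC 0)))) [0..<k] \<sigma> 0 i 0 = \<sigma> b i 0)"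
    for k i
    using assms(1) by (induction k arbitrary: i) auto
  then show ?thesis using assms by (simp add: copy_out_def)
qed

lemma int_size_le_input_size: "x \<in> set xs \<Longrightarrow> int_size x \<le> input_size xs"
  unfolding input_size_def by (rule member_le_sum_list) auto

lemma length_le_input_size: "length xs \<le> input_size xs"
  using sum_list_mono[of xs "\<lambda>_. 1" int_size] int_size_pos
  by (simp add: input_size_def sum_list_triv)

lemma int_size_load_input: "int_size (load_input xs z) \<le> input_size xs + 1"
proof -
  have "int_size 0 = 1" by (simp add: int_size_def bitlen_def floorlog_def)
  then show ?thesis
    by (auto simp: load_input_def intro!: le_SucI int_size_le_input_size nth_mem)
qed

lemma mono_bd_power:
  assumes "n \<le> M" "B \<le> K * (M + 1) ^ D"
  shows "mono_bd C d n B \<le> (C * K) * (M + 1) ^ (d + D)"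
proof -
  have "mono_bd C d n B \<le> C * (M + 1) ^ d * (K * (M + 1) ^ D)"
    unfolding mono_bd_def using assms by (intro mult_mono power_mono) auto
  then show ?thesis by (simp add: power_add mult_ac)
qed

lemma program_polytime:
  assumes s: "wfs {4..} {} s" and b: "4 \<le> b"
    and enc: "\<And>x. x \<in> I \<Longrightarrow> enc x = int (num x) # rest x" "\<And>x. x \<in> I \<Longrightarrow> num x \<le> length (enc x)"
    and ok: "\<And>x m. x \<in> I \<Longrightarrow>
      (\<And>i. i < num x \<Longrightarrow> m (int i) = run (num x) (\<lambda>_. 0) s (init (enc x)) b i 0) \<Longrightarrow> ok x m"
  shows "solves_in_polytime (program s b) enc I ok"
proof -
  from comps_exec[OF s] obtain C d where s_ok: "comps_ok {4..} {} s C d" by blast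
  have "wfs {0} {} (copy_out b)" using b by (simp add: copy_out_def ok_arr_def)
  from comps_exec[OF this] obtain C' d' where c_ok: "comps_ok {0} {} (copy_out b) C' d'" by blast
  from finite_limss[of s] obtain K0 where K0: "\<And>k. k \<in> limss s \<Longrightarrow> int_size (int k) \<le> K0"
    using finite_imageI[of "limss s" "\<lambda>k. int_size (int k)"]
    by (metis Max_ge imageI)
  define E where "E = 2 * (ecost (Const boundA) + ecost (Load (Const 0)))"
  define K1 where "K1 = K0 + 3"
  define K2 where "K2 = K1 + C * K1"
  define T where "T = E + C * (2 * K1) + C' * (2 * K2)"
  define D where "D = d' + (d + 1)"
  define p where "p = smult T ([:1, 1:] ^ (D + d + 1))"
  have p: "poly p M = T * (M + 1) ^ (D + d + 1)" for M by (simp add: p_def poly_power)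
  have "\<exists>t m. exec (program s b) (load_input (enc x)) t m \<and> t \<le> poly p (input_size (enc x)) \<and> ok x m"
    if x: "x \<in> I" for x
  proof -
    let ?n = "num x" and ?M = "input_size (enc x)" and ?e = "\<lambda>_. 0 :: nat"
    let ?\<sigma> = "init (enc x)" and ?m = "load_input (enc x)"
    have n: "?n \<le> ?M" using enc(2)[OF x] length_le_input_size[of "enc x"] by linarith
    have hd: "?m 0 = int ?n" using enc(1)[OF x] by (simp add: load_input_def)
    define B where "B = ?M + K0 + 2"
    have ns: "int_size (int ?n) \<le> ?M"
      using enc(1)[OF x] by (intro int_size_le_input_size) simp
    have rep: "rep ?n {} ?e ?\<sigma> (?m(boundA := int ?n))"
      by (auto simp: rep_def adr_inj init_def) (auto simp: adr_def load_input_def)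
    have bnd: "bnd {4..} ?n {} ?e ?\<sigma> B B"
    proof -
      have "int_size (?\<sigma> a i j) \<le> B" for a i j
        using int_size_load_input[of "enc x" "int i"]
        by (auto simp: init_def B_def) (simp add: int_size_def bitlen_def floorlog_def)
      then show ?thesis using ns by (auto simp: bnd_def B_def)
    qed
    have lims: "\<And>k. k \<in> limss s \<Longrightarrow> int_size (int k) \<le> B"
      using K0 by (force simp: B_def)
    let ?\<tau> = "run ?n ?e s ?\<sigma>"
    have 1: "bnd {4..} ?n {} ?e ?\<tau> B (B + mono_bd C d ?n B)"
      "hoare (comps s) (?m(boundA := int ?n)) (mono_bd C d ?n (B + B)) (rep ?n {} ?e ?\<tau>)"
      using comps_okD[OF s_ok rep bnd] lims by auto
    define B1 where "B1 = B + mono_bd C d ?n B"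
    \<comment> \<open>For the copying the roles are exchanged: the computed arrays are now the fixed
      part, so \<open>B\<close> is replaced by their final size \<open>B1\<close>.\<close>
    have "bnd {0} ?n {} ?e ?\<tau> B1 B1"
      using 1(1) by (simp add: bnd_def B1_def not_le) (metis not_le trans_le_add1 trans_le_add2 le_add2 add.commute)
    have "hoare (program s b) ?m (E * (?M + 1) + (mono_bd C d ?n (B + B) + mono_bd C' d' ?n (B1 + B1)))
        (rep ?n {} ?e (run ?n ?e (copy_out b) ?\<tau>))"
      unfolding program_def
    proof (rule hoare_Seq, rule hoare_Store[of "?M + 1"])
      have "?m(val (Const boundA) ?m := val (Load (Const 0)) ?m) = ?m(boundA := int ?n)" using hd by simp
      moreover have "hoare (Seq (comps s) (comps (copy_out b))) (?m(boundA := int ?n))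
        (mono_bd C d ?n (B + B) + mono_bd C' d' ?n (B1 + B1)) (rep ?n {} ?e (run ?n ?e (copy_out b) ?\<tau>))"
        using comps_okD(2)[OF c_ok _ \<open>bnd {0} ?n {} ?e ?\<tau> B1 B1\<close>]
        by (intro hoare_Seq hoare_weaken[OF 1(2) order_refl]) (auto simp: copy_out_def)
      ultimately show "hoare (Seq (comps s) (comps (copy_out b)))
          (?m(val (Const boundA) ?m := val (Load (Const 0)) ?m))
        (mono_bd C d ?n (B + B) + mono_bd C' d' ?n (B1 + B1)) (rep ?n {} ?e (run ?n ?e (copy_out b) ?\<tau>))"
        by simp
    qed (use int_size_load_input[of "enc x" 0] in \<open>auto simp: E_def\<close>)
    then obtain t m where 2: "exec (program s b) ?m t m" "rep ?n {} ?e (run ?n ?e (copy_out b) ?\<tau>) m"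
      "t \<le> E * (?M + 1) + (mono_bd C d ?n (B + B) + mono_bd C' d' ?n (B1 + B1))"
      unfolding hoare_def by blast
    have "t \<le> poly p ?M"
    proof -
      let ?P = "(?M + 1) ^ (D + d + 1)"
      have up: "c * (?M + 1) ^ i \<le> c * ?P" if "i \<le> D + d + 1" for c i
        using that by (intro mult_le_mono2 power_increasing) auto
      have B: "B \<le> K1 * (?M + 1) ^ 1" by (simp add: B_def K1_def algebra_simps)
      have "K1 * (?M + 1) ^ 1 \<le> K1 * (?M + 1) ^ (d + 1)"
        by (intro mult_le_mono2 power_increasing) auto
      with B mono_bd_power[OF n B, of C d] have "B1 \<le> K2 * (?M + 1) ^ (d + 1)"
        unfolding B1_def K2_def distrib_right by linarith
      then have "B1 + B1 \<le> (2 * K2) * (?M + 1) ^ (d + 1)" by simp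
      from mono_bd_power[OF n this, of C' d']
      have "mono_bd C' d' ?n (B1 + B1) \<le> C' * (2 * K2) * ?P"
        using up[of "d' + (d + 1)" "C' * (2 * K2)"] by (simp only: D_def) linarith
      moreover have "B + B \<le> (2 * K1) * (?M + 1) ^ 1" using B by simp
      from mono_bd_power[OF n this, of C d]
      have "mono_bd C d ?n (B + B) \<le> C * (2 * K1) * ?P"
        using up[of "d + 1" "C * (2 * K1)"] by linarith
      moreover have "E * (?M + 1) \<le> E * ?P" using up[of 1 E] by simp
      ultimately show ?thesis using 2(3) unfolding p T_def distrib_right by linarith
    qed
    moreover have "ok x m"
    proof (rule ok[OF x])
      fix i assume "i < ?n"
      then have "run ?n ?e (copy_out b) ?\<tau> 0 i 0 = ?\<tau> b i 0" using b by (intro run_copy_out) auto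
      then show "m (int i) = ?\<tau> b i 0" using 2(2) by (simp add: rep_def adr_def)
    qed
    ultimately show ?thesis using 2(1) by blast
  qed
  then show ?thesis unfolding solves_in_polytime_def by blast
qed

section \<open>The relaxation and its solution\<close>

definition phi :: "real \<Rightarrow> real" where
  "phi x = 2/5 * x + 3/5 * x^2"

text \<open>Completing the square at the minimum, \<open>x = - 1/3\<close>.\<close>

lemma phi_ge: "- 1/15 \<le> phi x"
proof -
  have "0 \<le> 3/5 * (x + 1/3)\<^sup>2" by simp
  then show ?thesis by (simp add: phi_def power2_eq_square algebra_simps)
qed

definition gram :: "nat \<Rightarrow> (nat \<Rightarrow> nat \<Rightarrow> real) \<Rightarrow> nat \<Rightarrow> nat \<Rightarrow> real" where
  "gram n L i j = (\<Sum>k<n. L i k * L j k)"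

definition dbl :: "nat \<Rightarrow> (nat \<Rightarrow> nat \<Rightarrow> real) \<Rightarrow> real" where
  "dbl n f = (\<Sum>i<n. \<Sum>j<n. f i j)"

lemma dbl_add: "dbl n (\<lambda>i j. f i j + g i j) = dbl n f + dbl n g"
  by (simp add: dbl_def sum.distrib)

lemma dbl_diff: "dbl n (\<lambda>i j. f i j - g i j) = dbl n f - dbl n g"
  by (simp add: dbl_def sum_subtractf)

lemma dbl_uminus: "dbl n (\<lambda>i j. - f i j) = - dbl n f"
  by (simp add: dbl_def sum_negf)

lemma dbl_cmult: "dbl n (\<lambda>i j. c * f i j) = c * dbl n f"
  by (simp add: dbl_def sum_distrib_left)

lemma dbl_mono: "(\<And>i j. i < n \<Longrightarrow> j < n \<Longrightarrow> f i j \<le> g i j) \<Longrightarrow> dbl n f \<le> dbl n g"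
  unfolding dbl_def by (intro sum_mono) auto

lemma dbl_cong: "(\<And>i j. i < n \<Longrightarrow> j < n \<Longrightarrow> f i j = g i j) \<Longrightarrow> dbl n f = dbl n g"
  unfolding dbl_def by (intro sum.cong) auto

lemma dbl_diag: "dbl n (\<lambda>i j. if i = j then f i else 0) = (\<Sum>i<n. f i)"
  by (simp add: dbl_def)

lemma dbl_swap: "dbl n (\<lambda>i j. f j i) = dbl n f"
  unfolding dbl_def by (rule sum.swap)

lemma dbl_prod: "dbl n (\<lambda>i j. f i * g j) = (\<Sum>i<n. f i) * (\<Sum>j<n. g j)"
  by (simp add: dbl_def sum_product)

lemma dbl_sum: "dbl n (\<lambda>i j. \<Sum>c\<in>A. f c i j) = (\<Sum>c\<in>A. dbl n (f c))"
  unfolding dbl_def by (subst (2) sum.swap, subst sum.swap) simp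

lemma abs_gram_le: "\<bar>gram n L i j\<bar> \<le> (gram n L i i + gram n L j j) / 2"
proof -
  have "\<bar>L i k * L j k\<bar> \<le> (L i k * L i k + L j k * L j k) / 2" for k
    using sum_squares_bound[of "L i k" "L j k"] sum_squares_bound[of "L i k" "- L j k"]
    by (simp add: power2_eq_square abs_if)
  then have "(\<Sum>k<n. \<bar>L i k * L j k\<bar>) \<le> (\<Sum>k<n. (L i k * L i k + L j k * L j k) / 2)"
    by (intro sum_mono)
  then have "\<bar>gram n L i j\<bar> \<le> (\<Sum>k<n. (L i k * L i k + L j k * L j k) / 2)"
    unfolding gram_def using sum_abs[of "\<lambda>k. L i k * L j k" "{..<n}"] by linarith
  then show ?thesis by (simp add: gram_def sum.distrib sum_divide_distrib[symmetric])
qed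

lemma entry_le_gram: "k < n \<Longrightarrow> (L i k)\<^sup>2 \<le> gram n L i i"
  unfolding gram_def power2_eq_square[symmetric]
  by (rule member_le_sum) auto

locale weights =
  fixes n :: nat and w :: "nat \<Rightarrow> nat \<Rightarrow> real"
  assumes w_nonneg: "\<And>i j. 0 \<le> w i j"
    and w_sym: "\<And>i j. w i j = w j i"
    and w_sum: "dbl n w = 1"
begin

definition p :: "nat \<Rightarrow> real" where
  "p i = (\<Sum>j<n. w i j)"

lemma p_nonneg: "0 \<le> p i"
  unfolding p_def by (simp add: sum_nonneg w_nonneg)

lemma p_sum: "(\<Sum>i<n. p i) = 1"
  using w_sum by (simp add: p_def dbl_def)

lemma p_le_1: "i < n \<Longrightarrow> p i \<le> 1"
  using member_le_sum[of i "{..<n}" p] p_nonneg p_sum by simp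

lemma pp_sum: "dbl n (\<lambda>i j. p i * p j) = 1"
  by (simp add: dbl_prod p_sum)

lemma w_marginal: "dbl n (\<lambda>i j. w i j * f i) = (\<Sum>i<n. p i * f i)"
  "dbl n (\<lambda>i j. w i j * f j) = (\<Sum>i<n. p i * f i)"
proof -
  show *: "dbl n (\<lambda>i j. w i j * f i) = (\<Sum>i<n. p i * f i)"
    by (simp add: dbl_def p_def sum_distrib_right)
  show "dbl n (\<lambda>i j. w i j * f j) = (\<Sum>i<n. p i * f i)"
    using dbl_swap[of n "\<lambda>i j. w i j * f i"] * w_sym by simp
qed

lemma pp_marginal: "dbl n (\<lambda>i j. p i * p j * f i) = (\<Sum>i<n. p i * f i)"
  "dbl n (\<lambda>i j. p i * p j * f j) = (\<Sum>i<n. p i * f i)"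
proof -
  have "dbl n (\<lambda>i j. p i * p j * f i) = dbl n (\<lambda>i j. p i * f i * p j)"
    by (rule dbl_cong) simp
  then show "dbl n (\<lambda>i j. p i * p j * f i) = (\<Sum>i<n. p i * f i)" by (simp add: dbl_prod p_sum)
  have "dbl n (\<lambda>i j. p i * p j * f j) = dbl n (\<lambda>i j. p i * (p j * f j))"
    by (rule dbl_cong) simp
  then show "dbl n (\<lambda>i j. p i * p j * f j) = (\<Sum>i<n. p i * f i)" by (simp add: dbl_prod p_sum)
qed

definition R :: "(nat \<Rightarrow> nat \<Rightarrow> real) \<Rightarrow> real" where
  "R X = dbl n (\<lambda>i j. w i j * X i j) - dbl n (\<lambda>i j. p i * p j * phi (X i j))"

end

text \<open>\<open>\<Lambda>\<close> weighs the penalty of the diagonal, \<open>\<mu>\<close> the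
  barrier; \<open>\<tau>\<close> is the tolerance for stationarity and \<open>\<eta>\<close> the
  step length. By \<open>n * \<tau> \<le> \<mu>\<close> an error matrix with entries up to
  \<open>\<tau>\<close> has norm at most \<open>\<mu>\<close>. The bound on \<open>\<eta>\<close>
  keeps the second-order loss of a step to at most half of its first-order gain.\<close>

locale solver = weights +
  fixes \<Lambda> \<mu> \<tau> \<eta> :: real
  assumes Lam: "10 \<le> \<Lambda>" and n_pos: "1 \<le> n" and mu: "0 < \<mu>" "\<mu> * n \<le> 1"
    and tau: "0 < \<tau>" "n * \<tau> \<le> \<mu>"
    and eta: "0 < \<eta>" "\<eta> * (100 * \<Lambda> * n) \<le> \<tau>"
begin

lemma mu1: "\<mu> \<le> 1"
proof -
  have "\<mu> * 1 \<le> \<mu> * real n" using n_pos mu by (intro mult_left_mono) auto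
  then show ?thesis using mu by linarith
qed

lemma eta_tau: "0 < \<eta> * \<tau>"
  using eta tau by simp

definition F :: "(nat \<Rightarrow> nat \<Rightarrow> real) \<Rightarrow> real" where
  "F X = R X - \<Lambda> * (\<Sum>i<n. (X i i - 1)\<^sup>2)"

definition G :: "(nat \<Rightarrow> nat \<Rightarrow> real) \<Rightarrow> nat \<Rightarrow> nat \<Rightarrow> real" where
  "G X i j = w i j - p i * p j * (2/5 + 6/5 * X i j) - (if i = j then 2 * \<Lambda> * (X i i - 1) else 0)"

text \<open>\<open>F\<close> is quadratic, so the expansion with gradient \<open>G\<close> is exact.
  The remainder is nonpositive, which gives concavity, and explicit, which gives the step
  length.\<close>

lemma F_expand:
  "F (\<lambda>i j. X i j + D i j) = F X + dbl n (\<lambda>i j. G X i j * D i j) -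
     3/5 * dbl n (\<lambda>i j. p i * p j * (D i j)\<^sup>2) - \<Lambda> * (\<Sum>i<n. (D i i)\<^sup>2)"
proof -
  have 1: "dbl n (\<lambda>i j. w i j * (X i j + D i j)) = dbl n (\<lambda>i j. w i j * X i j) + dbl n (\<lambda>i j. w i j * D i j)"
    by (simp add: dbl_add[symmetric] algebra_simps)
  have 2: "dbl n (\<lambda>i j. p i * p j * phi (X i j + D i j)) = dbl n (\<lambda>i j. p i * p j * phi (X i j)) +
      dbl n (\<lambda>i j. p i * p j * (2/5 + 6/5 * X i j) * D i j) + 3/5 * dbl n (\<lambda>i j. p i * p j * (D i j)\<^sup>2)"
    unfolding dbl_cmult[symmetric] dbl_add[symmetric]
    by (rule dbl_cong) (simp add: phi_def power2_eq_square algebra_simps)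
  have 3: "(\<Sum>i<n. (X i i + D i i - 1)\<^sup>2) = (\<Sum>i<n. (X i i - 1)\<^sup>2) + (\<Sum>i<n. 2 * (X i i - 1) * D i i) + (\<Sum>i<n. (D i i)\<^sup>2)"
    unfolding sum.distrib[symmetric] by (rule sum.cong) (auto simp: power2_eq_square algebra_simps)
  have "dbl n (\<lambda>i j. G X i j * D i j) = dbl n (\<lambda>i j. w i j * D i j) -
      dbl n (\<lambda>i j. p i * p j * (2/5 + 6/5 * X i j) * D i j) -
      dbl n (\<lambda>i j. if i = j then 2 * \<Lambda> * (X i i - 1) * D i i else 0)"
    unfolding dbl_diff[symmetric] by (rule dbl_cong) (simp add: G_def algebra_simps)
  also have "dbl n (\<lambda>i j. if i = j then 2 * \<Lambda> * (X i i - 1) * D i i else 0) = \<Lambda> * (\<Sum>i<n. 2 * (X i i - 1) * D i i)"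
    unfolding dbl_diag sum_distrib_left by (rule sum.cong) auto
  finally show ?thesis
    unfolding F_def R_def 1 2 3 by (simp add: algebra_simps)
qed

lemma F_concave: "F Y \<le> F X + dbl n (\<lambda>i j. G X i j * (Y i j - X i j))"
proof -
  have "0 \<le> dbl n (\<lambda>i j. p i * p j * (Y i j - X i j)\<^sup>2)"
    unfolding dbl_def by (intro sum_nonneg) (simp add: p_nonneg)
  moreover have "0 \<le> \<Lambda> * (\<Sum>i<n. (Y i i - X i i)\<^sup>2)"
    using Lam by (simp add: sum_nonneg)
  ultimately show ?thesis
    using F_expand[of X "\<lambda>i j. Y i j - X i j"] by simp
qed

text \<open>The matrix \<open>L\<^sup>T G L\<close> is, up to a factor 2, the derivative of
  \<open>F\<close> along the column operations below; its symmetry is why moves with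
  \<open>b \<le> a\<close> suffice.\<close>

definition S :: "(nat \<Rightarrow> nat \<Rightarrow> real) \<Rightarrow> nat \<Rightarrow> nat \<Rightarrow> real" where
  "S L a b = dbl n (\<lambda>i j. L i a * G (gram n L) i j * L j b)"

lemma gram_sym: "gram n L i j = gram n L j i"
  by (simp add: gram_def mult.commute)

lemma G_sym: "G (gram n L) i j = G (gram n L) j i"
  unfolding G_def using gram_sym[of L i j] w_sym[of i j] by auto

lemma S_sym: "S L a b = S L b a"
proof -
  have "S L a b = dbl n (\<lambda>i j. L j b * G (gram n L) j i * L i a)"
    unfolding S_def by (rule dbl_cong) (simp add: G_sym)
  then show ?thesis by (simp add: S_def dbl_swap[of n "\<lambda>i j. L i b * G (gram n L) i j * L j a"])
qed

text \<open>Right multiplication of \<open>L\<close> by \<open>I + t E\<close>, where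
  \<open>E\<close> has a single entry 1 in row \<open>a\<close> and column \<open>b\<close>. For
  \<open>b \<le> a\<close> triangularity survives, and for \<open>a = b\<close> the diagonal entry
  is multiplied by \<open>1 + t\<close>, so that the barrier changes by
  \<open>2 * \<mu> * ln (1 + t)\<close> however small the entry is.\<close>

definition move :: "real \<Rightarrow> nat \<Rightarrow> nat \<Rightarrow> (nat \<Rightarrow> nat \<Rightarrow> real) \<Rightarrow> nat \<Rightarrow> nat \<Rightarrow> real" where
  "move t a b L i j = (if j = b then L i b + t * L i a else L i j)"

definition shift :: "real \<Rightarrow> nat \<Rightarrow> nat \<Rightarrow> (nat \<Rightarrow> nat \<Rightarrow> real) \<Rightarrow> nat \<Rightarrow> nat \<Rightarrow> real" where
  "shift t a b L i j = t * (L i a * L j b + L i b * L j a) + t\<^sup>2 * (L i a * L j a)"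

lemma gram_move:
  assumes "b < n"
  shows "gram n (move t a b L) i j = gram n L i j + shift t a b L i j"
proof -
  have "gram n (move t a b L) i j = (\<Sum>k<n. L i k * L j k + (if k = b then shift t a b L i j else 0))"
    unfolding gram_def by (rule sum.cong) (auto simp: move_def shift_def power2_eq_square algebra_simps)
  also have "\<dots> = gram n L i j + (\<Sum>k<n. if k = b then shift t a b L i j else 0)"
    by (simp add: gram_def sum.distrib)
  also have "(\<Sum>k<n. if k = b then shift t a b L i j else 0) = shift t a b L i j"
    using assms by simp
  finally show ?thesis .
qed

lemma F_move:
  assumes "b < n"
  shows "F (gram n (move t a b L)) = F (gram n L) + (2 * t * S L a b + t\<^sup>2 * S L a a) -
    3/5 * dbl n (\<lambda>i j. p i * p j * (shift t a b L i j)\<^sup>2) - \<Lambda> * (\<Sum>i<n. (shift t a b L i i)\<^sup>2)"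
proof -
  have "dbl n (\<lambda>i j. G (gram n L) i j * shift t a b L i j) = t * (S L a b + S L b a) + t\<^sup>2 * S L a a"
    unfolding S_def dbl_add[symmetric] dbl_cmult[symmetric]
    by (rule dbl_cong) (simp add: shift_def algebra_simps)
  also have "\<dots> = 2 * t * S L a b + t\<^sup>2 * S L a a"
    using S_sym[of L a b] by simp
  moreover have "gram n (move t a b L) = (\<lambda>i j. gram n L i j + shift t a b L i j)"
    using gram_move[OF assms] by blast
  ultimately show ?thesis using F_expand[of "gram n L" "shift t a b L"] by simp
qed

definition lower :: "(nat \<Rightarrow> nat \<Rightarrow> real) \<Rightarrow> bool" where
  "lower L \<longleftrightarrow> (\<forall>i j. i < j \<longrightarrow> L i j = 0) \<and> (\<forall>i. 0 < L i i)"

text \<open>For lower triangular \<open>L\<close> the barrier is \<open>\<mu>\<close> times the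
  logarithm of the determinant of the Gram matrix.\<close>

definition Phi :: "(nat \<Rightarrow> nat \<Rightarrow> real) \<Rightarrow> real" where
  "Phi L = F (gram n L) + 2 * \<mu> * (\<Sum>a<n. ln (L a a))"

text \<open>The terms linear in the diagonal errors \<open>?y\<close>, coming from \<open>R\<close>
  and from \<open>ln x \<le> x - 1\<close>, are absorbed by half a square per vertex, which the
  penalty pays for. So the potential is bounded above, and a potential of at least -1 forces the
  diagonal close to 1.\<close>

lemma Phi_le:
  assumes "lower L"
  shows "Phi L \<le> 4 - (\<Lambda> - 1/2) * (\<Sum>i<n. (gram n L i i - 1)\<^sup>2)"
proof -
  let ?y = "\<lambda>i. gram n L i i - 1"
  have "dbl n (\<lambda>i j. w i j * gram n L i j) \<le> dbl n (\<lambda>i j. (1/2) * (w i j * gram n L i i) + (1/2) * (w i j * gram n L j j))"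
  proof (rule dbl_mono)
    fix i j
    have "gram n L i j \<le> (gram n L i i + gram n L j j) / 2"
      using abs_gram_le[of n L i j] by linarith
    then show "w i j * gram n L i j \<le> (1/2) * (w i j * gram n L i i) + (1/2) * (w i j * gram n L j j)"
      using mult_left_mono[OF _ w_nonneg, of _ _ i j] by (force simp: algebra_simps)
  qed
  also have "\<dots> = (\<Sum>i<n. p i * gram n L i i)"
    unfolding dbl_add dbl_cmult w_marginal by simp
  also have "\<dots> = (\<Sum>i<n. p i * ?y i) + 1"
    using p_sum by (simp add: algebra_simps sum.distrib sum_subtractf)
  finally have 1: "dbl n (\<lambda>i j. w i j * gram n L i j) \<le> (\<Sum>i<n. p i * ?y i) + 1" .
  have "dbl n (\<lambda>i j. p i * p j * (- 1/15)) \<le> dbl n (\<lambda>i j. p i * p j * phi (gram n L i j))"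
    by (intro dbl_mono mult_left_mono phi_ge) (simp add: p_nonneg)
  moreover have "dbl n (\<lambda>i j. p i * p j * (- 1/15)) = - 1/15"
    using dbl_cmult[of n "- 1/15" "\<lambda>i j. p i * p j"] pp_sum by (simp add: mult.commute)
  ultimately have 2: "- 1/15 \<le> dbl n (\<lambda>i j. p i * p j * phi (gram n L i j))" by simp
  have "2 * ln (L a a) \<le> ?y a" if "a < n" for a
  proof -
    have pos: "0 < L a a" using assms by (simp add: lower_def)
    then have "2 * ln (L a a) = ln ((L a a)\<^sup>2)" by (simp add: ln_realpow)
    also have "\<dots> \<le> (L a a)\<^sup>2 - 1" using pos by (intro ln_le_minus_one) simp
    also have "\<dots> \<le> ?y a" using entry_le_gram[OF that, of L a] by simp
    finally show ?thesis .
  qed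
  then have "(\<Sum>a<n. 2 * ln (L a a)) \<le> (\<Sum>a<n. ?y a)" by (intro sum_mono) auto
  then have 3: "2 * \<mu> * (\<Sum>a<n. ln (L a a)) \<le> \<mu> * (\<Sum>a<n. ?y a)"
    using mu by (simp add: sum_distrib_left[symmetric])
  \<comment> \<open>From \<open>2 x y \<le> x\<^sup>2 + y\<^sup>2\<close> with
    \<open>x = p i + \<mu>\<close>, which is at most 2. Summed over \<open>i\<close> the linear part
    is at most 2, as both \<open>p\<close> and \<open>\<mu>\<close> have total at most 1.\<close>
  have "(p i + \<mu>) * ?y i \<le> (p i + \<mu>) + 1/2 * (?y i)\<^sup>2" if "i < n" for i
  proof -
    have 1: "(p i + \<mu>) * ?y i \<le> 1/2 * (p i + \<mu>)\<^sup>2 + 1/2 * (?y i)\<^sup>2"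
      using sum_squares_bound[of "p i + \<mu>" "?y i"] unfolding mult.assoc by linarith
    have sq: "(p i + \<mu>)\<^sup>2 \<le> (p i + \<mu>) * 2"
      unfolding power2_eq_square using p_nonneg[of i] p_le_1[OF that] mu mu1 by (intro mult_left_mono) auto
    from 1 sq show ?thesis by argo
  qed
  then have "(\<Sum>i<n. (p i + \<mu>) * ?y i) \<le> (\<Sum>i<n. (p i + \<mu>) + 1/2 * (?y i)\<^sup>2)" by (intro sum_mono) auto
  also have "\<dots> = 1 + \<mu> * n + 1/2 * (\<Sum>i<n. (?y i)\<^sup>2)"
    by (simp add: sum.distrib p_sum sum_divide_distrib[symmetric])
  finally have 4: "(\<Sum>i<n. (p i + \<mu>) * ?y i) \<le> 2 + 1/2 * (\<Sum>i<n. (?y i)\<^sup>2)" using mu by linarith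
  have 5: "(\<Sum>i<n. (p i + \<mu>) * ?y i) = (\<Sum>i<n. p i * ?y i) + \<mu> * (\<Sum>a<n. ?y a)"
    by (simp add: sum_distrib_left sum.distrib[symmetric] algebra_simps)
  show ?thesis
    unfolding Phi_def F_def R_def using 1 2 3 4 5 by (simp add: algebra_simps)
qed

lemma diag_near_1:
  assumes "lower L" "- 1 \<le> Phi L"
  shows "(\<Sum>i<n. (gram n L i i - 1)\<^sup>2) \<le> 5 / (\<Lambda> - 1/2)"
  using Phi_le[OF assms(1)] assms(2) Lam by (simp add: field_simps)

lemma diag_bound:
  assumes "lower L" "- 1 \<le> Phi L" "i < n"
  shows "\<bar>gram n L i i - 1\<bar> \<le> 1"
proof -
  have "(gram n L i i - 1)\<^sup>2 \<le> (\<Sum>i<n. (gram n L i i - 1)\<^sup>2)"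
    using assms(3) by (intro member_le_sum) auto
  also have "\<dots> \<le> 5 / (\<Lambda> - 1/2)" by (rule diag_near_1[OF assms(1,2)])
  also have "\<dots> \<le> 1" using Lam by simp
  finally show ?thesis using abs_square_le_1 by blast
qed

text \<open>The first-order gain is at least \<open>2 * \<tau> * \<eta>\<close>. The bound on
  \<open>Phi\<close> keeps the squared row norms of \<open>L\<close> below 2, so all second-order
  terms are of order \<open>\<Lambda> * n * \<eta>\<^sup>2\<close>, and the choice of
  \<open>\<eta>\<close> makes them at most \<open>\<tau> * \<eta>\<close>.\<close>

lemma move_gain:
  assumes L: "lower L" "- 1 \<le> Phi L" and ab: "a < n" "b \<le> a"
    and t: "\<bar>t\<bar> = \<eta>" and gain: "\<tau> * \<eta> \<le> t * (S L a b + (if a = b then \<mu> else 0))"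
  shows "lower (move t a b L)" "Phi L + \<eta> * \<tau> \<le> Phi (move t a b L)"
proof -
  have b: "b < n" using ab by simp
  let ?X = "gram n L"
  have big: "1000 \<le> 100 * \<Lambda> * n"
    using Lam n_pos mult_mono[of 10 \<Lambda> 1 "real n"] by simp
  have "1 * \<tau> \<le> n * \<tau>" using n_pos tau by (intro mult_right_mono) auto
  then have tau1: "\<tau> \<le> 1" using tau mu1 by linarith
  have "\<eta> * 1000 \<le> 1" using mult_left_mono[OF big, of \<eta>] eta tau1 by linarith
  then have eta1: "\<eta> \<le> 1/1000" by simp
  have X: "\<bar>?X i i - 1\<bar> \<le> 1" if "i < n" for i using diag_bound[OF L that] .
  have X2: "\<bar>?X i j\<bar> \<le> 2" if "i < n" "j < n" for i j
  proof -
    have "gram n L i i \<le> 2" "gram n L j j \<le> 2" using X[OF that(1)] X[OF that(2)] by (simp_all add: abs_le_iff)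
    then show ?thesis using abs_gram_le[of n L i j] by argo
  qed
  have LL: "\<bar>L i k * L j l\<bar> \<le> 2" if "i < n" "j < n" "k < n" "l < n" for i j k l
  proof -
    have "2 * \<bar>L i k * L j l\<bar> \<le> (L i k)\<^sup>2 + (L j l)\<^sup>2"
      using sum_squares_bound[of "\<bar>L i k\<bar>" "\<bar>L j l\<bar>"] by (simp add: abs_mult)
    moreover have "gram n L i i \<le> 2" "gram n L j j \<le> 2"
      using X[OF that(1)] X[OF that(2)] by (simp_all add: abs_le_iff)
    ultimately show ?thesis
      using entry_le_gram[OF that(3), of L i] entry_le_gram[OF that(4), of L j] by linarith
  qed
  have sh: "\<bar>shift t a b L i j\<bar> \<le> 6 * \<eta>" if "i < n" "j < n" for i j
  proof -
    have "\<bar>shift t a b L i j\<bar> \<le> \<bar>t\<bar> * (\<bar>L i a * L j b\<bar> + \<bar>L i b * L j a\<bar>) + t\<^sup>2 * \<bar>L i a * L j a\<bar>"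
      unfolding shift_def by (rule order_trans[OF abs_triangle_ineq])
        (auto simp: abs_mult intro!: add_mono mult_left_mono abs_triangle_ineq[THEN order_trans])
    also have "\<dots> \<le> \<eta> * (2 + 2) + \<eta> * 2"
    proof (intro add_mono mult_mono)
      have "t\<^sup>2 = \<eta> * \<eta>" using t by (metis power2_abs power2_eq_square)
      also have "\<dots> \<le> \<eta> * 1" using eta eta1 by (intro mult_left_mono) auto
      finally show "t\<^sup>2 \<le> \<eta>" by simp
    qed (use t LL that ab b eta in auto)
    finally show ?thesis by simp
  qed
  have sh2: "(shift t a b L i j)\<^sup>2 \<le> 36 * \<eta>\<^sup>2" if "i < n" "j < n" for i j
  proof -
    have "\<bar>shift t a b L i j\<bar>\<^sup>2 \<le> (6 * \<eta>)\<^sup>2" using sh[OF that] by (intro power_mono) auto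
    then show ?thesis by (simp add: power_mult_distrib)
  qed
  have e1: "dbl n (\<lambda>i j. p i * p j * (shift t a b L i j)\<^sup>2) \<le> 36 * \<eta>\<^sup>2"
  proof -
    have "dbl n (\<lambda>i j. p i * p j * (shift t a b L i j)\<^sup>2) \<le> dbl n (\<lambda>i j. (36 * \<eta>\<^sup>2) * (p i * p j))"
      using sh2 by (intro dbl_mono) (simp add: mult.commute mult_left_mono p_nonneg)
    then show ?thesis by (simp add: dbl_cmult pp_sum)
  qed
  have e2: "\<Lambda> * (\<Sum>i<n. (shift t a b L i i)\<^sup>2) \<le> \<Lambda> * (n * (36 * \<eta>\<^sup>2))"
    using Lam sum_mono[of "{..<n}" "\<lambda>i. (shift t a b L i i)\<^sup>2" "\<lambda>i. 36 * \<eta>\<^sup>2"] sh2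
    by (intro mult_left_mono) auto
  have e3: "- (8 + 4 * \<Lambda> * n) \<le> S L a a"
  proof -
    have "dbl n (\<lambda>i j. - (2 * w i j + 28/5 * (p i * p j) + (if i = j then 4 * \<Lambda> else 0))) \<le> S L a a"
      unfolding S_def
    proof (rule dbl_mono)
      fix i j assume ij: "i < n" "j < n"
      have pp: "0 \<le> p i * p j" by (simp add: p_nonneg)
      have "\<bar>p i * p j * (2/5 + 6/5 * ?X i j)\<bar> \<le> p i * p j * (14/5)"
      proof -
        have "\<bar>2/5 + 6/5 * ?X i j\<bar> \<le> 14/5" using X2[OF ij] unfolding abs_le_iff by linarith
        then show ?thesis
          unfolding abs_mult[of "p i * p j"] abs_of_nonneg[OF pp] using pp by (rule mult_left_mono)
      qed
      moreover have "\<bar>if i = j then 2 * \<Lambda> * (?X i i - 1) else 0\<bar> \<le> (if i = j then 2 * \<Lambda> else 0)"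
        using X[OF ij(1)] Lam mult_left_mono[of "\<bar>?X i i - 1\<bar>" 1 "2 * \<Lambda>"] by (auto simp: abs_mult)
      ultimately have g: "\<bar>G ?X i j\<bar> \<le> w i j + 14/5 * (p i * p j) + (if i = j then 2 * \<Lambda> else 0)"
        unfolding G_def using w_nonneg[of i j] by (simp only: abs_le_iff) linarith
      have "\<bar>L i a * G ?X i j * L j a\<bar> = \<bar>L i a * L j a\<bar> * \<bar>G ?X i j\<bar>"
        by (simp add: abs_mult)
      also have "\<dots> \<le> 2 * (w i j + 14/5 * (p i * p j) + (if i = j then 2 * \<Lambda> else 0))"
        using g LL[OF ij ab(1) ab(1)] by (intro mult_mono) auto
      finally show "- (2 * w i j + 28/5 * (p i * p j) + (if i = j then 4 * \<Lambda> else 0)) \<le> L i a * G ?X i j * L j a"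
        by (auto split: if_splits)
    qed
    moreover have "dbl n (\<lambda>i j. - (2 * w i j + 28/5 * (p i * p j) + (if i = j then 4 * \<Lambda> else 0))) =
        - (2 * dbl n w + 28/5 * dbl n (\<lambda>i j. p i * p j) + (\<Sum>i<n. 4 * \<Lambda>))"
      unfolding dbl_uminus dbl_add dbl_cmult dbl_diag ..
    ultimately show ?thesis by (simp add: w_sum pp_sum mult.commute)
  qed
  have t2: "t\<^sup>2 = \<eta>\<^sup>2" using t by (metis power2_abs)
  \<comment> \<open>Here 30 covers \<open>8 + 3/5 * 36\<close> and 40 is \<open>4 + 36\<close>: the
    contributions of \<open>S L a a\<close>, of the curvature of \<open>phi\<close> and of the
    penalty.\<close>
  have dF: "F ?X + 2 * t * S L a b - \<eta>\<^sup>2 * (30 + 40 * \<Lambda> * n) \<le> F (gram n (move t a b L))"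
  proof -
    define K where "K = \<eta>\<^sup>2 * (\<Lambda> * n)"
    have "\<eta>\<^sup>2 * - (8 + 4 * \<Lambda> * n) \<le> \<eta>\<^sup>2 * S L a a" using e3 by (intro mult_left_mono) auto
    moreover have eq: "\<eta>\<^sup>2 * - (8 + 4 * \<Lambda> * n) = - 8 * \<eta>\<^sup>2 - 4 * K"
      "\<eta>\<^sup>2 * (30 + 40 * \<Lambda> * n) = 30 * \<eta>\<^sup>2 + 40 * K" "\<Lambda> * (n * (36 * \<eta>\<^sup>2)) = 36 * K"
      by (simp_all add: K_def algebra_simps)
    ultimately have "- 8 * \<eta>\<^sup>2 - 4 * K \<le> \<eta>\<^sup>2 * S L a a" by argo
    moreover have "\<Lambda> * (\<Sum>i<n. (shift t a b L i i)\<^sup>2) \<le> 36 * K" using e2 unfolding eq(3) .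
    ultimately show ?thesis
      unfolding F_move[OF b] t2 eq(2) using e1 zero_le_power2[of \<eta>] by linarith
  qed
  have t1: "\<bar>t\<bar> \<le> 1/2" "- 1 < t" using t eta1 by auto
  show low: "lower (move t a b L)"
  proof -
    have "0 < L i i + t * L i i" for i
      using mult_pos_pos[of "1 + t" "L i i"] L(1) t1(2) by (simp add: lower_def algebra_simps)
    then have "0 < L b b + t * L b a" using L(1) ab by (cases "a = b") (auto simp: lower_def)
    then show ?thesis using L(1) ab by (auto simp: lower_def move_def)
  qed
  have dlog: "(\<Sum>a<n. ln (L a a)) + (if a = b then t - 2 * \<eta>\<^sup>2 else 0) \<le> (\<Sum>c<n. ln (move t a b L c c))"
  proof (cases "a = b")
    case False
    then have "move t a b L c c = L c c" for c using L(1) ab by (auto simp: move_def lower_def)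
    then show ?thesis using False by simp
  next
    case True
    have "ln (move t a b L c c) = ln (L c c) + (if c = b then ln (1 + t) else 0)" for c
    proof (cases "c = b")
      case True
      have "move t a b L b b = L b b * (1 + t)" using \<open>a = b\<close> by (simp add: move_def algebra_simps)
      moreover have "0 < L b b" using L(1) by (simp add: lower_def)
      ultimately show ?thesis using True t1(2) by (simp add: ln_mult)
    qed (simp add: move_def)
    then have "(\<Sum>c<n. ln (move t a b L c c)) = (\<Sum>c<n. ln (L c c)) + ln (1 + t)"
      using b by (simp add: sum.distrib)
    moreover have "t - 2 * \<eta>\<^sup>2 \<le> ln (1 + t)"
      using abs_ln_one_plus_x_minus_x_bound[OF t1(1)] unfolding t2 by linarith
    ultimately show ?thesis using True by simp
  qed
  have "2 * \<mu> * ((\<Sum>a<n. ln (L a a)) + (if a = b then t - 2 * \<eta>\<^sup>2 else 0)) \<le> 2 * \<mu> * (\<Sum>c<n. ln (move t a b L c c))"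
    using dlog mu by (intro mult_left_mono) auto
  moreover have "2 * \<mu> * (if a = b then t - 2 * \<eta>\<^sup>2 else 0) \<ge> 2 * t * (if a = b then \<mu> else 0) - 4 * \<eta>\<^sup>2"
    using mult_right_mono[OF mu1, of "\<eta>\<^sup>2"] by (auto simp: algebra_simps)
  ultimately have "Phi L + 2 * (t * (S L a b + (if a = b then \<mu> else 0))) - \<eta>\<^sup>2 * (34 + 40 * \<Lambda> * n) \<le> Phi (move t a b L)"
    unfolding Phi_def using dF by (simp add: algebra_simps)
  moreover have "\<eta>\<^sup>2 * (34 + 40 * \<Lambda> * n) \<le> \<eta> * \<tau>"
  proof -
    have "\<eta>\<^sup>2 * (34 + 40 * \<Lambda> * n) \<le> \<eta>\<^sup>2 * (100 * \<Lambda> * n)" using big by (intro mult_left_mono) auto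
    also have "\<dots> = \<eta> * (\<eta> * (100 * \<Lambda> * n))" by (simp add: power2_eq_square)
    also have "\<dots> \<le> \<eta> * \<tau>" using eta by (intro mult_left_mono) auto
    finally show ?thesis .
  qed
  ultimately show "Phi L + \<eta> * \<tau> \<le> Phi (move t a b L)" using gain by (simp add: mult.commute)
qed


section \<open>Stationary points are nearly optimal\<close>

lemma forward_substitution:
  assumes "lower L"
  shows "\<exists>y. \<forall>i<m. z i = (\<Sum>j<m. L i j * y j)"
proof (induction m)
  case (Suc m)
  then obtain y where y: "\<forall>i<m. z i = (\<Sum>j<m. L i j * y j)" by blast
  define y' where "y' = y(m := (z m - (\<Sum>j<m. L m j * y j)) / L m m)"
  have eq: "(\<Sum>j<m. L i j * y' j) = (\<Sum>j<m. L i j * y j)" for i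
    by (rule sum.cong) (auto simp: y'_def)
  have "z i = (\<Sum>j<Suc m. L i j * y' j)" if "i < Suc m" for i
  proof (cases "i = m")
    case True
    have "L m m \<noteq> 0" using assms by (metis lower_def less_irrefl)
    then show ?thesis using True by (simp add: eq y'_def)
  next
    case False
    then show ?thesis using that y assms by (simp add: eq lower_def)
  qed
  then show ?case by blast
qed simp

definition stable :: "(nat \<Rightarrow> nat \<Rightarrow> real) \<Rightarrow> nat \<Rightarrow> nat \<Rightarrow> bool" where
  "stable L a b \<longleftrightarrow> \<bar>S L a b + (if a = b then \<mu> else 0)\<bar> \<le> \<tau>"

lemma stable_sym: "stable L a b \<longleftrightarrow> stable L b a"
  by (auto simp: stable_def S_sym[of L a b])

text \<open>A positive diagonal makes \<open>L\<close> invertible, so every \<open>z\<close> is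
  \<open>L y\<close> and the form becomes \<open>y\<^sup>T S y\<close>. There \<open>S\<close> is
  \<open>- \<mu> I\<close> up to entries of size \<open>\<tau>\<close>, whose form is at most
  \<open>n * \<tau>\<close> times the squared norm of \<open>y\<close>. Without the barrier a
  singular \<open>L\<close> could be stationary although \<open>G\<close> has a positive
  direction.\<close>

lemma G_nonpos:
  assumes "lower L" "\<And>a b. a < n \<Longrightarrow> b < n \<Longrightarrow> stable L a b"
  shows "dbl n (\<lambda>i j. z i * G (gram n L) i j * z j) \<le> 0"
proof -
  obtain y where y: "\<And>i. i < n \<Longrightarrow> z i = (\<Sum>a<n. L i a * y a)"
    using forward_substitution[OF assms(1), of n z] by blast
  have "dbl n (\<lambda>i j. z i * G (gram n L) i j * z j) =
      dbl n (\<lambda>i j. \<Sum>a<n. \<Sum>b<n. y a * y b * (L i a * G (gram n L) i j * L j b))"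
  proof (rule dbl_cong)
    fix i j assume "i < n" "j < n"
    then have "z i * G (gram n L) i j * z j = G (gram n L) i j * ((\<Sum>a<n. L i a * y a) * (\<Sum>b<n. L j b * y b))"
      by (simp add: y)
    also have "\<dots> = (\<Sum>a<n. \<Sum>b<n. y a * y b * (L i a * G (gram n L) i j * L j b))"
      unfolding sum_product unfolding sum_distrib_left by (intro sum.cong refl) (simp add: mult_ac)
    finally show "z i * G (gram n L) i j * z j = (\<Sum>a<n. \<Sum>b<n. y a * y b * (L i a * G (gram n L) i j * L j b))" .
  qed
  also have "\<dots> = (\<Sum>a<n. \<Sum>b<n. y a * y b * S L a b)"
    unfolding dbl_sum S_def dbl_cmult ..
  also have "\<dots> \<le> dbl n (\<lambda>a b. \<tau> * (\<bar>y a\<bar> * \<bar>y b\<bar>) + (if a = b then - \<mu> * (y a)\<^sup>2 else 0))"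
    unfolding dbl_def[symmetric]
  proof (rule dbl_mono)
    fix a b assume "a < n" "b < n"
    then have st: "\<bar>S L a b + (if a = b then \<mu> else 0)\<bar> \<le> \<tau>" using assms(2) by (simp add: stable_def)
    have "y a * y b * (S L a b + (if a = b then \<mu> else 0)) \<le> \<bar>y a * y b\<bar> * \<bar>S L a b + (if a = b then \<mu> else 0)\<bar>"
      unfolding abs_mult[symmetric] by simp
    also have "\<dots> \<le> \<bar>y a * y b\<bar> * \<tau>" using st by (intro mult_left_mono) auto
    finally have le: "y a * y b * (S L a b + (if a = b then \<mu> else 0)) \<le> \<bar>y a * y b\<bar> * \<tau>" .
    show "y a * y b * S L a b \<le> \<tau> * (\<bar>y a\<bar> * \<bar>y b\<bar>) + (if a = b then - \<mu> * (y a)\<^sup>2 else 0)"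
    proof (cases "a = b")
      case True
      then show ?thesis using le by (simp add: abs_mult power2_eq_square distrib_left mult_ac)
    next
      case False
      then show ?thesis using le by (simp add: abs_mult mult_ac)
    qed
  qed
  also have "\<dots> = \<tau> * (\<Sum>a<n. \<bar>y a\<bar>)\<^sup>2 - \<mu> * (\<Sum>a<n. (y a)\<^sup>2)"
    by (simp add: dbl_add dbl_cmult dbl_prod dbl_diag power2_eq_square sum_distrib_left sum_negf)
  also have "(\<Sum>a<n. \<bar>y a\<bar>)\<^sup>2 \<le> n * (\<Sum>a<n. (y a)\<^sup>2)"
    using sum_squared_le_sum_of_squares[of "\<lambda>a. \<bar>y a\<bar>" "{..<n}"] by (simp add: mult.commute)
  finally have "dbl n (\<lambda>i j. z i * G (gram n L) i j * z j) \<le> \<tau> * (n * (\<Sum>a<n. (y a)\<^sup>2)) - \<mu> * (\<Sum>a<n. (y a)\<^sup>2)"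
    using tau by simp
  also have "\<dots> = (n * \<tau> - \<mu>) * (\<Sum>a<n. (y a)\<^sup>2)" by (simp add: algebra_simps)
  also have "\<dots> \<le> 0" using tau by (intro mult_nonpos_nonneg sum_nonneg) auto
  finally show ?thesis .
qed

text \<open>A partition matrix is the sum of \<open>z z\<^sup>T\<close> over the indicator vectors
  \<open>z\<close> of its classes, so its product with \<open>G\<close> is nonpositive. The product
  of the Gram matrix with \<open>G\<close> is the trace of \<open>S\<close>, which is about
  \<open>- n * \<mu>\<close>. The supergradient inequality then compares the two values.\<close>

lemma stable_near_optimal:
  assumes L: "lower L" "\<And>a b. a < n \<Longrightarrow> b \<le> a \<Longrightarrow> stable L a b"
  shows "R (\<lambda>i j. of_bool (f i = f j)) \<le> R (gram n L) + n * (\<mu> + \<tau>)"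
proof -
  let ?X = "gram n L" and ?Y = "\<lambda>i j. of_bool (f i = f j) :: real"
  have st: "stable L a b" if "a < n" "b < n" for a b
    using L(2)[of a b] L(2)[of b a] that stable_sym by (cases "b \<le> a") auto
  have "dbl n (\<lambda>i j. G ?X i j * ?Y i j) =
      dbl n (\<lambda>i j. \<Sum>c\<in>f ` {..<n}. of_bool (f i = c) * G ?X i j * of_bool (f j = c))"
    by (rule dbl_cong) (simp add: sum.delta)
  also have "\<dots> = (\<Sum>c\<in>f ` {..<n}. dbl n (\<lambda>i j. of_bool (f i = c) * G ?X i j * of_bool (f j = c)))"
    by (rule dbl_sum)
  also have "\<dots> \<le> 0" by (intro sum_nonpos G_nonpos L(1) st)
  finally have 1: "dbl n (\<lambda>i j. G ?X i j * ?Y i j) \<le> 0" .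
  have "dbl n (\<lambda>i j. G ?X i j * ?X i j) = (\<Sum>a<n. S L a a)"
  proof -
    have "dbl n (\<lambda>i j. G ?X i j * ?X i j) = dbl n (\<lambda>i j. \<Sum>a<n. L i a * G ?X i j * L j a)"
    proof (rule dbl_cong)
      fix i j
      have "G ?X i j * ?X i j = G ?X i j * (\<Sum>a<n. L i a * L j a)" by (simp add: gram_def)
      also have "\<dots> = (\<Sum>a<n. L i a * G ?X i j * L j a)" unfolding sum_distrib_left by (simp add: mult_ac)
      finally show "G ?X i j * ?X i j = (\<Sum>a<n. L i a * G ?X i j * L j a)" .
    qed
    then show ?thesis by (simp add: dbl_sum S_def)
  qed
  also have "\<dots> \<ge> (\<Sum>a<n. - (\<mu> + \<tau>))"
    using st by (intro sum_mono) (fastforce simp: stable_def abs_le_iff)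
  finally have 2: "- (n * (\<mu> + \<tau>)) \<le> dbl n (\<lambda>i j. G ?X i j * ?X i j)"
    by (simp add: algebra_simps)
  have "R ?Y = F ?Y" by (simp add: F_def)
  also have "\<dots> \<le> F ?X + dbl n (\<lambda>i j. G ?X i j * (?Y i j - ?X i j))" by (rule F_concave)
  also have "dbl n (\<lambda>i j. G ?X i j * (?Y i j - ?X i j)) = dbl n (\<lambda>i j. G ?X i j * ?Y i j) - dbl n (\<lambda>i j. G ?X i j * ?X i j)"
    unfolding dbl_diff[symmetric] by (simp add: right_diff_distrib)
  finally have "R ?Y \<le> F ?X + n * (\<mu> + \<tau>)" using 1 2 by simp
  moreover have "F ?X \<le> R ?X" using Lam by (simp add: F_def sum_nonneg)
  ultimately show ?thesis by simp
qed

section \<open>Sweeps of the local search\<close>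

definition step :: "nat \<Rightarrow> nat \<Rightarrow> (nat \<Rightarrow> nat \<Rightarrow> real) \<Rightarrow> nat \<Rightarrow> nat \<Rightarrow> real" where
  "step a b L =
     (if \<tau> < S L a b + (if a = b then \<mu> else 0) then move \<eta> a b L
      else if S L a b + (if a = b then \<mu> else 0) < - \<tau> then move (- \<eta>) a b L
      else L)"

definition progress :: "(nat \<Rightarrow> nat \<Rightarrow> real) \<Rightarrow> (nat \<Rightarrow> nat \<Rightarrow> real) \<Rightarrow> bool" where
  "progress L L' \<longleftrightarrow> lower L' \<and> (L' = L \<or> Phi L + \<eta> * \<tau> \<le> Phi L')"

lemma progress_Phi: "progress L L' \<Longrightarrow> Phi L \<le> Phi L'"
  using eta_tau by (auto simp: progress_def)

lemma progress_trans: "progress L L' \<Longrightarrow> progress L' L'' \<Longrightarrow> progress L L''"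
  using eta tau progress_Phi[of L L'] progress_Phi[of L' L''] by (auto simp: progress_def)

lemma step_progress:
  assumes "lower L" "- 1 \<le> Phi L" "a < n" "b \<le> a"
  shows "progress L (step a b L) \<and> (step a b L = L \<longrightarrow> stable L a b)"
proof -
  let ?s = "S L a b + (if a = b then \<mu> else 0)"
  \<comment> \<open>A move raises \<open>Phi\<close> and so never returns \<open>L\<close> itself;
    hence \<open>step a b L = L\<close> means that no move was made.\<close>
  have ne: "L' \<noteq> L" if "Phi L + \<eta> * \<tau> \<le> Phi L'" for L'
    using that eta tau by (auto simp: mult_le_0_iff)
  consider "\<tau> < ?s" | "?s < - \<tau>" | "\<bar>?s\<bar> \<le> \<tau>" by linarith
  then show ?thesis
  proof cases
    case 1
    then have "\<tau> * \<eta> \<le> \<eta> * ?s" using eta by (simp add: mult.commute)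
    from move_gain[OF assms _ this] 1 show ?thesis
      using eta ne by (auto simp: step_def progress_def)
  next
    case 2
    then have "\<eta> * \<tau> \<le> \<eta> * - ?s" using eta by (intro mult_left_mono) auto
    then have "\<tau> * \<eta> \<le> - \<eta> * ?s" by (simp only: mult_minus_left mult_minus_right mult.commute[of \<tau> \<eta>])
    from move_gain[OF assms _ this] 2 tau show ?thesis
      using eta ne by (auto simp: step_def progress_def)
  next
    case 3
    then show ?thesis using assms(1) tau by (auto simp: step_def progress_def stable_def)
  qed
qed

definition sweep :: "(nat \<Rightarrow> nat \<Rightarrow> real) \<Rightarrow> nat \<Rightarrow> nat \<Rightarrow> real" where
  "sweep = fold (\<lambda>a. fold (\<lambda>b. step a b) [0..<Suc a]) [0..<n]"

text \<open>\<open>Phi\<close> never decreases along the fold and grows strictly at every change. So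
  a fold that ends where it began has changed nothing on the way, and all its tests were passed at
  one and the same \<open>L\<close>.\<close>

lemma fold_progress:
  assumes "\<And>x L. x \<in> set xs \<Longrightarrow> lower L \<Longrightarrow> - 1 \<le> Phi L \<Longrightarrow> progress L (f x L) \<and> (f x L = L \<longrightarrow> Q x L)"
    and "lower L" "- 1 \<le> Phi L"
  shows "progress L (fold f xs L) \<and> (fold f xs L = L \<longrightarrow> (\<forall>x\<in>set xs. Q x L))"
  using assms
proof (induction xs arbitrary: L)
  case Nil
  then show ?case by (simp add: progress_def)
next
  case (Cons x xs)
  have 1: "progress L (f x L)" "f x L = L \<longrightarrow> Q x L" using Cons.prems by auto
  have 2: "lower (f x L)" "- 1 \<le> Phi (f x L)"
    using 1 progress_Phi[OF 1(1)] Cons.prems by (auto simp: progress_def)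
  have 3: "progress (f x L) (fold f xs (f x L))"
    "fold f xs (f x L) = f x L \<longrightarrow> (\<forall>x'\<in>set xs. Q x' (f x L))"
    using Cons.IH[OF _ 2] Cons.prems(1) by auto
  have "f x L = L" if "fold f xs (f x L) = L"
  proof (rule ccontr)
    assume "f x L \<noteq> L"
    then have "Phi L + \<eta> * \<tau> \<le> Phi (f x L)" using 1 by (auto simp: progress_def)
    then show False using progress_Phi[OF 3(1)] that eta_tau by simp
  qed
  note fixpoint = this
  have "Q x' L" if "fold f (x # xs) L = L" "x' \<in> set (x # xs)" for x'
  proof -
    have "fold f xs (f x L) = L" using that(1) by simp
    then have fx: "f x L = L" by (rule fixpoint)
    show ?thesis
    proof (cases "x' = x")
      case True
      then show ?thesis using 1(2) fx by blast
    next
      case False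
      then show ?thesis using 3(2) that unfolding fold.simps comp_def fx by simp
    qed
  qed
  then show ?case using progress_trans[OF 1(1) 3(1)] by simp
qed

lemma sweep_progress:
  assumes "lower L" "- 1 \<le> Phi L"
  shows "progress L (sweep L) \<and> (sweep L = L \<longrightarrow> (\<forall>a<n. \<forall>b\<le>a. stable L a b))"
proof -
  have "progress L (fold (\<lambda>b. step a b) [0..<Suc a] L) \<and>
      (fold (\<lambda>b. step a b) [0..<Suc a] L = L \<longrightarrow> (\<forall>b\<in>set [0..<Suc a]. stable L a b))"
    if "a < n" "lower L" "- 1 \<le> Phi L" for a L
    using that by (intro fold_progress step_progress) auto
  from fold_progress[of "[0..<n]" "\<lambda>a. fold (\<lambda>b. step a b) [0..<Suc a]"
      "\<lambda>a L. \<forall>b\<in>set [0..<Suc a]. stable L a b", OF _ assms] this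
  have "progress L (sweep L) \<and> (sweep L = L \<longrightarrow> (\<forall>a\<in>set [0..<n]. \<forall>b\<in>set [0..<Suc a]. stable L a b))"
    unfolding sweep_def by simp
  then show ?thesis by (auto simp del: upt_Suc)
qed

definition L0 :: "nat \<Rightarrow> nat \<Rightarrow> real" where
  "L0 i j = of_bool (i = j)"

lemma L0: "lower L0" "- 1 \<le> Phi L0"
proof -
  show "lower L0" by (simp add: lower_def L0_def)
  have g: "gram n L0 i j = (if i = j then 1 else 0)" if "i < n" for i j
    using that by (simp add: gram_def L0_def of_bool_def mult_ac if_distrib[of "\<lambda>x. _ * x"] if_distrib[of "\<lambda>x. x * _"] cong: if_cong)
  have "0 \<le> dbl n (\<lambda>i j. w i j * gram n L0 i j)"
    unfolding dbl_def by (intro sum_nonneg) (simp add: g w_nonneg)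
  moreover have "dbl n (\<lambda>i j. p i * p j * phi (gram n L0 i j)) \<le> dbl n (\<lambda>i j. p i * p j)"
    by (intro dbl_mono) (simp add: g phi_def p_nonneg)
  moreover have "(\<Sum>a<n. ln (L0 a a)) = 0" by (simp add: L0_def)
  ultimately show "- 1 \<le> Phi L0"
    by (simp add: Phi_def F_def R_def g pp_sum)
qed

text \<open>An iterate fixed by a sweep stays fixed. If the last one is not fixed, every sweep has
  gained \<open>\<eta> * \<tau>\<close>, in total more than the range of \<open>Phi\<close> from -1
  to 4 allows.\<close>

lemma solver_correct:
  assumes T: "5 < T * (\<eta> * \<tau>)"
  shows "lower ((sweep ^^ T) L0)"
    "R (\<lambda>i j. of_bool (f i = f j)) \<le> R (gram n ((sweep ^^ T) L0)) + n * (\<mu> + \<tau>)"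
    "(\<Sum>i<n. (gram n ((sweep ^^ T) L0) i i - 1)\<^sup>2) \<le> 5 / (\<Lambda> - 1/2)"
proof -
  have inv: "lower ((sweep ^^ k) L0) \<and> - 1 \<le> Phi ((sweep ^^ k) L0) \<and>
      (((sweep ^^ k) L0 = (sweep ^^ Suc k) L0) \<or> - 1 + Suc k * (\<eta> * \<tau>) \<le> Phi ((sweep ^^ Suc k) L0))" for k
  proof (induction k)
    case 0
    then show ?case using L0 sweep_progress[OF L0] by (auto simp: progress_def)
  next
    case (Suc k)
    let ?L = "(sweep ^^ k) L0"
    from Suc have 1: "progress ?L (sweep ?L)" using sweep_progress by blast
    then have 2: "lower (sweep ?L)" "- 1 \<le> Phi (sweep ?L)"
      using progress_Phi[OF 1] Suc by (auto simp: progress_def)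
    then have 3: "progress (sweep ?L) (sweep (sweep ?L))" using sweep_progress by blast
    show ?case
    proof (cases "?L = sweep ?L")
      case True
      then show ?thesis using 2 by simp
    next
      case False
      then have "- 1 + Suc k * (\<eta> * \<tau>) \<le> Phi (sweep ?L)" using Suc by simp
      then show ?thesis using 2 3 by (auto simp: progress_def algebra_simps)
    qed
  qed
  let ?L = "(sweep ^^ T) L0"
  show low: "lower ?L" using inv by blast
  show "(\<Sum>i<n. (gram n ?L i i - 1)\<^sup>2) \<le> 5 / (\<Lambda> - 1/2)"
    using diag_near_1 inv by blast
  have "sweep ?L = ?L"
  proof (rule ccontr)
    assume "sweep ?L \<noteq> ?L"
    then have "- 1 + Suc T * (\<eta> * \<tau>) \<le> Phi (sweep ?L)" using inv[of T] by auto
    also have "\<dots> \<le> 4"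
    proof -
      have "lower (sweep ?L)" using inv[of "Suc T"] by simp
      then have "Phi (sweep ?L) \<le> 4 - (\<Lambda> - 1/2) * (\<Sum>i<n. (gram n (sweep ?L) i i - 1)\<^sup>2)" by (rule Phi_le)
      moreover have "0 \<le> (\<Lambda> - 1/2) * (\<Sum>i<n. (gram n (sweep ?L) i i - 1)\<^sup>2)"
        using Lam by (intro mult_nonneg_nonneg sum_nonneg) auto
      ultimately show ?thesis by linarith
    qed
    finally have "Suc T * (\<eta> * \<tau>) \<le> 5" by simp
    then show False using T eta_tau by (simp add: algebra_simps)
  qed
  then have "\<forall>a<n. \<forall>b\<le>a. stable ?L a b" using sweep_progress inv by blast
  then show "R (\<lambda>i j. of_bool (f i = f j)) \<le> R (gram n ?L) + n * (\<mu> + \<tau>)"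
    by (intro stable_near_optimal low) auto
qed

end

section \<open>Dimension reduction\<close>

definition bucket_err :: "nat \<Rightarrow> (nat \<Rightarrow> nat \<Rightarrow> real) \<Rightarrow> nat \<Rightarrow> (nat \<Rightarrow> nat \<Rightarrow> real) \<Rightarrow> nat \<Rightarrow> nat \<Rightarrow> real" where
  "bucket_err k L a S i j = gram k S i j - gram a L i j"

definition tail :: "nat \<Rightarrow> (nat \<Rightarrow> nat \<Rightarrow> real) \<Rightarrow> nat \<Rightarrow> nat \<Rightarrow> real" where
  "tail n L a i = (\<Sum>x\<in>{a..<n}. (L i x)\<^sup>2)"

text \<open>A pessimistic estimator of \<open>k\<close> times the final squared error when every
  remaining column of \<open>L\<close> is added to a uniformly random bucket with a random sign. The
  terms with \<open>tail\<close> account for the columns to come: at the start they are twice the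
  product of the squared norms, at the end they vanish.\<close>

definition pair_pot :: "nat \<Rightarrow> nat \<Rightarrow> (nat \<Rightarrow> nat \<Rightarrow> real) \<Rightarrow> nat \<Rightarrow> (nat \<Rightarrow> nat \<Rightarrow> real) \<Rightarrow> nat \<Rightarrow> nat \<Rightarrow> real" where
  "pair_pot n k L a S i j = k * (bucket_err k L a S i j)\<^sup>2 +
     2 * (gram k S i i * tail n L a j + gram k S j j * tail n L a i + tail n L a i * tail n L a j)"

definition bucket_add :: "(nat \<Rightarrow> nat \<Rightarrow> real) \<Rightarrow> nat \<Rightarrow> nat \<Rightarrow> real \<Rightarrow> (nat \<Rightarrow> nat \<Rightarrow> real) \<Rightarrow> nat \<Rightarrow> nat \<Rightarrow> real" where
  "bucket_add L a b s S i b' = S i b' + (if b' = b then s * L i a else 0)"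

lemma gram_bucket_add:
  assumes "b < k" "s\<^sup>2 = 1"
  shows "gram k (bucket_add L a b s S) i j =
    gram k S i j + s * (S i b * L j a + L i a * S j b) + L i a * L j a"
proof -
  have "gram k (bucket_add L a b s S) i j = (\<Sum>x<k. S i x * S j x +
      (if x = b then s * (S i b * L j a + L i a * S j b) + s\<^sup>2 * (L i a * L j a) else 0))"
    unfolding gram_def by (rule sum.cong) (auto simp: bucket_add_def algebra_simps power2_eq_square)
  then show ?thesis using assms by (simp add: sum.distrib gram_def)
qed

lemma tail_Suc: "a < n \<Longrightarrow> tail n L (Suc a) i = tail n L a i - (L i a)\<^sup>2"
  unfolding tail_def by (simp add: sum.atLeast_Suc_lessThan)

text \<open>In the error the product \<open>L i a * L j a\<close> cancels, so that a random sign
  leaves the centred change \<open>s * ?x\<close>. The average of its square over the buckets is at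
  most \<open>2 / k\<close> times \<open>?Ni * ?\<beta>\<^sup>2 + ?\<alpha>\<^sup>2 * ?Nj\<close>,
  and this is what the shrinking tails release.\<close>

lemma pair_pot_step:
  assumes "a < n"
  shows "(\<Sum>b<k. pair_pot n k L (Suc a) (bucket_add L a b 1 S) i j +
      pair_pot n k L (Suc a) (bucket_add L a b (- 1) S) i j) \<le> 2 * real k * pair_pot n k L a S i j"
proof -
  let ?\<alpha> = "L i a" and ?\<beta> = "L j a"
  let ?Ni = "gram k S i i" and ?Nj = "gram k S j j" and ?ti = "tail n L a i" and ?tj = "tail n L a j"
  let ?e = "bucket_err k L a S i j"
  let ?M = "2 * (2 * ((?Ni + ?\<alpha>\<^sup>2) * (?tj - ?\<beta>\<^sup>2) + (?Nj + ?\<beta>\<^sup>2) * (?ti - ?\<alpha>\<^sup>2) + (?ti - ?\<alpha>\<^sup>2) * (?tj - ?\<beta>\<^sup>2)))"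
  have "pair_pot n k L (Suc a) (bucket_add L a b 1 S) i j + pair_pot n k L (Suc a) (bucket_add L a b (- 1) S) i j
    \<le> k * (2 * ?e\<^sup>2 + 4 * (S i b * S i b * ?\<beta>\<^sup>2 + ?\<alpha>\<^sup>2 * (S j b * S j b))) + ?M" if "b < k" for b
  proof -
    let ?x = "S i b * ?\<beta> + ?\<alpha> * S j b"
    have err: "bucket_err k L (Suc a) (bucket_add L a b s S) i j = ?e + s * ?x" if "s\<^sup>2 = 1" for s
      using gram_bucket_add[OF \<open>b < k\<close> that, of L a S i j] by (simp add: bucket_err_def gram_def)
    have sq: "?x\<^sup>2 \<le> 2 * (S i b * S i b * ?\<beta>\<^sup>2 + ?\<alpha>\<^sup>2 * (S j b * S j b))"
      using zero_le_power2[of "S i b * ?\<beta> - ?\<alpha> * S j b"] by (simp add: power2_eq_square algebra_simps)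
    have Nx: "gram k (bucket_add L a b s S) x x = gram k S x x + s * (2 * L x a * S x b) + (L x a)\<^sup>2" if "s\<^sup>2 = 1" for s x
      using gram_bucket_add[OF \<open>b < k\<close> that, of L a S x x] by (simp add: power2_eq_square algebra_simps)
    have "pair_pot n k L (Suc a) (bucket_add L a b 1 S) i j + pair_pot n k L (Suc a) (bucket_add L a b (- 1) S) i j
      = k * (2 * ?e\<^sup>2 + 2 * ?x\<^sup>2) + ?M"
      unfolding pair_pot_def err[of 1, simplified] err[of "-1", simplified] Nx[of 1, simplified] Nx[of "-1", simplified]
        tail_Suc[OF assms]
      by (simp add: power2_eq_square algebra_simps)
    moreover have "k * (2 * ?e\<^sup>2 + 2 * ?x\<^sup>2) \<le> k * (2 * ?e\<^sup>2 + 4 * (S i b * S i b * ?\<beta>\<^sup>2 + ?\<alpha>\<^sup>2 * (S j b * S j b)))"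
      using sq by (intro mult_left_mono) auto
    ultimately show ?thesis by linarith
  qed
  then have "(\<Sum>b<k. pair_pot n k L (Suc a) (bucket_add L a b 1 S) i j + pair_pot n k L (Suc a) (bucket_add L a b (- 1) S) i j)
    \<le> (\<Sum>b<k. k * (2 * ?e\<^sup>2 + 4 * (S i b * S i b * ?\<beta>\<^sup>2 + ?\<alpha>\<^sup>2 * (S j b * S j b))) + ?M)"
    by (intro sum_mono) auto
  also have "\<dots> = k * (k * (2 * ?e\<^sup>2) + 4 * (?Ni * ?\<beta>\<^sup>2 + ?\<alpha>\<^sup>2 * ?Nj)) + k * ?M"
  proof -
    have "(\<Sum>b<k. k * (2 * E + 4 * (S i b * S i b * B + A * (S j b * S j b))) + M) =
        k * (k * (2 * E) + 4 * (?Ni * B + A * ?Nj)) + k * M" for A B E M :: real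
      by (simp add: sum.distrib gram_def sum_distrib_left[symmetric] sum_distrib_right[symmetric])
    then show ?thesis .
  qed
  also have "\<dots> = 2 * k * pair_pot n k L a S i j - 4 * k * (?\<alpha>\<^sup>2 * ?\<beta>\<^sup>2)"
    unfolding pair_pot_def by (simp add: algebra_simps)
  also have "\<dots> \<le> 2 * real k * pair_pot n k L a S i j" by simp
  finally show ?thesis .
qed

definition pot :: "nat \<Rightarrow> nat \<Rightarrow> (nat \<Rightarrow> nat \<Rightarrow> real) \<Rightarrow> (nat \<Rightarrow> nat \<Rightarrow> real) \<Rightarrow> nat \<Rightarrow> (nat \<Rightarrow> nat \<Rightarrow> real) \<Rightarrow> real" where
  "pot n k c L a S = dbl n (\<lambda>i j. c i j * pair_pot n k L a S i j)"

lemma pot_choice: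
  assumes c: "\<And>i j. 0 \<le> c i j" and "a < n" "0 < k"
  shows "\<exists>b<k. \<exists>s\<in>{1, -1}. pot n k c L (Suc a) (bucket_add L a b s S) \<le> pot n k c L a S"
proof (rule ccontr)
  let ?P = "\<lambda>b s. pot n k c L (Suc a) (bucket_add L a b s S)"
  assume "\<not> ?thesis"
  then have "(\<Sum>b<k. 2 * pot n k c L a S) < (\<Sum>b<k. ?P b 1 + ?P b (- 1))"
    using assms by (intro sum_strict_mono) (auto simp: not_le)
  also have "(\<Sum>b<k. ?P b 1 + ?P b (- 1)) = dbl n (\<lambda>i j. c i j *
      (\<Sum>b<k. pair_pot n k L (Suc a) (bucket_add L a b 1 S) i j + pair_pot n k L (Suc a) (bucket_add L a b (- 1) S) i j))"
    unfolding pot_def dbl_add[symmetric] dbl_sum[symmetric] sum_distrib_left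
    by (simp add: distrib_left)
  also have "\<dots> \<le> dbl n (\<lambda>i j. c i j * (2 * k * pair_pot n k L a S i j))"
    using mult_left_mono[OF pair_pot_step[OF assms(2)] c] by (intro dbl_mono) simp
  also have "\<dots> = 2 * k * pot n k c L a S"
    unfolding pot_def dbl_cmult[symmetric] by (simp add: mult_ac)
  finally show False by simp
qed

lemma pot_final:
  assumes "0 < k" "pot n k c L n S \<le> pot n k c L 0 (\<lambda>_ _. 0)"
  shows "dbl n (\<lambda>i j. c i j * (gram k S i j - gram n L i j)\<^sup>2) \<le> 2 / k * dbl n (\<lambda>i j. c i j * (gram n L i i * gram n L j j))"
proof -
  have "pot n k c L n S = k * dbl n (\<lambda>i j. c i j * (gram k S i j - gram n L i j)\<^sup>2)"
    unfolding pot_def dbl_cmult[symmetric] by (simp add: pair_pot_def bucket_err_def tail_def mult_ac)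
  moreover have "pot n k c L 0 (\<lambda>_ _. 0) = 2 * dbl n (\<lambda>i j. c i j * (gram n L i i * gram n L j j))"
    unfolding pot_def dbl_cmult[symmetric]
    by (simp add: pair_pot_def bucket_err_def tail_def gram_def atLeast0LessThan power2_eq_square mult_ac)
  ultimately show ?thesis using assms by (simp add: field_simps)
qed

section \<open>The collision probability of two or three random hyperplanes\<close>

definition coll :: "real \<Rightarrow> real" where
  "coll a = 87/100 * a^2 + 13/100 * a^3"

lemma cos_lower: "1 - x\<^sup>2 / 2 \<le> cos (x :: real)"
proof -
  have "\<bar>sin (x / 2)\<bar>\<^sup>2 \<le> \<bar>x / 2\<bar>\<^sup>2" using abs_sin_x_le_abs_x[of "x / 2"] by (intro power_mono) auto
  moreover have "cos x = 1 - 2 * (sin (x / 2))\<^sup>2" using cos_double_sin[of "x / 2"] by simp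
  ultimately show ?thesis by (simp add: power_divide)
qed

lemma sin_lower:
  assumes "0 \<le> x"
  shows "x - x^3 / 6 \<le> sin (x :: real)"
proof -
  let ?f = "\<lambda>x :: real. sin x - x + x^3 / 6"
  have d: "(?f has_real_derivative (cos t - 1 + 3 * t\<^sup>2 / 6)) (at t)" for t
    by (rule derivative_eq_intros refl | simp)+
  have "\<exists>y. (?f has_real_derivative y) (at t) \<and> 0 \<le> y" for t
  proof (intro exI conjI)
    show "(?f has_real_derivative (cos t - 1 + 3 * t\<^sup>2 / 6)) (at t)" by (rule d)
    show "0 \<le> cos t - 1 + 3 * t\<^sup>2 / 6" using cos_lower[of t] by argo
  qed
  then have "?f 0 \<le> ?f x" by (rule DERIV_nonneg_imp_nondecreasing[OF assms])
  then show ?thesis unfolding sin_zero power3_eq_cube mult_zero_left by argo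
qed

text \<open>The tangent at \<open>107 / 125\<close>, close to where the two sides of \<open>coll_ge\<close> nearly touch.\<close>

lemma sin_tangent:
  assumes "0 \<le> x" "x \<le> pi"
  shows "sin x \<le> sin (107/125) + cos (107/125) * (x - 107/125)"
proof -
  let ?x0 = "107/125 :: real"
  let ?f = "\<lambda>x. cos ?x0 * x - sin x"
  have pi: "?x0 \<le> pi" using pi_gt3 by simp
  have d: "(?f has_real_derivative (cos ?x0 - cos t)) (at t)" for t
    by (auto intro!: derivative_eq_intros)
  have "?f ?x0 \<le> ?f x"
  proof (cases "x \<le> ?x0")
    case True
    have "\<exists>y. (?f has_real_derivative y) (at t) \<and> y \<le> 0" if "x \<le> t" "t \<le> ?x0" for t
      using d[of t] cos_monotone_0_pi_le[of t ?x0] that assms pi by (intro exI[of _ "cos ?x0 - cos t"]) auto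
    then show ?thesis by (rule DERIV_nonpos_imp_nonincreasing[OF True])
  next
    case False
    have "\<exists>y. (?f has_real_derivative y) (at t) \<and> 0 \<le> y" if "?x0 \<le> t" "t \<le> x" for t
      using d[of t] cos_monotone_0_pi_le[of ?x0 t] that assms pi by (intro exI[of _ "cos ?x0 - cos t"]) auto
    then show ?thesis using False by (intro DERIV_nonneg_imp_nondecreasing[of ?x0 x ?f]) auto
  qed
  then show ?thesis by (simp add: algebra_simps)
qed

lemma sum_lessThan_8:
  "(\<Sum>m<8::nat. f m) = f 0 + f 1 + f 2 + f 3 + f 4 + f 5 + f 6 + (f 7 :: 'a :: comm_monoid_add)"
  by (simp add: eval_nat_numeral)

lemma sin_x0: "sin (107/125 :: real) \<le> 755234/1000000"
proof -
  have "sin x \<le> x - x^3 / 6 + x^5 / 120 - x^7 / 5040 + \<bar>x\<bar>^8 / 40320" for x :: real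
  proof -
    have "(\<Sum>m<8. sin_coeff m * x ^ m) = x - x^3 / 6 + x^5 / 120 - x^7 / 5040"
      unfolding sum_lessThan_8 by (simp add: sin_coeff_def fact_numeral)
    moreover have "inverse (fact 8) * \<bar>x\<bar> ^ 8 = \<bar>x\<bar>^8 / 40320" by (simp add: fact_numeral)
    ultimately show ?thesis using Maclaurin_sin_bound[of x 8] unfolding abs_le_iff by linarith
  qed
  from this[of "107/125"] have "sin (107/125 :: real) \<le> 107/125 - (107/125)^3 / 6 + (107/125)^5 / 120 - (107/125)^7 / 5040 + (107/125)^8 / 40320"
    by simp
  also have "\<dots> \<le> 755234/1000000" by (simp add: power_divide)
  finally show ?thesis .
qed

lemma cos_x0: "cos (107/125 :: real) \<in> {655449/1000000..655464/1000000}"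
proof -
  have "\<bar>cos x - (1 - x^2 / 2 + x^4 / 24 - x^6 / 720)\<bar> \<le> x^8 / 40320" for x :: real
  proof -
    obtain t where t: "cos x = (\<Sum>m<8. cos_coeff m * x ^ m) + cos (t + 1/2 * real 8 * pi) / fact 8 * x ^ 8"
      using Maclaurin_cos_expansion[of x 8] by blast
    have "(\<Sum>m<8. cos_coeff m * x ^ m) = 1 - x^2 / 2 + x^4 / 24 - x^6 / 720"
      unfolding sum_lessThan_8 by (simp add: cos_coeff_def fact_numeral)
    moreover have "\<bar>cos (t + 1/2 * real 8 * pi) / fact 8 * x ^ 8\<bar> \<le> 1 / fact 8 * x ^ 8"
      unfolding abs_mult abs_divide by (intro mult_mono frac_le abs_cos_le_one) auto
    ultimately show ?thesis using t by (simp add: fact_numeral)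
  qed
  from this[of "107/125"]
  have "cos (107/125 :: real) \<le> 1 - (107/125)^2 / 2 + (107/125)^4 / 24 - (107/125)^6 / 720 + (107/125)^8 / 40320"
    "1 - (107/125)^2 / 2 + (107/125)^4 / 24 - (107/125)^6 / 720 - (107/125)^8 / 40320 \<le> cos (107/125 :: real)"
    unfolding abs_le_iff by linarith+
  moreover have "1 - (107/125)^2 / 2 + (107/125)^4 / 24 - (107/125)^6 / 720 + (107/125)^8 / 40320 \<le> (655464/1000000 :: real)"
    by (simp add: power_divide)
  moreover have "(655449/1000000 :: real) \<le> 1 - (107/125)^2 / 2 + (107/125)^4 / 24 - (107/125)^6 / 720 - (107/125)^8 / 40320"
    by (simp add: power_divide)
  ultimately show ?thesis unfolding atLeastAtMost_iff by (meson order_trans)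
qed

lemma coll_mono: "0 \<le> a \<Longrightarrow> a \<le> b \<Longrightarrow> coll a \<le> coll b"
  unfolding coll_def by (intro add_mono mult_left_mono power_mono) auto

lemma coll_shift: "coll (u + 1/2) = 13/100 * u^3 + 1065/1000 * u\<^sup>2 + 9675/10000 * u + 23375/100000"
  by (simp add: coll_def power2_eq_square power3_eq_cube field_simps)

lemma pi_bounds: "3141592/1000000 \<le> pi" "pi \<le> 3141593/1000000"
  using pi_approx by simp_all

lemma cos_eq_sin: "cos (pi * (1 - a)) = sin (pi * (a - 1/2))"
proof -
  have "cos (pi * (1 - a)) = sin (pi / 2 - pi * (1 - a))" by (simp add: sin_cos_eq)
  also have "pi / 2 - pi * (1 - a) = pi * (a - 1/2)" by (simp add: algebra_simps)
  finally show ?thesis .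
qed

lemma cos_near_1:
  assumes "0 \<le> d" "d \<le> 1/10"
  shows "1 - 5 * d\<^sup>2 \<le> cos (pi * d)"
proof -
  have "pi\<^sup>2 \<le> (3141593/1000000)\<^sup>2" using pi_bounds pi_ge_zero by (intro power_mono) auto
  then have "pi\<^sup>2 \<le> 10" by (simp add: power2_eq_square)
  then have "(pi * d)\<^sup>2 / 2 \<le> 5 * d\<^sup>2"
    using mult_right_mono[of "pi\<^sup>2" 10 "d\<^sup>2"] by (simp add: power_mult_distrib)
  then show ?thesis using cos_lower[of "pi * d"] by linarith
qed

text \<open>Nearly an equality around \<open>a = 0.77\<close>. On \<open>a \<ge> 1/2\<close> the
  concave sine lies below a tangent and the convex cubic above one, which reduces the claim to
  linear functions. For \<open>a \<le> 1/2\<close> the cosine is nonpositive and crude estimates are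
  enough.\<close>

lemma coll_ge:
  assumes "0 \<le> a" "a \<le> 1"
  shows "383/500 * cos (pi * (1 - a)) + 1/2000 \<le> coll a"
proof -
  consider "1/2 \<le> a" | "1/10 \<le> a" "a \<le> 1/2" | "a \<le> 1/10" by linarith
  then show ?thesis
  proof cases
    case 1
    define u where "u = a - 1/2"
    have u: "0 \<le> u" "u \<le> 1/2" and a: "a = u + 1/2" using 1 assms by (auto simp: u_def)
    let ?s = "sin (107/125 :: real)" and ?c = "cos (107/125 :: real)"
    have "pi * u \<le> pi * 1" using u by (intro mult_left_mono) auto
    then have "sin (pi * u) \<le> ?s + ?c * (pi * u - 107/125)"
      using u by (intro sin_tangent) auto
    also have "\<dots> = ?s + (?c * pi) * u - ?c * (107/125)" by (simp add: algebra_simps)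
    also have "\<dots> \<le> 755234/1000000 + (655464/1000000 * (3141593/1000000)) * u - 655449/1000000 * (107/125)"
    proof -
      have "?c * pi \<le> 655464/1000000 * (3141593/1000000)"
        using cos_x0 pi_bounds by (intro mult_mono) auto
      then have "(?c * pi) * u \<le> (655464/1000000 * (3141593/1000000)) * u" using u by (intro mult_right_mono) auto
      then show ?thesis using sin_x0 cos_x0 unfolding atLeastAtMost_iff by argo
    qed
    finally have sin: "sin (pi * u) \<le> 755234/1000000 + (655464/1000000 * (3141593/1000000)) * u - 655449/1000000 * (107/125)" .
    \<comment> \<open>The product is the remainder of \<open>13/100 * u^3 + 1065/1000 * u^2\<close>
      over its tangent at 2727/10000, a point close to \<open>107/125 / pi\<close>, where the
      tangent of the sine touches.\<close>
    have "0 \<le> (u - 2727/10000)\<^sup>2 * (1065/1000 + 13/100 * (u + 2 * (2727/10000)))"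
      using u by (intro mult_nonneg_nonneg) auto
    also have "\<dots> = 13/100 * u^3 + 1065/1000 * u\<^sup>2 - 6098534631/10000000000 * u + 4223584082079/50000000000000"
    proof -
      have *: "(u - q)\<^sup>2 * (k + c * (u + 2 * q)) = c * u^3 + k * u\<^sup>2 - (2 * q * k + 3 * c * q\<^sup>2) * u + (q\<^sup>2 * k + 2 * c * q^3)"
        for q k c :: real
        by (simp add: power2_eq_square power3_eq_cube algebra_simps)
      have eq: "2 * (2727/10000) * (1065/1000) + 3 * (13/100) * (2727/10000)\<^sup>2 = (6098534631/10000000000 :: real)"
        "(2727/10000)\<^sup>2 * (1065/1000) + 2 * (13/100) * (2727/10000)^3 = (4223584082079/50000000000000 :: real)"
        by (simp_all add: power2_eq_square power3_eq_cube)
      show ?thesis unfolding *[of "2727/10000" "1065/1000" "13/100"] eq ..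
    qed
    finally have "383/500 * (755234/1000000 + (655464/1000000 * (3141593/1000000)) * u - 655449/1000000 * (107/125)) + 1/2000
      \<le> coll (u + 1/2)"
      unfolding coll_shift using u by argo
    moreover have "383/500 * sin (pi * u) \<le> 383/500 * (755234/1000000 + (655464/1000000 * (3141593/1000000)) * u - 655449/1000000 * (107/125))"
      using sin by (intro mult_left_mono) auto
    ultimately have "383/500 * sin (pi * u) + 1/2000 \<le> coll (u + 1/2)" by linarith
    then show ?thesis unfolding cos_eq_sin a by simp
  next
    case 2
    have "pi * (1/2 - a) \<le> pi * 1" using assms by (intro mult_left_mono) auto
    then have "0 \<le> sin (pi * (1/2 - a))" using 2 by (intro sin_ge_zero) auto
    moreover have "sin (pi * (a - 1/2)) = - sin (pi * (1/2 - a))"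
      using sin_minus[of "pi * (1/2 - a)"] by (simp add: algebra_simps)
    moreover have "coll (1/10) \<le> coll a" using 2 by (intro coll_mono) auto
    ultimately show ?thesis unfolding cos_eq_sin by (simp add: coll_def power2_eq_square power3_eq_cube)
  next
    case 3
    have "cos (pi * (1 - a)) = - cos (pi * a)" by (simp add: algebra_simps)
    moreover have "1 - 5 * a\<^sup>2 \<le> cos (pi * a)" using 3 assms by (intro cos_near_1) auto
    moreover have "a\<^sup>2 \<le> (1/10)\<^sup>2" using 3 assms by (intro power_mono) auto
    moreover have "0 \<le> coll a" using assms by (simp add: coll_def)
    ultimately show ?thesis by (simp add: power2_eq_square)
  qed
qed

lemma phi_mono: "0 \<le> x \<Longrightarrow> x \<le> y \<Longrightarrow> phi x \<le> phi y"
  unfolding phi_def by (intro add_mono mult_left_mono power_mono) auto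

lemma coll_le:
  assumes "0 \<le> a" "a \<le> 1"
  shows "coll a \<le> 117/500 + 383/500 * phi (cos (pi * (1 - a)))"
proof -
  \<comment> \<open>Near 1 the cosine is flat while \<open>coll\<close> falls linearly. Around
    \<open>1/2\<close> the sides nearly touch: their values are 0.23375 and 0.234, their slopes
    0.9675 and \<open>383/500 * 2/5 * pi\<close>, about 0.9626. Below 44/100 the lower bound of
    \<open>phi\<close> is enough.\<close>
  consider "9/10 \<le> a" | "1/2 \<le> a" "a \<le> 9/10" | "44/100 \<le> a" "a \<le> 1/2" | "a \<le> 44/100" by linarith
  then show ?thesis
  proof cases
    case 1
    define d where "d = 1 - a"
    have d: "0 \<le> d" "d \<le> 1/10" and a: "a = 1 - d" using 1 assms by (auto simp: d_def)
    have d2: "d\<^sup>2 \<le> d * (1/10)" unfolding power2_eq_square using d by (intro mult_left_mono) auto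
    have "phi (1 - 5 * d\<^sup>2) \<le> phi (cos (pi * d))"
      using cos_near_1[OF d] d2 d by (intro phi_mono) auto
    moreover have "coll (1 - d) \<le> 117/500 + 383/500 * (1 - 8 * d\<^sup>2)"
    proof -
      have "coll (1 - d) = 1 - d * (213/100 - 126/100 * d + 13/100 * d\<^sup>2)"
        by (simp add: coll_def power2_eq_square power3_eq_cube field_simps)
      moreover have "d * 1 \<le> d * (213/100 - 126/100 * d + 13/100 * d\<^sup>2)"
      proof (rule mult_left_mono)
        have "126/100 * d \<le> 126/1000" "0 \<le> 13/100 * d\<^sup>2" using d by auto
        then show "1 \<le> 213/100 - 126/100 * d + 13/100 * d\<^sup>2" by linarith
      qed (use d in auto)
      ultimately have "coll (1 - d) \<le> 1 - d" by (simp only: mult_1_right)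
      then show ?thesis using d2 d by argo
    qed
    moreover have "1 - 8 * d\<^sup>2 \<le> phi (1 - 5 * d\<^sup>2)"
    proof -
      have "(1 - 5 * d\<^sup>2)\<^sup>2 = 1 - 10 * d\<^sup>2 + 25 * (d\<^sup>2)\<^sup>2"
        by (simp add: power2_diff power_mult_distrib)
      then show ?thesis unfolding phi_def using zero_le_power2[of "d\<^sup>2"] by argo
    qed
    ultimately have "coll (1 - d) \<le> 117/500 + 383/500 * phi (cos (pi * d))" by argo
    then show ?thesis unfolding a by simp
  next
    case 2
    define u where "u = a - 1/2"
    have u: "0 \<le> u" "u \<le> 4/10" and a: "a = u + 1/2" using 2 by (auto simp: u_def)
    define l where "l = 3141592/1000000 * u - 5168/1000 * u^3"
    have u2: "u\<^sup>2 \<le> u * (4/10)" unfolding power2_eq_square using u by (intro mult_left_mono) auto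
    have "l \<le> pi * u - (pi * u)^3 / 6"
    proof -
      have "pi^3 \<le> (3141593/1000000)^3" using pi_bounds by (intro power_mono) auto
      then have "pi^3 / 6 \<le> 5168/1000" by (simp add: power3_eq_cube)
      then have "pi^3 / 6 * u^3 \<le> 5168/1000 * u^3" using u by (intro mult_right_mono) auto
      moreover have "3141592/1000000 * u \<le> pi * u" using pi_bounds u by (intro mult_right_mono) auto
      ultimately show ?thesis by (simp add: l_def power_mult_distrib)
    qed
    also have "\<dots> \<le> sin (pi * u)" using u by (intro sin_lower) auto
    finally have l: "l \<le> sin (pi * u)" .
    have l': "l = u * (3141592/1000000 - 5168/1000 * u\<^sup>2)" by (simp add: l_def power2_eq_square power3_eq_cube algebra_simps)
    have "0 \<le> l" unfolding l' using u u2 by (intro mult_nonneg_nonneg) auto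
    with l have "phi l \<le> phi (sin (pi * u))" by (intro phi_mono) auto
    moreover have "coll (u + 1/2) \<le> 117/500 + 383/500 * phi l"
    proof -
      have p: "phi l = 2/5 * (3141592/1000000 * u - 5168/1000 * u^3) +
          3/5 * (u\<^sup>2 * (3141592/1000000 - 5168/1000 * u\<^sup>2)\<^sup>2)"
      proof -
        have "l\<^sup>2 = u\<^sup>2 * (3141592/1000000 - 5168/1000 * u\<^sup>2)\<^sup>2" unfolding l' by (rule power_mult_distrib)
        then show ?thesis unfolding phi_def l_def by argo
      qed
      have "(3141592/1000000)\<^sup>2 - 33 * u\<^sup>2 \<le> (3141592/1000000 - 5168/1000 * u\<^sup>2)\<^sup>2"
      proof -
        have "(3141592/1000000 - 5168/1000 * u\<^sup>2)\<^sup>2 = (3141592/1000000)\<^sup>2 - 2 * (3141592/1000000) * (5168/1000) * u\<^sup>2 + (5168/1000 * u\<^sup>2)\<^sup>2"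
          by (simp add: power2_diff)
        then show ?thesis using zero_le_power2[of "5168/1000 * u\<^sup>2"] zero_le_power2[of u] by linarith
      qed
      then have q: "u\<^sup>2 * ((3141592/1000000)\<^sup>2 - 33 * u\<^sup>2) \<le> u\<^sup>2 * (3141592/1000000 - 5168/1000 * u\<^sup>2)\<^sup>2"
        by (intro mult_left_mono) auto
      have "u\<^sup>2 * (3141592/1000000)\<^sup>2 - 33 * u^4 \<le> u\<^sup>2 * (3141592/1000000 - 5168/1000 * u\<^sup>2)\<^sup>2"
        using q by (simp add: algebra_simps power_numeral_reduce)
      moreover have "u^3 \<le> 4/10 * u\<^sup>2"
        using mult_right_mono[OF u(2), of "u\<^sup>2"] by (simp add: power_numeral_reduce mult_ac)
      moreover have "u^4 \<le> 16/100 * u\<^sup>2"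
        using mult_right_mono[OF power_mono[OF u(2,1), of 2], of "u\<^sup>2"] by (simp add: power_numeral_reduce power2_eq_square mult_ac)
      \<comment> \<open>The tangent of the square at 7/1000 absorbs the small excess of the slope of
        \<open>coll\<close> at \<open>u = 0\<close> over that of the right side.\<close>
      moreover have "14/1000 * u - 49/1000000 \<le> u\<^sup>2"
        using zero_le_power2[of "u - 7/1000"] by (simp add: power2_eq_square field_simps)
      moreover have "(3141592/1000000 :: real)\<^sup>2 \<ge> 98695/10000" by (simp add: power2_eq_square)
      then have "u\<^sup>2 * (98695/10000) \<le> u\<^sup>2 * (3141592/1000000)\<^sup>2" by (intro mult_left_mono) auto
      ultimately show ?thesis
        unfolding coll_shift p using u by argo
    qed
    ultimately show ?thesis unfolding cos_eq_sin a by simp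
  next
    case 3
    define v where "v = 1/2 - a"
    have v: "0 \<le> v" "v \<le> 6/100" and a: "a = 1/2 - v" using 3 by (auto simp: v_def)
    let ?y = "sin (pi * v)" and ?Y = "3141593/1000000 * v"
    have "?y \<le> pi * v" using v by (intro sin_x_le_x) auto
    also have "\<dots> \<le> ?Y" using pi_bounds v by (intro mult_right_mono) auto
    finally have y: "?y \<le> ?Y" .
    have "phi (- ?Y) \<le> phi (- ?y)"
    proof -
      have "0 \<le> (?Y - ?y) * (2/5 - 3/5 * (?Y + ?y))" using y v by (intro mult_nonneg_nonneg) auto
      moreover have *: "(b * - y + c * (- y)\<^sup>2) - (b * - Y + c * (- Y)\<^sup>2) = (Y - y) * (b - c * (Y + y))" for b c y Y :: real
        by (simp add: power2_eq_square algebra_simps)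
      ultimately have "0 \<le> (2/5 * - ?y + 3/5 * (- ?y)\<^sup>2) - (2/5 * - ?Y + 3/5 * (- ?Y)\<^sup>2)"
        unfolding *[of "2/5" ?y "3/5" ?Y] by blast
      then show ?thesis unfolding phi_def by linarith
    qed
    moreover have "coll (1/2 - v) \<le> 117/500 + 383/500 * phi (- ?Y)"
    proof -
      have "coll (1/2 - v) = 23375/100000 - 9675/10000 * v + 1065/1000 * v\<^sup>2 - 13/100 * v^3"
        by (simp add: coll_def power2_eq_square power3_eq_cube field_simps)
      moreover have "phi (- ?Y) = 3/5 * (3141593/1000000)\<^sup>2 * v\<^sup>2 - 2/5 * ?Y"
        unfolding phi_def power2_minus power_mult_distrib by argo
      moreover have "9 * v\<^sup>2 \<le> (3141593/1000000)\<^sup>2 * v\<^sup>2" by (intro mult_right_mono) (auto simp: power2_eq_square)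
      moreover have "0 \<le> v\<^sup>2" "0 \<le> v^3" using v by auto
      ultimately show ?thesis using v by argo
    qed
    moreover have "sin (pi * (a - 1/2)) = - ?y"
      unfolding a using sin_minus[of "pi * v"] by (simp add: algebra_simps)
    ultimately show ?thesis unfolding cos_eq_sin a by simp
  next
    case 4
    have "coll a \<le> coll (44/100)" using 4 assms by (intro coll_mono) auto
    moreover have "- 1/15 \<le> phi (cos (pi * (1 - a)))" by (rule phi_ge)
    moreover have "coll (44/100) \<le> 117/500 - 383/500 / 15" by (simp add: coll_def power2_eq_square power3_eq_cube)
    ultimately show ?thesis by argo
  qed
qed

section \<open>Random hyperplanes in a fixed dimension\<close>

text \<open>Cauchy's functional equation on an interval: nonnegativity gives monotonicity, which
  squeezes \<open>f t\<close> between neighbouring multiples of \<open>f (c / m)\<close>, with an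
  error of at most \<open>f c / m\<close>.\<close>

lemma additive_linear:
  fixes f :: "real \<Rightarrow> real"
  assumes add: "\<And>a b. 0 \<le> a \<Longrightarrow> 0 \<le> b \<Longrightarrow> a + b \<le> c \<Longrightarrow> f (a + b) = f a + f b"
    and nonneg: "\<And>a. 0 \<le> a \<Longrightarrow> a \<le> c \<Longrightarrow> 0 \<le> f a"
    and c: "0 < c" and t: "0 \<le> t" "t \<le> c"
  shows "f t = t / c * f c"
proof -
  have mono: "f a \<le> f b" if "0 \<le> a" "a \<le> b" "b \<le> c" for a b
    using add[of a "b - a"] nonneg[of "b - a"] that by simp
  have mult: "f (real j * a) = real j * f a" if "0 \<le> a" "real j * a \<le> c" for j a
    using that(2)
  proof (induction j)
    case 0
    then show ?case using add[of 0 0] c by simp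
  next
    case (Suc j)
    then have "real j * a + a \<le> c" by (simp add: algebra_simps)
    then show ?case using Suc that(1) add[of "real j * a" a] by (simp add: algebra_simps)
  qed
  have near: "\<bar>f t - t / c * f c\<bar> \<le> f c / m" if m: "0 < m" for m :: nat
  proof -
    define a where "a = c / m"
    have a: "0 < a" "m * a = c" using c m by (auto simp: a_def)
    have fa: "f c = m * f a" using mult[of a m] a by simp
    define j where "j = nat \<lfloor>t / a\<rfloor>"
    have "real j = of_int \<lfloor>t / a\<rfloor>" using t a by (simp add: j_def)
    then have "j \<le> t / a" "t / a < j + 1"
      using real_of_int_floor_add_one_gt[of "t / a"] of_int_floor_le[of "t / a"] by linarith+
    then have j: "j * a \<le> t" "t < (j + 1) * a"
      using a by (simp_all only: pos_le_divide_eq pos_divide_less_eq)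
    have 1: "j * f a \<le> f t" using mult[of a j] mono[of "j * a" t] j a t by simp
    have 2: "f t \<le> (j + 1) * f a"
    proof (cases "(j + 1) * a \<le> c")
      case True
      then show ?thesis using mult[of a "j + 1"] mono[of t "(j + 1) * a"] j a t by simp
    next
      case False
      then have "real m * a < real (j + 1) * a" using a by simp
      then have "m < j + 1" by (simp only: mult_less_cancel_right_pos[OF a(1)] of_nat_less_iff)
      then have "m \<le> j" by simp
      then have "f c \<le> (j + 1) * f a" unfolding fa using nonneg[of a] a t c m
        by (intro mult_right_mono) (auto simp: a_def field_simps)
      then show ?thesis using mono[of t c] t by simp
    qed
    have "t / c * f c = (t / a) * f a" unfolding fa using a m by (simp add: a_def)
    moreover have fa0: "0 \<le> f a" using nonneg[of a] a m c by (simp add: a_def field_simps)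
    then have "j * f a \<le> (t / a) * f a" "(t / a) * f a \<le> (j + 1) * f a"
      using j a by (intro mult_right_mono; simp add: field_simps)+
    ultimately have "\<bar>f t - t / c * f c\<bar> \<le> f a" using 1 2 by (simp add: abs_le_iff algebra_simps)
    also have "f a = f c / m" using fa m by simp
    finally show ?thesis .
  qed
  have "(\<lambda>m. f c / real m) \<longlonglongrightarrow> 0"
    by (rule lim_const_over_n)
  then have "\<bar>f t - t / c * f c\<bar> \<le> 0"
    by (rule LIMSEQ_le_const) (use near in \<open>auto intro!: exI[of _ 1]\<close>)
  then show ?thesis by simp
qed

text \<open>Normals are drawn from the unit ball rather than the sphere, so that Lebesgue measure
  applies; the signs depend only on their direction.\<close>

definition sep :: "(real^'k) \<Rightarrow> (real^'k) \<Rightarrow> (real^'k) set" where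
  "sep u v = {g \<in> cball 0 1. (0 < g \<bullet> u) \<noteq> (0 < g \<bullet> v)}"

lemma ball_halfspace_measurable: "{g \<in> cball 0 1. 0 < g \<bullet> u} \<in> lmeasurable"
proof -
  have "{g \<in> cball 0 1. 0 < g \<bullet> u} = cball 0 1 \<inter> {g. 0 < u \<bullet> g}" by (auto simp: inner_commute)
  moreover have "{g. 0 < u \<bullet> g} \<in> sets lebesgue" by (simp add: open_halfspace_gt borel_open)
  ultimately show ?thesis by (simp add: bounded_Int bounded_set_imp_lmeasurable sets.Int borel_closed)
qed

lemma sep_measurable: "sep u v \<in> lmeasurable"
proof -
  have "sep u v = ({g \<in> cball 0 1. 0 < g \<bullet> u} - {g \<in> cball 0 1. 0 < g \<bullet> v}) \<union>
      ({g \<in> cball 0 1. 0 < g \<bullet> v} - {g \<in> cball 0 1. 0 < g \<bullet> u})"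
    by (auto simp: sep_def)
  then show ?thesis by (simp only:) (intro fmeasurable.Un fmeasurable.Diff ball_halfspace_measurable)
qed

definition mball :: "'k::finite itself \<Rightarrow> real" where
  "mball _ = measure lebesgue (cball 0 1 :: (real^'k) set)"

lemma measure_sep_opposite:
  fixes u :: "real^'k"
  assumes "u \<noteq> 0"
  shows "measure lebesgue (sep u (- u)) = mball TYPE('k)"
  unfolding mball_def
proof (rule measure_negligible_symdiff)
  have "cball 0 1 - sep u (- u) \<union> (sep u (- u) - cball 0 1) \<subseteq> {x. u \<bullet> x = 0}"
    by (auto simp: sep_def inner_commute)
  then show "negligible (cball 0 1 - sep u (- u) \<union> (sep u (- u) - cball 0 1))"
    using negligible_hyperplane[of u 0] assms negligible_subset by blast
qed simp

definition circ :: "real^'k \<Rightarrow> real^'k \<Rightarrow> real \<Rightarrow> real^'k" where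
  "circ f1 f2 t = cos t *\<^sub>R f1 + sin t *\<^sub>R f2"

text \<open>The rotation by \<open>t\<close> in the plane of \<open>f1\<close> and
  \<open>f2\<close>, written so that it visibly fixes the orthogonal complement.\<close>

definition rot :: "real^'k \<Rightarrow> real^'k \<Rightarrow> real \<Rightarrow> real^'k \<Rightarrow> real^'k" where
  "rot f1 f2 t x = x + ((cos t - 1) * (x \<bullet> f1) - sin t * (x \<bullet> f2)) *\<^sub>R f1
     + ((cos t - 1) * (x \<bullet> f2) + sin t * (x \<bullet> f1)) *\<^sub>R f2"

context
  fixes f1 f2 :: "real^'k::{finite,wellorder}"
  assumes f: "f1 \<bullet> f1 = 1" "f2 \<bullet> f2 = 1" "f1 \<bullet> f2 = 0"
begin

lemma f21: "f2 \<bullet> f1 = 0"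
  using f by (simp add: inner_commute)

lemma rot_orthogonal: "orthogonal_transformation (rot f1 f2 t)"
  unfolding orthogonal_transformation_def
proof (intro conjI allI)
  show "linear (rot f1 f2 t)"
    by (rule linearI) (simp_all add: rot_def algebra_simps)
  fix x y
  let ?a = "x \<bullet> f1" and ?b = "x \<bullet> f2" and ?c = "y \<bullet> f1" and ?d = "y \<bullet> f2"
  let ?p = "(cos t - 1) * ?a - sin t * ?b" and ?q = "(cos t - 1) * ?b + sin t * ?a"
  let ?r = "(cos t - 1) * ?c - sin t * ?d" and ?s = "(cos t - 1) * ?d + sin t * ?c"
  have "rot f1 f2 t x \<bullet> rot f1 f2 t y = x \<bullet> y + ?r * ?a + ?s * ?b + ?p * ?c + ?q * ?d + ?p * ?r + ?q * ?s"
    unfolding rot_def using f f21 by (simp add: inner_add_left inner_add_right inner_commute[of _ y])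
      (simp add: algebra_simps inner_commute)
  also have "?r * ?a + ?s * ?b + ?p * ?c + ?q * ?d + ?p * ?r + ?q * ?s =
      (?a * ?c + ?b * ?d) * ((cos t)\<^sup>2 + (sin t)\<^sup>2 - 1)"
  proof -
    have "((C - 1) * c - S * d) * a + ((C - 1) * d + S * c) * b + ((C - 1) * a - S * b) * c + ((C - 1) * b + S * a) * d +
        ((C - 1) * a - S * b) * ((C - 1) * c - S * d) + ((C - 1) * b + S * a) * ((C - 1) * d + S * c) =
        (a * c + b * d) * (C\<^sup>2 + S\<^sup>2 - 1)" for a b c d C S :: real
      by (simp add: power2_eq_square algebra_simps)
    then show ?thesis .
  qed
  then have "x \<bullet> y + ?r * ?a + ?s * ?b + ?p * ?c + ?q * ?d + ?p * ?r + ?q * ?s = x \<bullet> y" by simp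
  finally show "rot f1 f2 t x \<bullet> rot f1 f2 t y = x \<bullet> y" .
qed

lemma rot_circ: "rot f1 f2 t (circ f1 f2 s) = circ f1 f2 (s + t)"
  unfolding rot_def circ_def cos_add sin_add using f f21
  by (simp add: inner_add_left algebra_simps)

lemma rot_sep: "rot f1 f2 t ` sep (circ f1 f2 a) (circ f1 f2 b) = sep (circ f1 f2 (a + t)) (circ f1 f2 (b + t))"
proof -
  have inner: "rot f1 f2 t g \<bullet> circ f1 f2 (s + t) = g \<bullet> circ f1 f2 s" for g s
    using rot_orthogonal[of t] rot_circ[of t s] unfolding orthogonal_transformation_def by metis
  have norm: "norm (rot f1 f2 t g) = norm g" for g
    using rot_orthogonal by (rule orthogonal_transformation_norm)
  have surj: "\<exists>x. rot f1 f2 t x = y" for y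
    using orthogonal_transformation_surj[OF rot_orthogonal, of t] by (metis surjD)
  show ?thesis
  proof (intro set_eqI iffI)
    fix y assume "y \<in> sep (circ f1 f2 (a + t)) (circ f1 f2 (b + t))"
    moreover obtain x where "y = rot f1 f2 t x" using surj by metis
    ultimately show "y \<in> rot f1 f2 t ` sep (circ f1 f2 a) (circ f1 f2 b)"
      by (auto simp: sep_def inner norm)
  qed (auto simp: sep_def inner norm)
qed

text \<open>For \<open>0 < a < b < pi\<close> all three sines are positive, so the middle vector
  lies in the cone of the outer two, and a normal with equal signs on these has the same sign on the
  middle one.\<close>

lemma circ_convex:
  "sin b *\<^sub>R circ f1 f2 a = sin (b - a) *\<^sub>R circ f1 f2 0 + sin a *\<^sub>R circ f1 f2 b"
  by (simp add: circ_def algebra_simps sin_diff scaleR_add_right[symmetric] scaleR_add_left[symmetric])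

lemma sep_circ_Un:
  assumes "0 < a" "a < b" "b \<le> pi"
  shows "sep (circ f1 f2 0) (circ f1 f2 b) \<subseteq> sep (circ f1 f2 0) (circ f1 f2 a) \<union> sep (circ f1 f2 a) (circ f1 f2 b)"
    "b < pi \<Longrightarrow> sep (circ f1 f2 0) (circ f1 f2 a) \<union> sep (circ f1 f2 a) (circ f1 f2 b) \<subseteq> sep (circ f1 f2 0) (circ f1 f2 b)"
    "b < pi \<Longrightarrow> sep (circ f1 f2 0) (circ f1 f2 a) \<inter> sep (circ f1 f2 a) (circ f1 f2 b) = {}"
proof -
  show "sep (circ f1 f2 0) (circ f1 f2 b) \<subseteq> sep (circ f1 f2 0) (circ f1 f2 a) \<union> sep (circ f1 f2 a) (circ f1 f2 b)"
    by (auto simp: sep_def)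
  assume b: "b < pi"
  have s: "0 < sin b" "0 < sin (b - a)" "0 < sin a" using assms b by (auto intro!: sin_gt_zero)
  have eq: "sin b * (g \<bullet> circ f1 f2 a) = sin (b - a) * (g \<bullet> circ f1 f2 0) + sin a * (g \<bullet> circ f1 f2 b)" for g
    using arg_cong[OF circ_convex, of "\<lambda>x. g \<bullet> x" b a] by (simp add: inner_add_right)
  have "0 < g \<bullet> circ f1 f2 a" if "0 < g \<bullet> circ f1 f2 0" "0 < g \<bullet> circ f1 f2 b" for g
  proof -
    have "0 < sin b * (g \<bullet> circ f1 f2 a)" unfolding eq using s that by (intro add_pos_pos mult_pos_pos)
    then show ?thesis using s by (simp add: zero_less_mult_iff)
  qed
  moreover have "\<not> 0 < g \<bullet> circ f1 f2 a" if "\<not> 0 < g \<bullet> circ f1 f2 0" "\<not> 0 < g \<bullet> circ f1 f2 b" for g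
  proof -
    have "sin (b - a) * (g \<bullet> circ f1 f2 0) \<le> 0" "sin a * (g \<bullet> circ f1 f2 b) \<le> 0"
      using s that by (auto simp: mult_le_0_iff)
    then have "sin b * (g \<bullet> circ f1 f2 a) \<le> 0" using eq[of g] by simp
    then show ?thesis using s by (auto simp: mult_le_0_iff)
  qed
  ultimately show "sep (circ f1 f2 0) (circ f1 f2 a) \<union> sep (circ f1 f2 a) (circ f1 f2 b) \<subseteq> sep (circ f1 f2 0) (circ f1 f2 b)"
    "sep (circ f1 f2 0) (circ f1 f2 a) \<inter> sep (circ f1 f2 a) (circ f1 f2 b) = {}"
    by (auto simp: sep_def)
qed

lemma circ_nonzero: "circ f1 f2 t \<noteq> 0"
proof
  assume "circ f1 f2 t = 0"
  then have "circ f1 f2 t \<bullet> f1 = 0" "circ f1 f2 t \<bullet> f2 = 0" by simp_all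
  then have "cos t = 0" "sin t = 0" using f f21 by (simp_all add: circ_def inner_add_left)
  then show False using sin_cos_squared_add[of t] by simp
qed

lemma circ_pi: "circ f1 f2 pi = - circ f1 f2 0"
  by (simp add: circ_def)

text \<open>The rotation by \<open>a\<close> carries the second set into place. For
  \<open>a + b = pi\<close> the end vectors are opposite and the two sets may overlap, but only
  within the hyperplane orthogonal to them.\<close>

lemma measure_sep_circ_add:
  assumes "0 \<le> a" "0 \<le> b" "a + b \<le> pi"
  shows "measure lebesgue (sep (circ f1 f2 0) (circ f1 f2 (a + b))) =
    measure lebesgue (sep (circ f1 f2 0) (circ f1 f2 a)) + measure lebesgue (sep (circ f1 f2 0) (circ f1 f2 b))"
proof (cases "a = 0 \<or> b = 0")
  case True
  have "sep (circ f1 f2 0) (circ f1 f2 0) = {}" by (simp add: sep_def)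
  then show ?thesis using True by auto
next
  case False
  then have ab: "0 < a" "a < a + b" using assms by auto
  have shift: "measure lebesgue (sep (circ f1 f2 a) (circ f1 f2 (a + b))) = measure lebesgue (sep (circ f1 f2 0) (circ f1 f2 b))"
    using measure_orthogonal_image[OF rot_orthogonal[of a] sep_measurable[of "circ f1 f2 0" "circ f1 f2 b"]]
    by (simp add: rot_sep add.commute)
  show ?thesis
  proof (cases "a + b = pi")
    case False
    then have "a + b < pi" using assms by simp
    note Un = sep_circ_Un[OF ab assms(3)]
    have "sep (circ f1 f2 0) (circ f1 f2 (a + b)) = sep (circ f1 f2 0) (circ f1 f2 a) \<union> sep (circ f1 f2 a) (circ f1 f2 (a + b))"
      using Un(1) Un(2)[OF \<open>a + b < pi\<close>] by blast
    also have "measure lebesgue \<dots> = measure lebesgue (sep (circ f1 f2 0) (circ f1 f2 a)) + measure lebesgue (sep (circ f1 f2 a) (circ f1 f2 (a + b)))"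
      using Un(3)[OF \<open>a + b < pi\<close>]
      by (subst measure_Un2) (auto simp: sep_measurable Diff_triv Int_commute)
    finally show ?thesis unfolding shift .
  next
    case True
    let ?H = "{x. circ f1 f2 0 \<bullet> x = 0}"
    have neg: "negligible ?H" using negligible_hyperplane[of "circ f1 f2 0" 0] circ_nonzero by auto
    have "sep (circ f1 f2 0) (circ f1 f2 a) \<inter> sep (circ f1 f2 a) (circ f1 f2 pi) \<subseteq> ?H"
      by (auto simp: sep_def circ_pi inner_commute)
    then have 0: "negligible (sep (circ f1 f2 0) (circ f1 f2 a) \<inter> sep (circ f1 f2 a) (circ f1 f2 pi))"
      using neg negligible_subset by blast
    have "measure lebesgue (sep (circ f1 f2 0) (circ f1 f2 pi)) = measure lebesgue (sep (circ f1 f2 0) (circ f1 f2 a) \<union> sep (circ f1 f2 a) (circ f1 f2 pi))"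
    proof (rule measure_negligible_symdiff)
      show "sep (circ f1 f2 0) (circ f1 f2 a) \<union> sep (circ f1 f2 a) (circ f1 f2 pi) \<in> lmeasurable"
        by (simp add: fmeasurable.Un sep_measurable)
      have "sep (circ f1 f2 0) (circ f1 f2 a) \<union> sep (circ f1 f2 a) (circ f1 f2 pi) - sep (circ f1 f2 0) (circ f1 f2 pi) \<union>
          (sep (circ f1 f2 0) (circ f1 f2 pi) - (sep (circ f1 f2 0) (circ f1 f2 a) \<union> sep (circ f1 f2 a) (circ f1 f2 pi))) \<subseteq> ?H"
        by (auto simp: sep_def circ_pi inner_commute)
      then show "negligible (sep (circ f1 f2 0) (circ f1 f2 a) \<union> sep (circ f1 f2 a) (circ f1 f2 pi) - sep (circ f1 f2 0) (circ f1 f2 pi) \<union>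
          (sep (circ f1 f2 0) (circ f1 f2 pi) - (sep (circ f1 f2 0) (circ f1 f2 a) \<union> sep (circ f1 f2 a) (circ f1 f2 pi))))"
        using neg negligible_subset by blast
    qed
    also have "\<dots> = measure lebesgue (sep (circ f1 f2 0) (circ f1 f2 a)) + measure lebesgue (sep (circ f1 f2 a) (circ f1 f2 pi))"
    proof -
      have "measure lebesgue (sep (circ f1 f2 a) (circ f1 f2 pi) - sep (circ f1 f2 0) (circ f1 f2 a)) = measure lebesgue (sep (circ f1 f2 a) (circ f1 f2 pi))"
        by (rule measure_negligible_symdiff[OF sep_measurable])
          (rule negligible_subset[OF 0], auto)
      then show ?thesis by (subst measure_Un2) (auto simp: sep_measurable)
    qed
    finally show ?thesis using True shift by simp
  qed
qed

lemma measure_sep_circ: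
  assumes "0 \<le> t" "t \<le> pi"
  shows "measure lebesgue (sep (circ f1 f2 0) (circ f1 f2 t)) = t / pi * mball TYPE('k)"
proof -
  have "measure lebesgue (sep (circ f1 f2 0) (circ f1 f2 t)) = t / pi * measure lebesgue (sep (circ f1 f2 0) (circ f1 f2 pi))"
    using assms by (intro additive_linear measure_sep_circ_add) auto
  then show ?thesis
    using measure_sep_opposite[OF circ_nonzero[of 0]] by (simp add: circ_pi)
qed

end

text \<open>The probability of separation is additive in the angle by rotation invariance, hence
  linear, and it is 1 at angle \<open>pi\<close>. Parallel vectors span no plane to rotate in and
  are treated directly.\<close>

lemma measure_sep_unit:
  fixes u v :: "real^'k::{finite,wellorder}"
  assumes "norm u = 1" "norm v = 1"
  shows "measure lebesgue (sep u v) = arccos (u \<bullet> v) / pi * mball TYPE('k)"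
proof -
  let ?c = "u \<bullet> v"
  have uu: "u \<bullet> u = 1" "v \<bullet> v = 1" using assms by (simp_all add: norm_eq_1)
  have c: "\<bar>?c\<bar> \<le> 1" using Cauchy_Schwarz_ineq2[of u v] assms by simp
  have eq: "(v - ?c *\<^sub>R u) \<bullet> (v - ?c *\<^sub>R u) = 1 - ?c\<^sup>2"
    using uu by (simp add: inner_diff_left inner_diff_right inner_commute power2_eq_square)
  show ?thesis
  proof (cases "\<bar>?c\<bar> = 1")
    case True
    then have "v = ?c *\<^sub>R u" using eq by (metis diff_self inner_eq_zero_iff power2_abs power_one right_minus_eq)
    then consider "?c = 1" "v = u" | "?c = - 1" "v = - u" using True by (auto simp: abs_if split: if_splits)
    then show ?thesis
    proof cases
      case 1
      then show ?thesis by (simp add: sep_def)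
    next
      case 2
      moreover have "u \<noteq> 0" using assms by auto
      ultimately show ?thesis using measure_sep_opposite[of u] by simp
    qed
  next
    case False
    then have c1: "?c\<^sup>2 < 1" using c by (simp add: abs_square_less_1)
    let ?t = "arccos ?c"
    have t: "0 \<le> ?t" "?t \<le> pi" "cos ?t = ?c" using c by (auto simp: arccos_lbound arccos_ubound abs_le_iff)
    have s: "sin ?t = sqrt (1 - ?c\<^sup>2)" using c by (simp add: sin_arccos abs_le_iff)
    define f2 where "f2 = (1 / sqrt (1 - ?c\<^sup>2)) *\<^sub>R (v - ?c *\<^sub>R u)"
    have f: "f2 \<bullet> f2 = 1" "u \<bullet> f2 = 0"
    proof -
      have "f2 \<bullet> f2 = (1 / sqrt (1 - ?c\<^sup>2)) * ((1 / sqrt (1 - ?c\<^sup>2)) * (1 - ?c\<^sup>2))"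
        unfolding f2_def inner_scaleR_left inner_scaleR_right eq ..
      also have "\<dots> = 1" using c1 by (simp add: real_div_sqrt)
      finally show "f2 \<bullet> f2 = 1" .
      show "u \<bullet> f2 = 0" using uu by (simp add: f2_def inner_diff_right)
    qed
    have "circ u f2 0 = u" "circ u f2 ?t = v"
      using c1 by (auto simp: circ_def t s f2_def)
    then show ?thesis using measure_sep_circ[OF uu(1) f t(1,2)] by simp
  qed
qed


section \<open>Discretisation of the normals\<close>

definition slab :: "real \<Rightarrow> real^'k \<Rightarrow> (real^'k) set" where
  "slab d u = {g \<in> cball 0 1. \<bar>g \<bullet> u\<bar> \<le> d}"

lemma slab_measurable: "slab d u \<in> lmeasurable"
proof -
  have "slab d u = cball 0 1 \<inter> ({g. g \<bullet> u \<le> d} \<inter> {g. - d \<le> g \<bullet> u})"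
    by (auto simp: slab_def abs_le_iff)
  moreover have "closed ({g. g \<bullet> u \<le> d} \<inter> {g. - d \<le> g \<bullet> u})"
    by (intro closed_Int closed_Collect_le continuous_intros)
  ultimately show ?thesis
    by (simp add: bounded_Int bounded_set_imp_lmeasurable sets.Int borel_closed)
qed

text \<open>Rotating \<open>u\<close> onto a coordinate axis puts the slab into a box with one side
  \<open>2 * d\<close> and all others of length 2.\<close>

lemma slab_small:
  fixes d :: real and u :: "real^'k::{finite,wellorder}"
  assumes u: "norm u = 1" and d: "0 \<le> d"
  shows "measure lebesgue (slab d u) \<le> d * 2 ^ CARD('k)"
proof -
  obtain i0 :: 'k where True by simp
  let ?e = "axis i0 1 :: (real, 'k) vec"
  obtain f where f: "orthogonal_transformation f" "f ?e = u"
    using orthogonal_transformation_exists_1[of ?e u] u by (auto simp: norm_axis_1)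
  have inner: "f g \<bullet> u = g \<bullet> ?e" for g using f unfolding orthogonal_transformation_def by metis
  have norm: "norm (f g) = norm g" for g using f(1) by (rule orthogonal_transformation_norm)
  have surj: "\<exists>x. f x = y" for y using orthogonal_transformation_surj[OF f(1)] by (metis surjD)
  have "slab d u = f ` slab d ?e"
  proof (intro set_eqI iffI)
    fix y assume "y \<in> slab d u"
    moreover obtain x where "y = f x" using surj by metis
    ultimately show "y \<in> f ` slab d ?e" by (auto simp: slab_def inner norm)
  qed (auto simp: slab_def inner norm)
  then have "measure lebesgue (slab d u) = measure lebesgue (slab d ?e)"
    using measure_orthogonal_image[OF f(1) slab_measurable] by simp
  also have "\<dots> \<le> measure lebesgue (cbox (\<chi> i. - (if i = i0 then d else 1)) (\<chi> i. if i = i0 then d else 1) :: ((real, 'k) vec) set)"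
  proof (rule measure_mono_fmeasurable)
    show "slab d ?e \<subseteq> cbox (\<chi> i. - (if i = i0 then d else 1)) (\<chi> i. if i = i0 then d else 1)"
    proof
      fix g assume "g \<in> slab d ?e"
      then have g: "norm g \<le> 1" "\<bar>g $ i0\<bar> \<le> d" by (auto simp: slab_def inner_axis)
      have "\<bar>g $ i\<bar> \<le> 1" for i using component_le_norm_cart[of g i] g by linarith
      then show "g \<in> cbox (\<chi> i. - (if i = i0 then d else 1)) (\<chi> i. if i = i0 then d else 1)"
        using g by (auto simp: mem_box_cart abs_le_iff minus_le_iff)
    qed
  qed (auto simp: slab_measurable fmeasurableD)
  also have "\<dots> = (\<Prod>i\<in>UNIV. (if i = i0 then d else 1) * 2)"
  proof -
    have "cbox (\<chi> i. - (if i = i0 then d else 1)) (\<chi> i. if i = i0 then d else 1) \<noteq> ({} :: ((real, 'k) vec) set)"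
      using d by (auto simp: interval_ne_empty_cart)
    then show ?thesis by (subst measure_completion) (simp_all add: content_cbox_cart mult.commute)
  qed
  also have "\<dots> = d * 2 ^ CARD('k)" by (simp add: prod.distrib)
  finally show ?thesis .
qed

definition rnd :: "nat \<Rightarrow> real^'k \<Rightarrow> 'k \<Rightarrow> int" where
  "rnd N g i = \<lfloor>N * g $ i\<rfloor>"

definition ipos :: "('k \<Rightarrow> int) \<Rightarrow> real^'k \<Rightarrow> bool" where
  "ipos \<gamma> u \<longleftrightarrow> 0 < (\<Sum>i\<in>UNIV. of_int (\<gamma> i) * u $ i)"

text \<open>Taking floors moves each coordinate by at most 1 and thus the scaled inner product by at
  most the dimension. Outside the slab the inner product is larger than that, so its sign
  survives.\<close>

lemma ipos_rnd:
  fixes u :: "real^'k" and d :: real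
  assumes g: "g \<in> cball 0 1" "g \<notin> slab d u" and u: "norm u = 1" and N: "CARD('k) < N * d" "0 < d"
  shows "ipos (rnd N g) u \<longleftrightarrow> 0 < g \<bullet> u"
proof -
  define r :: "real^'k" where "r = (\<chi> i. of_int (rnd N g i))"
  have "\<bar>r \<bullet> u - N * (g \<bullet> u)\<bar> = \<bar>(r - real N *\<^sub>R g) \<bullet> u\<bar>"
    by (simp add: inner_diff_left)
  also have "\<dots> \<le> norm (r - real N *\<^sub>R g)" using Cauchy_Schwarz_ineq2[of "r - real N *\<^sub>R g" u] u by simp
  also have "\<dots> \<le> (\<Sum>i\<in>UNIV. \<bar>(r - real N *\<^sub>R g) $ i\<bar>)" by (rule norm_le_l1_cart)
  also have "\<dots> \<le> (\<Sum>i\<in>(UNIV :: 'k set). 1)"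
  proof (rule sum_mono)
    fix i
    have "(r - real N *\<^sub>R g) $ i = of_int \<lfloor>N * g $ i\<rfloor> - N * g $ i" by (simp add: r_def rnd_def)
    then show "\<bar>(r - real N *\<^sub>R g) $ i\<bar> \<le> 1" by linarith
  qed
  finally have 1: "\<bar>r \<bullet> u - N * (g \<bullet> u)\<bar> \<le> CARD('k)" by simp
  have "d < \<bar>g \<bullet> u\<bar>" using g by (simp add: slab_def)
  then have "N * d \<le> N * \<bar>g \<bullet> u\<bar>" by (intro mult_left_mono) auto
  then have 2: "CARD('k) < \<bar>N * (g \<bullet> u)\<bar>" using N by (simp add: abs_mult)
  have "0 < real N" using N by (cases N) auto
  then have "0 < r \<bullet> u \<longleftrightarrow> 0 < g \<bullet> u"
    using 1 2 zero_less_mult_iff[of "real N" "g \<bullet> u"] by (auto simp: abs_if split: if_splits)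
  moreover have "r \<bullet> u = (\<Sum>i\<in>UNIV. of_int (rnd N g i) * u $ i)" by (simp add: inner_vec_def r_def)
  ultimately show ?thesis by (simp add: ipos_def)
qed

lemma cell_measurable: "{g \<in> cball 0 1. rnd N g = \<gamma>} \<in> lmeasurable"
proof -
  have "{g \<in> cball 0 1. rnd N g = \<gamma>} = cball 0 1 \<inter> (\<Inter>i\<in>UNIV. {g. of_int (\<gamma> i) \<le> N * g $ i} \<inter> {g. N * g $ i < of_int (\<gamma> i) + 1})"
    by (auto simp: rnd_def fun_eq_iff floor_eq_iff)
  also have "\<dots> \<in> sets borel"
    by (intro sets.Int sets.finite_INT borel_closed borel_open closed_Collect_le open_Collect_less continuous_intros)
      auto
  finally have "{g \<in> cball 0 1. rnd N g = \<gamma>} \<in> sets lebesgue" by simp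
  then show ?thesis by (intro bounded_set_imp_lmeasurable) (auto intro!: bounded_subset[OF bounded_cball[of 0 1]])
qed

lemma hyperplane_family_cart:
  fixes \<epsilon> :: real
  assumes eps: "0 < \<epsilon>"
  shows "\<exists>(\<Gamma> :: ('k::{finite,wellorder} \<Rightarrow> int) set) m. finite \<Gamma> \<and> (\<forall>\<gamma>\<in>\<Gamma>. 0 \<le> m \<gamma>) \<and> sum m \<Gamma> = 1 \<and>
    (\<forall>u v. norm u = 1 \<longrightarrow> norm v = 1 \<longrightarrow>
      \<bar>(\<Sum>\<gamma>\<in>\<Gamma>. m \<gamma> * of_bool (ipos \<gamma> u \<noteq> ipos \<gamma> v)) - arccos (u \<bullet> v) / pi\<bar> \<le> \<epsilon>)"
proof -
  let ?B = "cball 0 1 :: ((real, 'k) vec) set"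
  let ?V = "mball TYPE('k)"
  have V: "0 < ?V" unfolding mball_def using content_cball_pos[of 1 "0 :: (real, 'k) vec"] by simp
  \<comment> \<open>Chosen so that the slabs of \<open>u\<close> and \<open>v\<close> together have
    measure at most \<open>\<epsilon> * ?V\<close>.\<close>
  define d where "d = \<epsilon> * ?V / (2 * 2 ^ CARD('k))"
  have d: "0 < d" using eps V by (simp add: d_def)
  obtain N :: nat where N: "CARD('k) < N * d" using reals_Archimedean3[OF d] by blast
  define cell where "cell \<gamma> = {g \<in> ?B. rnd N g = \<gamma>}" for \<gamma>
  define \<Gamma> where "\<Gamma> = rnd N ` ?B"
  \<comment> \<open>The weight of an integral normal is the share of the ball that is rounded to
    it.\<close>
  define m where "m \<gamma> = measure lebesgue (cell \<gamma>) / ?V" for \<gamma>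
  have fin: "finite \<Gamma>"
  proof (rule finite_subset)
    show "\<Gamma> \<subseteq> PiE UNIV (\<lambda>_. {- int N..int N})"
    proof
      fix \<gamma> assume "\<gamma> \<in> \<Gamma>"
      then obtain g where g: "g \<in> ?B" "\<gamma> = rnd N g" by (auto simp: \<Gamma>_def)
      have "\<gamma> i \<in> {- int N..int N}" for i
      proof -
        have "\<bar>g $ i\<bar> \<le> 1" using component_le_norm_cart[of g i] g by simp
        then have "\<bar>N * g $ i\<bar> \<le> real N * 1" unfolding abs_mult by (intro mult_mono) auto
        then show ?thesis unfolding g(2) rnd_def by (auto simp: le_floor_iff floor_le_iff)
      qed
      then show "\<gamma> \<in> PiE UNIV (\<lambda>_. {- int N..int N})" by auto
    qed
  qed (simp add: finite_PiE)
  have cellm: "cell \<gamma> \<in> lmeasurable" for \<gamma> unfolding cell_def by (rule cell_measurable)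
  have union: "(\<Sum>\<gamma>\<in>A. measure lebesgue (cell \<gamma>)) = measure lebesgue (\<Union>\<gamma>\<in>A. cell \<gamma>)" if "A \<subseteq> \<Gamma>" for A
    using that fin cellm by (intro measure_UNION'[symmetric])
      (auto simp: pairwise_def disjnt_def cell_def intro: finite_subset)
  have "sum m \<Gamma> = measure lebesgue (\<Union>\<gamma>\<in>\<Gamma>. cell \<gamma>) / ?V"
    unfolding m_def sum_divide_distrib[symmetric] by (simp add: union)
  also have "(\<Union>\<gamma>\<in>\<Gamma>. cell \<gamma>) = ?B" by (auto simp: \<Gamma>_def cell_def)
  finally have total: "sum m \<Gamma> = 1" using V by (simp add: mball_def)
  have approx: "\<bar>(\<Sum>\<gamma>\<in>\<Gamma>. m \<gamma> * of_bool (ipos \<gamma> u \<noteq> ipos \<gamma> v)) - arccos (u \<bullet> v) / pi\<bar> \<le> \<epsilon>"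
    if u: "norm u = 1" and v: "norm v = 1" for u v :: "(real, 'k) vec"
  proof -
    let ?A = "{\<gamma> \<in> \<Gamma>. ipos \<gamma> u \<noteq> ipos \<gamma> v}"
    let ?U = "\<Union>\<gamma>\<in>?A. cell \<gamma>"
    have Um: "?U \<in> lmeasurable" using fin cellm by (intro fmeasurable.finite_UN) auto
    have "(\<Sum>\<gamma>\<in>\<Gamma>. m \<gamma> * of_bool (ipos \<gamma> u \<noteq> ipos \<gamma> v)) = (\<Sum>\<gamma>\<in>?A. m \<gamma>)"
      using fin by (simp add: sum.inter_filter of_bool_def if_distrib cong: if_cong)
    also have "\<dots> = measure lebesgue ?U / ?V"
      unfolding m_def sum_divide_distrib[symmetric] by (subst union) auto
    finally have 1: "(\<Sum>\<gamma>\<in>\<Gamma>. m \<gamma> * of_bool (ipos \<gamma> u \<noteq> ipos \<gamma> v)) = measure lebesgue ?U / ?V" .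
    have 2: "arccos (u \<bullet> v) / pi = measure lebesgue (sep u v) / ?V"
      using measure_sep_unit[OF u v] V by simp
    let ?S = "slab d u \<union> slab d v"
    have Sm: "?S \<in> lmeasurable" by (intro fmeasurable.Un slab_measurable)
    have S: "measure lebesgue ?S \<le> \<epsilon> * ?V"
    proof -
      have "measure lebesgue ?S \<le> measure lebesgue (slab d u) + measure lebesgue (slab d v)"
        by (intro measure_Un_le fmeasurableD slab_measurable)
      also have "\<dots> \<le> d * 2 ^ CARD('k) + d * 2 ^ CARD('k)"
        using u v d by (intro add_mono slab_small) auto
      also have "\<dots> = \<epsilon> * ?V" by (simp add: d_def)
      finally show ?thesis .
    qed
    have U: "?U = {g \<in> ?B. ipos (rnd N g) u \<noteq> ipos (rnd N g) v}"
      by (auto simp: \<Gamma>_def cell_def)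
    have iff: "g \<in> ?U \<longleftrightarrow> g \<in> sep u v" if "g \<notin> ?S" for g
      unfolding U sep_def using that ipos_rnd[OF _ _ u N d] ipos_rnd[OF _ _ v N d] by auto
    have "measure lebesgue ?U \<le> measure lebesgue (sep u v \<union> ?S)"
      using iff by (intro measure_mono_fmeasurable fmeasurable.Un Sm sep_measurable fmeasurableD[OF Um]) auto
    also have "\<dots> \<le> measure lebesgue (sep u v) + measure lebesgue ?S"
      by (intro measure_Un_le fmeasurableD sep_measurable Sm)
    finally have 3: "measure lebesgue ?U \<le> measure lebesgue (sep u v) + \<epsilon> * ?V" using S by simp
    have "measure lebesgue (sep u v) \<le> measure lebesgue (?U \<union> ?S)"
      using iff by (intro measure_mono_fmeasurable fmeasurable.Un Sm Um fmeasurableD[OF sep_measurable]) auto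
    also have "\<dots> \<le> measure lebesgue ?U + measure lebesgue ?S"
      by (intro measure_Un_le fmeasurableD Um Sm)
    finally have 4: "measure lebesgue (sep u v) \<le> measure lebesgue ?U + \<epsilon> * ?V" using S by simp
    have "\<bar>measure lebesgue ?U - measure lebesgue (sep u v)\<bar> \<le> \<epsilon> * ?V" using 3 4 by (simp add: abs_le_iff)
    then have "\<bar>measure lebesgue ?U - measure lebesgue (sep u v)\<bar> / ?V \<le> \<epsilon>" using V by (simp add: pos_divide_le_eq)
    then show ?thesis unfolding 1 2 using V by (simp add: diff_divide_distrib[symmetric])
  qed
  show ?thesis
    using fin total approx V by (intro exI[of _ \<Gamma>] exI[of _ m]) (auto simp: m_def)
qed

definition hpos :: "nat \<Rightarrow> (nat \<Rightarrow> int) \<Rightarrow> (nat \<Rightarrow> real) \<Rightarrow> bool" where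
  "hpos k \<gamma> u \<longleftrightarrow> 0 < (\<Sum>b<k. of_int (\<gamma> b) * u b)"

text \<open>A transfer from coordinates indexed by a type, where the measure lives, to coordinates
  indexed by the numbers below \<open>k\<close>, as the program has them.\<close>

lemma hyperplane_family:
  fixes \<epsilon> :: real
  assumes eps: "0 < \<epsilon>"
  defines "k \<equiv> CARD('k::{finite,wellorder})"
  shows "\<exists>\<Gamma> m. finite \<Gamma> \<and> (\<forall>\<gamma>\<in>\<Gamma>. 0 \<le> m \<gamma>) \<and> sum m \<Gamma> = 1 \<and>
    (\<forall>u v. (\<Sum>b<k. (u b)\<^sup>2) = 1 \<longrightarrow> (\<Sum>b<k. (v b)\<^sup>2) = 1 \<longrightarrow>
      \<bar>(\<Sum>\<gamma>\<in>\<Gamma>. m \<gamma> * of_bool (hpos k \<gamma> u \<noteq> hpos k \<gamma> v)) - arccos (\<Sum>b<k. u b * v b) / pi\<bar> \<le> \<epsilon>)"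
proof -
  obtain \<Gamma> :: "('k \<Rightarrow> int) set" and m where G: "finite \<Gamma>" "\<forall>\<gamma>\<in>\<Gamma>. 0 \<le> m \<gamma>" "sum m \<Gamma> = 1"
    "\<And>u v. norm u = 1 \<Longrightarrow> norm v = 1 \<Longrightarrow>
      \<bar>(\<Sum>\<gamma>\<in>\<Gamma>. m \<gamma> * of_bool (ipos \<gamma> u \<noteq> ipos \<gamma> v)) - arccos (u \<bullet> v) / pi\<bar> \<le> \<epsilon>"
    using hyperplane_family_cart[OF eps] by blast
  obtain h where h: "bij_betw h {..<k} (UNIV :: 'k set)"
    using ex_bij_betw_nat_finite[of "UNIV :: 'k set"] by (auto simp: k_def atLeast0LessThan)
  define h' where "h' = inv_into {..<k} h"
  have hh: "h' (h b) = b" if "b < k" for b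
    using h that by (simp add: h'_def bij_betw_inv_into_left)
  have hh': "h (h' i) = i" for i
    using h by (simp add: h'_def bij_betw_inv_into_right)
  have reindex: "(\<Sum>i\<in>UNIV. f i) = (\<Sum>b<k. f (h b))" for f :: "'k \<Rightarrow> real"
    using sum.reindex_bij_betw[OF h, of f] by simp
  define vec_of where "vec_of u = (\<chi> i. u (h' i))" for u :: "nat \<Rightarrow> real"
  have inner: "vec_of u \<bullet> vec_of v = (\<Sum>b<k. u b * v b)" for u v
    unfolding inner_vec_def reindex by (rule sum.cong) (auto simp: vec_of_def hh)
  have pos: "hpos k (\<gamma> \<circ> h) u \<longleftrightarrow> ipos \<gamma> (vec_of u)" for \<gamma> u
    unfolding hpos_def ipos_def reindex
    by (intro arg_cong[where f = "\<lambda>x. 0 < x"] sum.cong) (auto simp: vec_of_def hh)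
  have inj: "inj_on (\<lambda>\<gamma>. \<gamma> \<circ> h) \<Gamma>"
    by (rule inj_onI) (metis comp_apply ext hh')
  define m' where "m' \<gamma> = m (\<gamma> \<circ> h')" for \<gamma>
  have m': "m' (\<gamma> \<circ> h) = m \<gamma>" for \<gamma>
    unfolding m'_def by (rule arg_cong[where f = m]) (simp add: fun_eq_iff hh')
  have sums: "(\<Sum>\<gamma>\<in>(\<lambda>\<gamma>. \<gamma> \<circ> h) ` \<Gamma>. m' \<gamma> * f \<gamma>) = (\<Sum>\<gamma>\<in>\<Gamma>. m \<gamma> * f (\<gamma> \<circ> h))" for f :: "(nat \<Rightarrow> int) \<Rightarrow> real"
    by (simp add: sum.reindex[OF inj] m')
  show ?thesis
  proof (intro exI[of _ "(\<lambda>\<gamma>. \<gamma> \<circ> h) ` \<Gamma>"] exI[of _ m'] conjI allI impI)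
    show "sum m' ((\<lambda>\<gamma>. \<gamma> \<circ> h) ` \<Gamma>) = 1" using sums[of "\<lambda>_. 1"] G(3) by simp
    fix u v :: "nat \<Rightarrow> real"
    assume "(\<Sum>b<k. (u b)\<^sup>2) = 1" "(\<Sum>b<k. (v b)\<^sup>2) = 1"
    then have "norm (vec_of u) = 1" "norm (vec_of v) = 1"
      by (simp_all add: norm_eq_1 inner power2_eq_square)
    from G(4)[OF this]
    show "\<bar>(\<Sum>\<gamma>\<in>(\<lambda>\<gamma>. \<gamma> \<circ> h) ` \<Gamma>. m' \<gamma> * of_bool (hpos k \<gamma> u \<noteq> hpos k \<gamma> v)) - arccos (\<Sum>b<k. u b * v b) / pi\<bar> \<le> \<epsilon>"
      by (simp only: sums pos inner)
  qed (use G m' in auto)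
qed

section \<open>Rounding\<close>

lemma exists_ge_average:
  fixes m f :: "'a \<Rightarrow> real"
  assumes "finite A" "\<And>a. a \<in> A \<Longrightarrow> 0 \<le> m a" "sum m A = 1" "E \<le> (\<Sum>a\<in>A. m a * f a)"
  shows "\<exists>a\<in>A. E \<le> f a"
proof (rule ccontr)
  assume "\<not> ?thesis"
  then have less: "f a < E" if "a \<in> A" for a using that by auto
  have "(\<Sum>a\<in>A. m a * (E - f a)) = E - (\<Sum>a\<in>A. m a * f a)"
    using assms(3) by (simp add: right_diff_distrib sum_subtractf sum_distrib_right[symmetric])
  then have "(\<Sum>a\<in>A. m a * (E - f a)) \<le> 0" using assms(4) by simp
  moreover have nn: "0 \<le> m a * (E - f a)" if "a \<in> A" for a
    using assms(2)[OF that] less[OF that] by simp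
  ultimately have "(\<Sum>a\<in>A. m a * (E - f a)) = 0" by (simp add: sum_nonneg antisym)
  then have "\<forall>a\<in>A. m a * (E - f a) = 0" using nn assms(1) by (simp add: sum_nonneg_eq_0_iff)
  then have "\<forall>a\<in>A. m a = 0" using less by fastforce
  then show False using assms(3) by simp
qed

definition agree :: "nat \<Rightarrow> (nat \<Rightarrow> int) \<Rightarrow> (nat \<Rightarrow> nat \<Rightarrow> real) \<Rightarrow> nat \<Rightarrow> nat \<Rightarrow> real" where
  "agree k \<gamma> S i j = of_bool (hpos k \<gamma> (S i) = hpos k \<gamma> (S j))"

lemma agree_zero: "agree k (\<lambda>_. 0) S i j = 1"
  by (simp add: agree_def hpos_def)

definition accurate :: "nat \<Rightarrow> real \<Rightarrow> (nat \<Rightarrow> int) set \<Rightarrow> ((nat \<Rightarrow> int) \<Rightarrow> real) \<Rightarrow> bool" where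
  "accurate k \<epsilon> \<Gamma> m \<longleftrightarrow> finite \<Gamma> \<and> (\<forall>\<gamma>\<in>\<Gamma>. 0 \<le> m \<gamma>) \<and> sum m \<Gamma> = 1 \<and>
    (\<forall>u v. (\<Sum>b<k. (u b)\<^sup>2) = 1 \<longrightarrow> (\<Sum>b<k. (v b)\<^sup>2) = 1 \<longrightarrow>
      \<bar>(\<Sum>\<gamma>\<in>\<Gamma>. m \<gamma> * of_bool (hpos k \<gamma> u \<noteq> hpos k \<gamma> v)) - arccos (\<Sum>b<k. u b * v b) / pi\<bar> \<le> \<epsilon>)"

definition agreement :: "nat \<Rightarrow> (nat \<Rightarrow> int) set \<Rightarrow> ((nat \<Rightarrow> int) \<Rightarrow> real) \<Rightarrow> (nat \<Rightarrow> nat \<Rightarrow> real) \<Rightarrow> nat \<Rightarrow> nat \<Rightarrow> real" where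
  "agreement k \<Gamma> m S i j = (\<Sum>\<gamma>\<in>\<Gamma>. m \<gamma> * agree k \<gamma> S i j)"

lemma agreement_bounds:
  assumes "accurate k \<epsilon> \<Gamma> m"
  shows "0 \<le> agreement k \<Gamma> m S i j" "agreement k \<Gamma> m S i j \<le> 1"
proof -
  show "0 \<le> agreement k \<Gamma> m S i j"
    using assms by (auto simp: agreement_def accurate_def agree_def intro!: sum_nonneg)
  have "agreement k \<Gamma> m S i j \<le> (\<Sum>\<gamma>\<in>\<Gamma>. m \<gamma>)"
    unfolding agreement_def using assms
    by (intro sum_mono mult_left_le) (auto simp: accurate_def agree_def)
  then show "agreement k \<Gamma> m S i j \<le> 1" using assms by (simp add: accurate_def)
qed

lemma hpos_scale: "0 < c \<Longrightarrow> hpos k \<gamma> (\<lambda>b. u b / c) \<longleftrightarrow> hpos k \<gamma> u"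
  unfolding hpos_def times_divide_eq_right sum_divide_distrib[symmetric] by (simp add: zero_less_divide_iff)

lemma agreement_near:
  assumes acc: "accurate k \<epsilon> \<Gamma> m" and pos: "0 < gram k S i i" "0 < gram k S j j"
  defines "c \<equiv> gram k S i j / (sqrt (gram k S i i) * sqrt (gram k S j j))"
  shows "\<bar>c\<bar> \<le> 1" "\<bar>agreement k \<Gamma> m S i j - (1 - arccos c / pi)\<bar> \<le> \<epsilon>"
proof -
  let ?u = "\<lambda>b. S i b / sqrt (gram k S i i)" and ?v = "\<lambda>b. S j b / sqrt (gram k S j j)"
  have unit: "(\<Sum>b<k. (S l b / sqrt (gram k S l l))\<^sup>2) = 1" if "0 < gram k S l l" for l
    using that by (simp add: power_divide sum_divide_distrib[symmetric] gram_def[symmetric] power2_eq_square[of "S _ _"])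
  have ip: "(\<Sum>b<k. ?u b * ?v b) = c"
    by (simp add: c_def gram_def sum_divide_distrib)
  have "\<bar>\<Sum>b<k. ?u b * ?v b\<bar> \<le> (\<Sum>b<k. ((?u b)\<^sup>2 + (?v b)\<^sup>2) / 2)"
  proof -
    have "\<bar>?u b * ?v b\<bar> \<le> ((?u b)\<^sup>2 + (?v b)\<^sup>2) / 2" for b
      using sum_squares_bound[of "\<bar>?u b\<bar>" "\<bar>?v b\<bar>"] unfolding power2_abs abs_mult by argo
    then show ?thesis by (intro order_trans[OF sum_abs] sum_mono)
  qed
  also have "\<dots> = 1" unfolding sum_divide_distrib[symmetric] sum.distrib unit[OF pos(1)] unit[OF pos(2)] by simp
  finally show c: "\<bar>c\<bar> \<le> 1" unfolding ip .
  have "agreement k \<Gamma> m S i j = (\<Sum>\<gamma>\<in>\<Gamma>. m \<gamma> - m \<gamma> * of_bool (hpos k \<gamma> ?u \<noteq> hpos k \<gamma> ?v))"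
    unfolding agreement_def agree_def using pos by (intro sum.cong) (auto simp: hpos_scale)
  also have "\<dots> = 1 - (\<Sum>\<gamma>\<in>\<Gamma>. m \<gamma> * of_bool (hpos k \<gamma> ?u \<noteq> hpos k \<gamma> ?v))"
    using acc by (simp add: sum_subtractf accurate_def)
  finally have eq: "agreement k \<Gamma> m S i j = 1 - (\<Sum>\<gamma>\<in>\<Gamma>. m \<gamma> * of_bool (hpos k \<gamma> ?u \<noteq> hpos k \<gamma> ?v))" .
  have "\<bar>(\<Sum>\<gamma>\<in>\<Gamma>. m \<gamma> * of_bool (hpos k \<gamma> ?u \<noteq> hpos k \<gamma> ?v)) - arccos (\<Sum>b<k. ?u b * ?v b) / pi\<bar> \<le> \<epsilon>"
  proof -
    have "\<And>u v. (\<Sum>b<k. (u b)\<^sup>2) = 1 \<Longrightarrow> (\<Sum>b<k. (v b)\<^sup>2) = 1 \<Longrightarrow>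
      \<bar>(\<Sum>\<gamma>\<in>\<Gamma>. m \<gamma> * of_bool (hpos k \<gamma> u \<noteq> hpos k \<gamma> v)) - arccos (\<Sum>b<k. u b * v b) / pi\<bar> \<le> \<epsilon>"
      using acc unfolding accurate_def by (elim conjE) (drule spec, drule spec, drule mp, assumption, drule mp, assumption, assumption)
    from this[of ?u ?v, OF unit[OF pos(1)] unit[OF pos(2)]] show ?thesis .
  qed
  then show "\<bar>agreement k \<Gamma> m S i j - (1 - arccos c / pi)\<bar> \<le> \<epsilon>"
    unfolding eq ip by (simp add: abs_le_iff)
qed

lemma coll_Lipschitz:
  assumes "0 \<le> a" "a \<le> 1" "0 \<le> b" "b \<le> 1"
  shows "\<bar>coll a - coll b\<bar> \<le> 3 * \<bar>a - b\<bar>"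
proof -
  let ?q = "87/100 * (a + b) + 13/100 * (a\<^sup>2 + a * b + b\<^sup>2)"
  have "coll a - coll b = (a - b) * ?q"
  proof -
    have "(s * a^2 + t * a^3) - (s * b^2 + t * b^3) = (a - b) * (s * (a + b) + t * (a\<^sup>2 + a * b + b\<^sup>2))" for s t
      by (simp add: power2_eq_square power3_eq_cube algebra_simps)
    then show ?thesis unfolding coll_def .
  qed
  moreover have "\<bar>?q\<bar> \<le> 3"
  proof -
    have bound: "\<bar>87/100 * s + 13/100 * t\<bar> \<le> 3" if "0 \<le> s" "s \<le> 2" "0 \<le> t" "t \<le> 3" for s t :: real
      using that by (simp add: abs_le_iff)
    have "a\<^sup>2 \<le> 1" "b\<^sup>2 \<le> 1" "a * b \<le> 1" "0 \<le> a * b"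
      using assms by (simp_all add: power_le_one mult_le_one)
    then have "0 \<le> a\<^sup>2 + a * b + b\<^sup>2" "a\<^sup>2 + a * b + b\<^sup>2 \<le> 3" using zero_le_power2[of a] zero_le_power2[of b] by linarith+
    then show ?thesis using assms by (intro bound) simp_all
  qed
  then have "\<bar>a - b\<bar> * \<bar>?q\<bar> \<le> \<bar>a - b\<bar> * 3" by (intro mult_left_mono) auto
  ultimately show ?thesis by (simp only: abs_mult mult.commute)
qed

lemma coll_bounds: "0 \<le> a \<Longrightarrow> a \<le> 1 \<Longrightarrow> 0 \<le> coll a \<and> coll a \<le> 1"
  using coll_mono[of 0 a] coll_mono[of a 1] by (simp add: coll_def)

text \<open>The product is the geometric mean of \<open>x\<close> and \<open>y\<close> and so lies
  between their minimum and maximum.\<close>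

lemma sqrt_prod_near_1:
  assumes "0 < x" "0 < y"
  shows "\<bar>sqrt x * sqrt y - 1\<bar> \<le> \<bar>x - 1\<bar> + \<bar>y - 1\<bar>"
proof -
  have le: "\<bar>z - 1\<bar> \<le> \<bar>z\<^sup>2 - 1\<bar>" if "0 \<le> z" for z :: real
  proof -
    have "z\<^sup>2 - 1 = (z - 1) * (z + 1)" by (simp add: power2_eq_square algebra_simps)
    then have "\<bar>z\<^sup>2 - 1\<bar> = \<bar>z - 1\<bar> * (z + 1)" using that by (simp only: abs_mult)
    moreover have "\<bar>z - 1\<bar> * 1 \<le> \<bar>z - 1\<bar> * (z + 1)" using that by (intro mult_left_mono) auto
    ultimately show ?thesis by simp
  qed
  have min: "min x y \<le> sqrt x * sqrt y"
  proof -
    have "sqrt (min x y) * sqrt (min x y) \<le> sqrt x * sqrt y"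
      using assms by (intro mult_mono) auto
    then show ?thesis using assms by simp
  qed
  have max: "sqrt x * sqrt y \<le> max x y"
  proof -
    have "sqrt x * sqrt y \<le> sqrt (max x y) * sqrt (max x y)"
      using assms by (intro mult_mono) auto
    then show ?thesis using assms by simp
  qed
  show ?thesis using min max by (auto simp: min_def max_def abs_if split: if_splits)
qed

text \<open>The two estimates of \<open>coll\<close> hold for the normalised inner product
  \<open>c\<close> and pass to the entry \<open>x\<close> of the relaxation by Lipschitz continuity;
  \<open>r\<close> collects the errors of the inner product and of the norms. The range up to
  101/100 allows for a diagonal that is only nearly 1.\<close>

lemma pair_bounds:
  fixes S :: "nat \<Rightarrow> nat \<Rightarrow> real" and i j k :: nat and x :: real
  assumes acc: "accurate k \<epsilon> \<Gamma> m" and eps: "0 \<le> \<epsilon>" and x: "\<bar>x\<bar> \<le> 101/100"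
  defines "r \<equiv> \<bar>gram k S i j - x\<bar> + \<bar>gram k S i i - 1\<bar> + \<bar>gram k S j j - 1\<bar>"
    and "a \<equiv> agreement k \<Gamma> m S i j"
  shows "383/500 * x + 1/2000 - 3 * \<epsilon> - r \<le> coll a"
    "coll a \<le> 117/500 + 383/500 * phi x + 3 * \<epsilon> + 2 * r"
proof -
  have a: "0 \<le> a" "a \<le> 1" unfolding a_def by (rule agreement_bounds[OF acc])+
  have ca: "0 \<le> coll a" "coll a \<le> 1" using coll_bounds[OF a] by auto
  have gnn: "0 \<le> gram k S l l" for l unfolding gram_def by (intro sum_nonneg) auto
  have "383/500 * x + 1/2000 - 3 * \<epsilon> - r \<le> coll a \<and> coll a \<le> 117/500 + 383/500 * phi x + 3 * \<epsilon> + 2 * r"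
  proof (cases "0 < gram k S i i \<and> 0 < gram k S j j")
    \<comment> \<open>A zero vector has no direction, but its norm error alone makes
      \<open>r \<ge> 1\<close>, which renders both estimates trivial.\<close>
    case False
    then have "1 \<le> r" unfolding r_def using gnn[of i] gnn[of j] by (auto simp: not_less abs_if)
    moreover have "x \<le> 101/100" using x by simp
    ultimately show ?thesis using ca eps phi_ge[of x] by argo
  next
    case True
    define c where "c = gram k S i j / (sqrt (gram k S i i) * sqrt (gram k S j j))"
    have c: "\<bar>c\<bar> \<le> 1" and near: "\<bar>a - (1 - arccos c / pi)\<bar> \<le> \<epsilon>"
      using agreement_near[OF acc, of S i j] True unfolding c_def a_def by auto
    define b where "b = 1 - arccos c / pi"
    have b: "0 \<le> b" "b \<le> 1" "cos (pi * (1 - b)) = c"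
      using c arccos_lbound[of c] arccos_ubound[of c] by (auto simp: b_def abs_le_iff)
    have "\<bar>a - b\<bar> \<le> \<epsilon>" using near by (simp only: b_def)
    then have "\<bar>coll a - coll b\<bar> \<le> 3 * \<epsilon>" using coll_Lipschitz[OF a b(1,2)] by argo
    then have ab: "coll b \<le> coll a + 3 * \<epsilon>" "coll a \<le> coll b + 3 * \<epsilon>" unfolding abs_le_iff by argo+
    let ?s = "sqrt (gram k S i i) * sqrt (gram k S j j)"
    have s0: "0 < ?s" using True by simp
    then have "gram k S i j = c * ?s" unfolding c_def using True by (intro nonzero_divide_eq_eq[THEN iffD1]) auto
    then have "\<bar>gram k S i j - c\<bar> = \<bar>c\<bar> * \<bar>?s - 1\<bar>" by (simp add: abs_mult[symmetric] algebra_simps)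
    also have "\<dots> \<le> 1 * \<bar>?s - 1\<bar>" using c by (intro mult_right_mono) auto
    also have "\<dots> \<le> \<bar>gram k S i i - 1\<bar> + \<bar>gram k S j j - 1\<bar>" using sqrt_prod_near_1 True by simp
    finally have cx: "\<bar>c - x\<bar> \<le> r" unfolding r_def by linarith
    have "\<bar>phi c - phi x\<bar> \<le> 2 * r"
    proof -
      have "(s * c + t * c\<^sup>2) - (s * x + t * x\<^sup>2) = (c - x) * (s + t * (c + x))" for s t
        by (simp add: power2_eq_square algebra_simps)
      then have "phi c - phi x = (c - x) * (2/5 + 3/5 * (c + x))" unfolding phi_def .
      moreover have "\<bar>2/5 + 3/5 * (c + x)\<bar> \<le> 2"
      proof -
        have "c \<le> 1" "- 1 \<le> c" "x \<le> 101/100" "- 101/100 \<le> x" using c x by auto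
        then show ?thesis unfolding abs_le_iff by argo
      qed
      ultimately have "\<bar>phi c - phi x\<bar> \<le> \<bar>c - x\<bar> * 2" by (simp only: abs_mult mult_left_mono abs_ge_zero)
      then show ?thesis using cx by simp
    qed
    then have p: "phi c \<le> phi x + 2 * r" by linarith
    have r0: "0 \<le> r" by (simp add: r_def)
    have "x - r \<le> c" using cx by linarith
    moreover have "383/500 * c + 1/2000 \<le> coll b" using coll_ge[OF b(1,2)] b(3) by simp
    moreover have "coll b \<le> 117/500 + 383/500 * phi c" using coll_le[OF b(1,2)] b(3) by simp
    ultimately show ?thesis using ab p r0 by argo
  qed
  then show "383/500 * x + 1/2000 - 3 * \<epsilon> - r \<le> coll a"
    "coll a \<le> 117/500 + 383/500 * phi x + 3 * \<epsilon> + 2 * r" by auto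
qed

context weights
begin

text \<open>The weights with which rounding pays for an error in an entry: those of the edges, of
  the null model and of the diagonal. One potential with their sum controls all three kinds of
  error.\<close>

definition cw :: "nat \<Rightarrow> nat \<Rightarrow> real" where
  "cw i j = w i j + p i * p j + (if i = j then p i else 0)"

lemma cw_nonneg: "0 \<le> cw i j"
  by (simp add: cw_def w_nonneg p_nonneg)

lemma cw_sum: "dbl n cw = 3"
proof -
  have "dbl n cw = dbl n w + dbl n (\<lambda>i j. p i * p j) + dbl n (\<lambda>i j. if i = j then p i else 0)"
    unfolding dbl_add[symmetric] by (rule dbl_cong) (simp add: cw_def)
  then show ?thesis by (simp add: w_sum pp_sum dbl_diag p_sum)
qed

text \<open>With \<open>\<gamma>3 = 0\<close>, which separates nothing, this is the modularity of rounding with two hyperplanes.\<close>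

definition quality :: "nat \<Rightarrow> (nat \<Rightarrow> nat \<Rightarrow> real) \<Rightarrow> (nat \<Rightarrow> int) \<Rightarrow> (nat \<Rightarrow> int) \<Rightarrow> (nat \<Rightarrow> int) \<Rightarrow> real" where
  "quality k S \<gamma>1 \<gamma>2 \<gamma>3 = dbl n (\<lambda>i j. (w i j - p i * p j) *
     (agree k \<gamma>1 S i j * agree k \<gamma>2 S i j * agree k \<gamma>3 S i j))"

text \<open>The expected quality is linear in the distribution of each single hyperplane, so they
  can be fixed one after another. The mixture of two and three hyperplanes is a convex combination,
  hence one of its parts reaches the average.\<close>

lemma exists_good_hyperplanes:
  assumes acc: "accurate k \<epsilon> \<Gamma> m"
  shows "\<exists>\<gamma>1\<in>\<Gamma>. \<exists>\<gamma>2\<in>\<Gamma>. \<exists>\<gamma>3\<in>insert (\<lambda>_. 0) \<Gamma>.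
    dbl n (\<lambda>i j. (w i j - p i * p j) * coll (agreement k \<Gamma> m S i j)) \<le> quality k S \<gamma>1 \<gamma>2 \<gamma>3"
proof -
  have fin: "finite \<Gamma>" and m: "\<And>\<gamma>. \<gamma> \<in> \<Gamma> \<Longrightarrow> 0 \<le> m \<gamma>" and m1: "sum m \<Gamma> = 1"
    using acc by (auto simp: accurate_def)
  let ?Q = "\<lambda>\<gamma>1 \<gamma>2 \<gamma>3. quality k S \<gamma>1 \<gamma>2 \<gamma>3"
  let ?q = "\<lambda>i j. w i j - p i * p j"
  let ?a = "agreement k \<Gamma> m S"
  have push: "(\<Sum>\<gamma>\<in>\<Gamma>. m \<gamma> * dbl n (\<lambda>i j. h i j * agree k \<gamma> S i j)) = dbl n (\<lambda>i j. h i j * ?a i j)" for h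
  proof -
    have "(\<Sum>\<gamma>\<in>\<Gamma>. m \<gamma> * dbl n (\<lambda>i j. h i j * agree k \<gamma> S i j)) = dbl n (\<lambda>i j. \<Sum>\<gamma>\<in>\<Gamma>. m \<gamma> * (h i j * agree k \<gamma> S i j))"
      by (simp add: dbl_sum dbl_cmult)
    then show ?thesis by (simp add: agreement_def sum_distrib_left mult_ac)
  qed
  define E where "E \<gamma>1 \<gamma>2 = 87/100 * ?Q \<gamma>1 \<gamma>2 (\<lambda>_. 0) + 13/100 * (\<Sum>\<gamma>\<in>\<Gamma>. m \<gamma> * ?Q \<gamma>1 \<gamma>2 \<gamma>)" for \<gamma>1 \<gamma>2
  have E: "E \<gamma>1 \<gamma>2 = dbl n (\<lambda>i j. (?q i j * (87/100 + 13/100 * ?a i j) * agree k \<gamma>1 S i j) * agree k \<gamma>2 S i j)" for \<gamma>1 \<gamma>2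
  proof -
    have Q: "(\<Sum>\<gamma>\<in>\<Gamma>. m \<gamma> * ?Q \<gamma>1 \<gamma>2 \<gamma>) = dbl n (\<lambda>i j. ?q i j * (agree k \<gamma>1 S i j * agree k \<gamma>2 S i j) * ?a i j)"
      using push[of "\<lambda>i j. ?q i j * (agree k \<gamma>1 S i j * agree k \<gamma>2 S i j)"] by (simp add: quality_def mult.assoc)
    show ?thesis
      unfolding E_def Q unfolding quality_def agree_zero dbl_cmult[symmetric] dbl_add[symmetric]
    proof (rule dbl_cong)
      fix i j
      have "s * (q * (x * y * 1)) + t * (q * (x * y) * a) = q * (s + t * a) * x * y" for s t q x y a :: real
        by (simp add: algebra_simps)
      then show "87/100 * (?q i j * (agree k \<gamma>1 S i j * agree k \<gamma>2 S i j * 1)) + 13/100 * (?q i j * (agree k \<gamma>1 S i j * agree k \<gamma>2 S i j) * ?a i j) =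
        (?q i j * (87/100 + 13/100 * ?a i j) * agree k \<gamma>1 S i j) * agree k \<gamma>2 S i j" .
    qed
  qed
  have "(\<Sum>\<gamma>1\<in>\<Gamma>. m \<gamma>1 * (\<Sum>\<gamma>2\<in>\<Gamma>. m \<gamma>2 * E \<gamma>1 \<gamma>2)) =
      (\<Sum>\<gamma>1\<in>\<Gamma>. m \<gamma>1 * dbl n (\<lambda>i j. (?q i j * (87/100 + 13/100 * ?a i j) * agree k \<gamma>1 S i j) * ?a i j))"
    by (simp only: E push)
  also have "\<dots> =
      (\<Sum>\<gamma>1\<in>\<Gamma>. m \<gamma>1 * dbl n (\<lambda>i j. (?q i j * (87/100 + 13/100 * ?a i j) * ?a i j) * agree k \<gamma>1 S i j))"
  proof -
    have "(q * r * x) * a = (q * r * a) * x" for q r x a :: real by simp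
    then show ?thesis by (rule sum.cong[OF refl, OF arg_cong2[where f = "(*)", OF refl dbl_cong]])
  qed
  also have "\<dots> = dbl n (\<lambda>i j. ?q i j * coll (?a i j))"
    unfolding push
  proof (rule dbl_cong)
    fix i j
    have "q * (s + t * a) * a * a = q * (s * a\<^sup>2 + t * a^3)" for q s t a :: real
      by (simp add: power2_eq_square power3_eq_cube algebra_simps)
    then show "?q i j * (87/100 + 13/100 * ?a i j) * ?a i j * ?a i j = ?q i j * coll (?a i j)"
      unfolding coll_def .
  qed
  finally have avg: "dbl n (\<lambda>i j. ?q i j * coll (?a i j)) \<le> (\<Sum>\<gamma>1\<in>\<Gamma>. m \<gamma>1 * (\<Sum>\<gamma>2\<in>\<Gamma>. m \<gamma>2 * E \<gamma>1 \<gamma>2))" by simp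
  let ?V = "dbl n (\<lambda>i j. ?q i j * coll (?a i j))"
  obtain \<gamma>1 where g1: "\<gamma>1 \<in> \<Gamma>" "?V \<le> (\<Sum>\<gamma>2\<in>\<Gamma>. m \<gamma>2 * E \<gamma>1 \<gamma>2)"
    using exists_ge_average[OF fin m m1 avg] by blast
  obtain \<gamma>2 where g2: "\<gamma>2 \<in> \<Gamma>" "?V \<le> E \<gamma>1 \<gamma>2"
    using exists_ge_average[OF fin m m1 g1(2)] by blast
  show ?thesis
  proof (cases "?V \<le> ?Q \<gamma>1 \<gamma>2 (\<lambda>_. 0)")
    case True
    then show ?thesis using g1 g2 by blast
  next
    case False
    then have "?V \<le> (\<Sum>\<gamma>\<in>\<Gamma>. m \<gamma> * ?Q \<gamma>1 \<gamma>2 \<gamma>)" using g2(2) unfolding E_def by argo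
    from exists_ge_average[OF fin m m1 this] show ?thesis using g1 g2 by blast
  qed
qed

text \<open>The factor 6: \<open>\<epsilon>\<close> enters with 3 in each of the two sums; the norm
  errors enter with 2 in the edge sum and 4 in the null-model sum, and each of them is at most a
  diagonal error of the reduction plus \<open>\<delta>\<close>.\<close>

lemma rounding:
  assumes acc: "accurate k \<epsilon> \<Gamma> m" and eps: "0 \<le> \<epsilon>"
    and err: "dbl n (\<lambda>i j. cw i j * \<bar>gram k S i j - X i j\<bar>) \<le> \<eta>"
    and diag: "\<And>i. i < n \<Longrightarrow> \<bar>X i i - 1\<bar> \<le> \<delta>"
    and X: "\<And>i j. i < n \<Longrightarrow> j < n \<Longrightarrow> \<bar>X i j\<bar> \<le> 101/100"
  shows "\<exists>\<gamma>1\<in>\<Gamma>. \<exists>\<gamma>2\<in>\<Gamma>. \<exists>\<gamma>3\<in>insert (\<lambda>_. 0) \<Gamma>.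
    383/500 * R X - 117/500 + 1/2000 - 6 * (\<epsilon> + \<eta> + \<delta>) \<le> quality k S \<gamma>1 \<gamma>2 \<gamma>3"
proof -
  define e where "e i j = \<bar>gram k S i j - X i j\<bar>" for i j
  define N where "N i = \<bar>gram k S i i - 1\<bar>" for i
  let ?a = "agreement k \<Gamma> m S"
  have ww: "dbl n (\<lambda>i j. w i j * c) = c" "dbl n (\<lambda>i j. p i * p j * c) = c" for c
    using dbl_cmult[of n c w] dbl_cmult[of n c "\<lambda>i j. p i * p j"] by (simp_all add: w_sum pp_sum mult.commute)
  have lower: "383/500 * dbl n (\<lambda>i j. w i j * X i j) + 1/2000 - 3 * \<epsilon> -
      (dbl n (\<lambda>i j. w i j * e i j) + 2 * (\<Sum>i<n. p i * N i)) \<le> dbl n (\<lambda>i j. w i j * coll (?a i j))"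
  proof -
    have "dbl n (\<lambda>i j. w i j * (383/500 * X i j + 1/2000 - 3 * \<epsilon> - (e i j + N i + N j))) \<le> dbl n (\<lambda>i j. w i j * coll (?a i j))"
      using pair_bounds(1)[OF acc eps X] by (intro dbl_mono mult_left_mono w_nonneg) (simp add: e_def N_def)
    moreover have "dbl n (\<lambda>i j. w i j * (383/500 * X i j + 1/2000 - 3 * \<epsilon> - (e i j + N i + N j))) =
      383/500 * dbl n (\<lambda>i j. w i j * X i j) + dbl n (\<lambda>i j. w i j * (1/2000 - 3 * \<epsilon>)) - (dbl n (\<lambda>i j. w i j * e i j) + dbl n (\<lambda>i j. w i j * N i) + dbl n (\<lambda>i j. w i j * N j))"
      unfolding dbl_cmult[symmetric] dbl_add[symmetric] dbl_diff[symmetric] by (rule dbl_cong) (simp add: algebra_simps)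
    ultimately show ?thesis unfolding ww w_marginal by simp
  qed
  have upper: "dbl n (\<lambda>i j. p i * p j * coll (?a i j)) \<le> 117/500 + 383/500 * dbl n (\<lambda>i j. p i * p j * phi (X i j)) + 3 * \<epsilon> +
      2 * (dbl n (\<lambda>i j. p i * p j * e i j) + 2 * (\<Sum>i<n. p i * N i))"
  proof -
    have "dbl n (\<lambda>i j. p i * p j * coll (?a i j)) \<le> dbl n (\<lambda>i j. p i * p j * (117/500 + 383/500 * phi (X i j) + 3 * \<epsilon> + 2 * (e i j + N i + N j)))"
      using pair_bounds(2)[OF acc eps X] by (intro dbl_mono mult_left_mono) (simp_all add: e_def N_def p_nonneg)
    also have "\<dots> = dbl n (\<lambda>i j. p i * p j * (117/500 + 3 * \<epsilon>)) + 383/500 * dbl n (\<lambda>i j. p i * p j * phi (X i j)) +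
        2 * (dbl n (\<lambda>i j. p i * p j * e i j) + dbl n (\<lambda>i j. p i * p j * N i) + dbl n (\<lambda>i j. p i * p j * N j))"
      unfolding dbl_cmult[symmetric] dbl_add[symmetric] by (rule dbl_cong) (simp add: algebra_simps)
    finally show ?thesis unfolding ww pp_marginal by simp
  qed
  have "(\<Sum>i<n. p i * N i) \<le> (\<Sum>i<n. p i * (e i i + \<delta>))"
  proof (intro sum_mono mult_left_mono p_nonneg)
    fix i assume "i \<in> {..<n}"
    then show "N i \<le> e i i + \<delta>" using diag[of i] unfolding N_def e_def by simp
  qed
  then have N: "(\<Sum>i<n. p i * N i) \<le> (\<Sum>i<n. p i * e i i) + \<delta>"
    by (simp add: distrib_left sum.distrib sum_distrib_right[symmetric] p_sum)
  have "dbl n (\<lambda>i j. cw i j * e i j) = dbl n (\<lambda>i j. w i j * e i j) + dbl n (\<lambda>i j. p i * p j * e i j) + dbl n (\<lambda>i j. if i = j then p i * e i i else 0)"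
    unfolding dbl_add[symmetric] by (rule dbl_cong) (simp add: cw_def algebra_simps)
  then have err': "dbl n (\<lambda>i j. w i j * e i j) + dbl n (\<lambda>i j. p i * p j * e i j) + (\<Sum>i<n. p i * e i i) \<le> \<eta>"
    using err by (simp add: dbl_diag e_def)
  have nn: "0 \<le> dbl n (\<lambda>i j. w i j * e i j)" "0 \<le> dbl n (\<lambda>i j. p i * p j * e i j)" "0 \<le> (\<Sum>i<n. p i * e i i)"
    unfolding dbl_def by (intro sum_nonneg mult_nonneg_nonneg; simp add: w_nonneg p_nonneg e_def)+
  have "dbl n (\<lambda>i j. (w i j - p i * p j) * coll (?a i j)) = dbl n (\<lambda>i j. w i j * coll (?a i j)) - dbl n (\<lambda>i j. p i * p j * coll (?a i j))"
    unfolding dbl_diff[symmetric] by (simp add: left_diff_distrib)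
  then have "383/500 * R X - 117/500 + 1/2000 - 6 * (\<epsilon> + \<eta> + \<delta>) \<le> dbl n (\<lambda>i j. (w i j - p i * p j) * coll (?a i j))"
    unfolding R_def using lower upper N err' nn by argo
  then show ?thesis using exists_good_hyperplanes[OF acc, of S] by (meson order_trans)
qed

text \<open>The additive form of the Cauchy-Schwarz inequality for weights of total 3: an error
  \<open>x\<close> is at most \<open>x\<^sup>2 / (2 * t) + t / 2\<close>.\<close>

lemma mean_error:
  assumes "dbl n (\<lambda>i j. cw i j * (e i j)\<^sup>2) \<le> v" "0 < t"
  shows "dbl n (\<lambda>i j. cw i j * \<bar>e i j\<bar>) \<le> v / (2 * t) + 3 * t / 2"
proof -
  have "dbl n (\<lambda>i j. cw i j * \<bar>e i j\<bar>) \<le> dbl n (\<lambda>i j. 1 / (2 * t) * (cw i j * (e i j)\<^sup>2) + t / 2 * cw i j)"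
  proof (rule dbl_mono)
    fix i j
    have "2 * \<bar>e i j\<bar> * t \<le> (e i j)\<^sup>2 + t\<^sup>2" using sum_squares_bound[of "\<bar>e i j\<bar>" t] by simp
    then have "\<bar>e i j\<bar> \<le> 1 / (2 * t) * (e i j)\<^sup>2 + t / 2"
      using assms(2) by (simp add: field_simps power2_eq_square)
    from mult_left_mono[OF this cw_nonneg[of i j]]
    show "cw i j * \<bar>e i j\<bar> \<le> 1 / (2 * t) * (cw i j * (e i j)\<^sup>2) + t / 2 * cw i j"
      by (simp add: algebra_simps)
  qed
  also have "\<dots> = 1 / (2 * t) * dbl n (\<lambda>i j. cw i j * (e i j)\<^sup>2) + t / 2 * 3"
    unfolding dbl_add dbl_cmult cw_sum ..
  also have "\<dots> \<le> 1 / (2 * t) * v + t / 2 * 3" using assms by (intro add_right_mono mult_left_mono) auto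
  finally show ?thesis by simp
qed

end

section \<open>The algorithm\<close>

definition same_but :: "nat set \<Rightarrow> state \<Rightarrow> state \<Rightarrow> bool" where
  "same_but X \<sigma> \<tau> \<longleftrightarrow> (\<forall>a. a \<notin> X \<longrightarrow> \<tau> a = \<sigma> a)"

lemma same_but_refl [simp]: "same_but X \<sigma> \<sigma>"
  by (simp add: same_but_def)

lemma same_but_trans: "same_but X \<sigma> \<tau> \<Longrightarrow> same_but X \<tau> \<rho> \<Longrightarrow> same_but X \<sigma> \<rho>"
  by (simp add: same_but_def)

lemma fold_upt_invariant:
  assumes "P 0 \<sigma>" "\<And>i \<tau>. i < m \<Longrightarrow> P i \<tau> \<Longrightarrow> P (Suc i) (f i \<tau>)"
  shows "P m (fold f [0..<m] \<sigma>)"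
  using assms(2)
proof (induction m)
  case 0
  then show ?case using assms(1) by simp
qed simp

text \<open>The hypothesis evaluates \<open>t\<close> in the partially updated state, so
  \<open>t\<close> may read entries of the array that are not yet overwritten.\<close>

lemma run_column:
  assumes "\<And>i \<tau>. i < ln_of n l \<Longrightarrow> \<tau> = \<sigma>(a := \<lambda>i' j. if i' < i \<and> j = b then v i' else \<sigma> a i' j) \<Longrightarrow>
      tv n (e(x := i)) \<tau> t = v i \<and> nat (tv n (e(x := i)) \<tau> tb) = b"
  shows "run n e (SFor x l (SSet a (TV x) tb t)) \<sigma> =
    \<sigma>(a := \<lambda>i j. if i < ln_of n l \<and> j = b then v i else \<sigma> a i j)"
  unfolding run.simps(5)
  by (rule fold_upt_invariant[where P = "\<lambda>i \<tau>. \<tau> = \<sigma>(a := \<lambda>i' j. if i' < i \<and> j = b then v i' else \<sigma> a i' j)"])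
    (use assms in \<open>auto simp: fun_eq_iff less_Suc_eq\<close>)

lemma run_row:
  assumes "\<And>j \<tau>. j < ln_of n l \<Longrightarrow> \<tau> = \<sigma>(a := \<lambda>i j'. if i = b \<and> j' < j then v j' else \<sigma> a i j') \<Longrightarrow>
      tv n (e(x := j)) \<tau> t = v j \<and> nat (tv n (e(x := j)) \<tau> tb) = b"
  shows "run n e (SFor x l (SSet a tb (TV x) t)) \<sigma> =
    \<sigma>(a := \<lambda>i j. if i = b \<and> j < ln_of n l then v j else \<sigma> a i j)"
  unfolding run.simps(5)
  by (rule fold_upt_invariant[where P = "\<lambda>j \<tau>. \<tau> = \<sigma>(a := \<lambda>i j'. if i = b \<and> j' < j then v j' else \<sigma> a i j')"])
    (use assms in \<open>auto simp: fun_eq_iff less_Suc_eq\<close>)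

text \<open>The arbitrary contents \<open>f\<close> express that \<open>t\<close> must not depend on
  the array being filled.\<close>

lemma run_matrix:
  assumes "x \<noteq> y" "\<And>i j f. i < ln_of n l \<Longrightarrow> j < ln_of n l' \<Longrightarrow> tv n (e(x := i, y := j)) (\<sigma>(a := f)) t = v i j"
  shows "run n e (SFor x l (SFor y l' (SSet a (TV x) (TV y) t))) \<sigma> =
    \<sigma>(a := \<lambda>i j. if i < ln_of n l \<and> j < ln_of n l' then v i j else \<sigma> a i j)"
  unfolding run.simps(5)[of _ _ x]
proof (rule fold_upt_invariant[where P = "\<lambda>i \<tau>. \<tau> = \<sigma>(a := \<lambda>i' j. if i' < i \<and> j < ln_of n l' then v i' j else \<sigma> a i' j)"], goal_cases)
  case (2 i \<tau>)
  have "run n (e(x := i)) (SFor y l' (SSet a (TV x) (TV y) t)) \<tau> =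
      \<tau>(a := \<lambda>i' j. if i' = i \<and> j < ln_of n l' then v i j else \<tau> a i' j)"
    by (rule run_row) (use 2 assms in auto)
  then show ?case unfolding 2 by (auto simp: fun_eq_iff less_Suc_eq)
qed (simp add: fun_eq_iff)

text \<open>Tests know only positivity; for an integer x, \<open>1 - x * x\<close> is positive just
  when x is 0.\<close>

definition teq :: "tm \<Rightarrow> tm \<Rightarrow> tm" where
  "teq s t = TSub (TC 1) (TMul (TSub s t) (TSub s t))"

lemma teq [simp]: "0 < tv n e \<sigma> (teq s t) \<longleftrightarrow> tv n e \<sigma> s = tv n e \<sigma> t"
proof -
  have "0 < 1 - x * x \<longleftrightarrow> x = 0" for x :: int
  proof
    assume "0 < 1 - x * x"
    then have "x * x < 1" by simp
    moreover have "1 \<le> \<bar>x\<bar> * \<bar>x\<bar>" if "x \<noteq> 0"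
      using that mult_mono[of 1 "\<bar>x\<bar>" 1 "\<bar>x\<bar>"] by simp
    ultimately show "x = 0" by (auto simp: abs_mult_self_eq)
  qed simp
  then show ?thesis by (simp add: teq_def)
qed

text \<open>
  Arrays: \<open>4\<close> the factor \<open>L\<close>, whose entries have the common denominator \<open>6\<close>; \<open>5\<close> the product of the
  denominators of the input; \<open>7\<close> the vectors after dimension reduction; \<open>8\<close> a flag; \<open>9\<close> the current
  labels; \<open>10\<close> the best labels; \<open>11\<close>, \<open>12\<close>, \<open>13\<close> the adjacency matrix, the degrees and their sum.
  The variables from \<open>5\<close> to \<open>7\<close> are bound by sums, the others by loops.
\<close>

abbreviation tA :: "nat \<Rightarrow> nat \<Rightarrow> tm" where "tA x y \<equiv> TA 11 (TV x) (TV y)"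
abbreviation td :: "nat \<Rightarrow> tm" where "td x \<equiv> TA 12 (TV x) (TC 0)"
abbreviation tM :: tm where "tM \<equiv> TA 13 (TC 0) (TC 0)"
abbreviation tL :: "nat \<Rightarrow> nat \<Rightarrow> tm" where "tL x y \<equiv> TA 4 (TV x) (TV y)"
abbreviation tZ :: tm where "tZ \<equiv> TA 6 (TC 0) (TC 0)"
abbreviation tZ2 :: tm where "tZ2 \<equiv> TMul tZ tZ"

definition tgram :: "nat \<Rightarrow> nat \<Rightarrow> tm" where
  "tgram x y = TSum 7 LN (TMul (tL x 7) (tL y 7))"

text \<open>
  To be integral, the gradient \<open>G\<close> is scaled by \<open>5 M\<^sup>2 Z\<^sup>2\<close>, and \<open>L\<^sup>T G L\<close> by \<open>W = 5 M\<^sup>2 Z\<^sup>4\<close>, where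
  \<open>M\<close> is the sum of the degrees and \<open>Z\<close> the denominator of \<open>L\<close>.
\<close>

definition tgrad :: "int \<Rightarrow> tm" where
  "tgrad lam = TSub (TSub (TMul (TC 5) (TMul (tA 5 6) (TMul tM tZ2)))
      (TMul (TMul (td 5) (td 6)) (TAdd (TMul (TC 2) tZ2) (TMul (TC 6) (tgram 5 6)))))
    (TIf (teq (TV 5) (TV 6)) (TMul (TC (10 * lam)) (TMul (TMul tM tM) (TSub (tgram 5 5) tZ2))) (TC 0))"

definition tW :: tm where
  "tW = TMul (TC 5) (TMul (TMul tM tM) (TMul tZ2 tZ2))"

definition tS :: "int \<Rightarrow> tm" where
  "tS lam = TSum 5 LN (TSum 6 LN (TMul (TMul (tL 5 1) (tgrad lam)) (tL 6 2)))"

text \<open>With \<open>\<mu> = 1 / (c n)\<close> and \<open>\<tau> = 1 / (c n\<^sup>2)\<close>,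
  multiplication by \<open>c n\<^sup>2 W\<close> turns \<open>\<mu>\<close> into \<open>n W\<close>
  and the comparison with \<open>\<tau>\<close> into one with \<open>W\<close>.\<close>

definition tU :: "int \<Rightarrow> int \<Rightarrow> tm" where
  "tU lam c = TAdd (TMul (TC c) (TMul (TMul TN TN) (tS lam))) (TIf (teq (TV 1) (TV 2)) (TMul TN tW) (TC 0))"

definition tq :: "int \<Rightarrow> tm" where
  "tq q = TMul (TC q) (TMul TN (TMul TN TN))"

text \<open>Steps of length \<open>1 / (q n\<^sup>3)\<close> are taken by scaling \<open>L\<close> and its denominator up; the division is exact.\<close>

definition s_move :: "int \<Rightarrow> int \<Rightarrow> st" where
  "s_move q s = SSeq
    (SFor 3 LN (SSeq (SFor 4 LN (SSet 4 (TV 3) (TV 4) (TMul (tq q) (tL 3 4))))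
      (SSet 4 (TV 3) (TV 2) (TAdd (tL 3 2) (TMul (TC s) (TDiv (tL 3 1) (tq q)))))))
    (SSet 6 (TC 0) (TC 0) (TMul (tq q) tZ))"

definition s_step :: "int \<Rightarrow> int \<Rightarrow> int \<Rightarrow> st" where
  "s_step lam c q = SIf (TSub (tU lam c) tW) (s_move q 1)
     (SIf (TSub (TSub (TC 0) (tU lam c)) tW) (s_move q (- 1)) SSkip)"

text \<open>Loop limits are constants or \<open>n\<close>, so \<open>b \<le> a\<close> has to be
  tested, in the form \<open>a + 1 - b > 0\<close>. Variables 1 and 2 hold \<open>a\<close> and
  \<open>b\<close>.\<close>

definition s_sweep :: "int \<Rightarrow> int \<Rightarrow> int \<Rightarrow> st" where
  "s_sweep lam c q = SFor 1 LN (SFor 2 LN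
     (SIf (TSub (TAdd (TV 1) (TC 1)) (TV 2)) (s_step lam c q) SSkip))"

definition s_init :: st where
  "s_init = SSeq (SSet 6 (TC 0) (TC 0) (TC 1))
     (SFor 3 LN (SFor 4 LN (SSet 4 (TV 3) (TV 4) (TIf (teq (TV 3) (TV 4)) (TC 1) (TC 0)))))"

definition s_power :: "nat \<Rightarrow> st \<Rightarrow> st" where
  "s_power k s = SFor 10 LN (SFor 11 LN (SFor 12 LN (SFor 13 LN (SFor 14 LN (SFor 15 (LC k) s)))))"

definition s_solve :: "int \<Rightarrow> int \<Rightarrow> int \<Rightarrow> nat \<Rightarrow> st" where
  "s_solve lam c q k = SSeq s_init (s_power k (s_sweep lam c q))"

lemma wfs_solve: "wfs {4..} {} (s_solve lam c q k)"
  by (simp add: s_solve_def s_power_def s_sweep_def s_step_def s_move_def s_init_def tU_def tS_def tW_def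
      tq_def tgrad_def tgram_def teq_def ok_arr_def)

locale algo =
  fixes n :: nat and A :: "nat \<Rightarrow> nat \<Rightarrow> int" and lam c q :: int
  assumes A_nonneg: "\<And>i j. 0 \<le> A i j" and A_sym: "\<And>i j. A i j = A j i"
    and M_pos: "0 < (\<Sum>i<n. \<Sum>j<n. A i j)"
    and lam: "10 \<le> lam" and c: "1 \<le> c" and q: "100 * lam * c \<le> q"
begin

definition d :: "nat \<Rightarrow> int" where "d i = (\<Sum>j<n. A i j)"
definition M :: int where "M = (\<Sum>i<n. d i)"

lemma M_pos': "0 < M"
  using M_pos by (simp add: M_def d_def)

lemma n_ge_1: "1 \<le> n"
  using M_pos by (cases n) auto

lemma q_pos: "0 < q"
proof -
  have "0 < 100 * lam * c" using lam c by simp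
  then show ?thesis using q by linarith
qed

sublocale weights n "\<lambda>i j. of_int (A i j) / of_int M"
  using A_nonneg A_sym M_pos'
  by unfold_locales (auto simp: dbl_def M_def d_def sum_divide_distrib[symmetric] simp flip: of_int_sum)

lemma p_eq: "p i = of_int (d i) / of_int M"
  by (simp add: p_def d_def sum_divide_distrib)

text \<open>Here \<open>\<tau>\<close> is exactly \<open>\<mu> / n\<close>, and the bound on the
  step length reduces to \<open>100 * lam * c \<le> q\<close>.\<close>

sublocale solver n "\<lambda>i j. of_int (A i j) / of_int M" "real_of_int lam" "1 / (real_of_int c * real n)"
  "1 / (real_of_int c * (real n)\<^sup>2)" "1 / (real_of_int q * real n ^ 3)"
proof unfold_locales
  have c1: "1 \<le> real_of_int c" and n1: "1 \<le> real n" using c n_ge_1 by auto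
  show "10 \<le> real_of_int lam" using lam by simp
  show "1 \<le> n" by (rule n_ge_1)
  show "0 < 1 / (real_of_int c * real n)" using c1 n1 by simp
  show "0 < 1 / (real_of_int c * (real n)\<^sup>2)" using c1 n1 by simp
  show "0 < 1 / (real_of_int q * real n ^ 3)" using n1 q_pos by simp
  show "1 / (real_of_int c * real n) * real n \<le> 1" using c1 n1 by (simp add: field_simps)
  show "real n * (1 / (real_of_int c * (real n)\<^sup>2)) \<le> 1 / (real_of_int c * real n)"
    using c1 n1 by (simp add: field_simps power2_eq_square)
  have "real_of_int (100 * lam * c) \<le> real_of_int q" using q of_int_le_iff by blast
  then have "100 * real_of_int lam * c \<le> q" by simp
  then show "1 / (real_of_int q * real n ^ 3) * (100 * real_of_int lam * real n) \<le> 1 / (real_of_int c * (real n)\<^sup>2)"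
    using c1 n1 q_pos by (simp add: field_simps power2_eq_square power3_eq_cube)
qed

definition data :: "state \<Rightarrow> bool" where
  "data \<sigma> \<longleftrightarrow> (\<forall>i<n. \<forall>j<n. \<sigma> 11 i j = A i j) \<and> (\<forall>i<n. \<sigma> 12 i 0 = d i) \<and> \<sigma> 13 0 0 = M"

lemma data_same_but: "data \<sigma> \<Longrightarrow> same_but X \<sigma> \<tau> \<Longrightarrow> X \<inter> {11,12,13} = {} \<Longrightarrow> data \<tau>"
  by (auto simp: data_def same_but_def)

definition repr :: "(nat \<Rightarrow> nat \<Rightarrow> real) \<Rightarrow> state \<Rightarrow> bool" where
  "repr L \<sigma> \<longleftrightarrow> 0 < \<sigma> 6 0 0 \<and> (\<forall>i<n. \<forall>j<n. of_int (\<sigma> 4 i j) = of_int (\<sigma> 6 0 0) * L i j)"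

lemma repr_init:
  fixes \<sigma> :: state and e :: env
  shows "same_but {4,6} \<sigma> (run n e s_init \<sigma>)" "repr L0 (run n e s_init \<sigma>)"
proof -
  let ?\<sigma> = "\<sigma>(6 := (\<sigma> 6)(0 := (\<sigma> 6 0)(0 := 1)))"
  have "run n e s_init \<sigma> = ?\<sigma>(4 := \<lambda>i j. if i < n \<and> j < n then of_bool (i = j) else ?\<sigma> 4 i j)"
    unfolding s_init_def run.simps(3)
    by (subst run_matrix[where v = "\<lambda>i j. of_bool (i = j)"]) (simp_all add: fun_eq_iff)
  then show "same_but {4,6} \<sigma> (run n e s_init \<sigma>)" "repr L0 (run n e s_init \<sigma>)"
    by (auto simp: same_but_def repr_def L0_def)
qed

lemma tv_gram:
  assumes "repr L \<sigma>" "e x < n" "e y < n" "x \<noteq> 7" "y \<noteq> 7"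
  shows "of_int (tv n e \<sigma> (tgram x y)) = (of_int (\<sigma> 6 0 0))\<^sup>2 * gram n L (e x) (e y)"
proof -
  have "of_int (tv n e \<sigma> (tgram x y)) = (\<Sum>k<n. of_int (\<sigma> 4 (e x) k) * real_of_int (\<sigma> 4 (e y) k))"
    using assms(4,5) by (simp add: tgram_def)
  also have "\<dots> = (\<Sum>k<n. (of_int (\<sigma> 6 0 0))\<^sup>2 * (L (e x) k * L (e y) k))"
    using assms(1-3) by (intro sum.cong) (auto simp: repr_def power2_eq_square mult_ac)
  finally show ?thesis by (simp add: gram_def sum_distrib_left)
qed

lemma tv_grad:
  assumes "data \<sigma>" "repr L \<sigma>" "e 5 < n" "e 6 < n"
  shows "of_int (tv n e \<sigma> (tgrad lam)) = 5 * (of_int M)\<^sup>2 * (of_int (\<sigma> 6 0 0))\<^sup>2 * G (gram n L) (e 5) (e 6)"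
proof -
  define Z where "Z = real_of_int (\<sigma> 6 0 0)"
  have M: "real_of_int M \<noteq> 0" using M_pos' by simp
  have "of_int (tv n e \<sigma> (tgrad lam)) = 5 * (of_int (A (e 5) (e 6)) * (of_int M * (Z * Z))) -
      of_int (d (e 5)) * of_int (d (e 6)) * (2 * (Z * Z) + 6 * of_int (tv n e \<sigma> (tgram 5 6))) -
      (if e 5 = e 6 then 10 * of_int lam * (of_int M * of_int M * (of_int (tv n e \<sigma> (tgram 5 5)) - Z * Z)) else 0)"
    using assms(1,3,4) by (simp add: tgrad_def data_def Z_def)
  also have "\<dots> = 5 * (of_int M)\<^sup>2 * Z\<^sup>2 * G (gram n L) (e 5) (e 6)"
    using M tv_gram[OF assms(2), of e 5 6] tv_gram[OF assms(2), of e 5 5] assms(3,4)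
    by (simp add: G_def p_eq field_simps power2_eq_square flip: Z_def)
  finally show ?thesis by (simp only: Z_def)
qed

lemma tv_W: "data \<sigma> \<Longrightarrow> of_int (tv n e \<sigma> tW) = 5 * (of_int M)\<^sup>2 * real_of_int (\<sigma> 6 0 0) ^ 4"
  by (simp add: tW_def data_def power2_eq_square power4_eq_xxxx)

lemma tv_S:
  assumes "data \<sigma>" "repr L \<sigma>" "e 1 < n" "e 2 < n"
  shows "of_int (tv n e \<sigma> (tS lam)) = 5 * (of_int M)\<^sup>2 * of_int (\<sigma> 6 0 0) ^ 4 * S L (e 1) (e 2)"
proof -
  define Z where "Z = real_of_int (\<sigma> 6 0 0)"
  have "of_int (tv n e \<sigma> (tS lam)) = dbl n (\<lambda>i j. of_int (\<sigma> 4 i (e 1)) * of_int (tv n (e(5 := i, 6 := j)) \<sigma> (tgrad lam)) * of_int (\<sigma> 4 j (e 2)))"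
    by (simp add: tS_def dbl_def)
  also have "\<dots> = dbl n (\<lambda>i j. 5 * (of_int M)\<^sup>2 * Z ^ 4 * (L i (e 1) * G (gram n L) i j * L j (e 2)))"
    using assms(2-4)
    by (intro dbl_cong) (simp add: tv_grad[OF assms(1,2)] repr_def power2_eq_square power4_eq_xxxx mult_ac flip: Z_def)
  finally show ?thesis by (simp only: dbl_cmult S_def Z_def)
qed

lemma tv_U:
  assumes "data \<sigma>" "repr L \<sigma>" "e 1 < n" "e 2 < n"
  shows "of_int (tv n e \<sigma> (tU lam c)) = of_int c * (real n)\<^sup>2 * of_int (tv n e \<sigma> tW) *
    (S L (e 1) (e 2) + (if e 1 = e 2 then 1 / (of_int c * real n) else 0))"
proof -
  have "of_int (tv n e \<sigma> (tU lam c)) = of_int c * ((real n * real n) * of_int (tv n e \<sigma> (tS lam))) +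
      (if e 1 = e 2 then real n * of_int (tv n e \<sigma> tW) else 0)"
    by (simp add: tU_def)
  then show ?thesis
    using c n_ge_1 unfolding tv_S[OF assms] tv_W[OF assms(1)] by (simp add: field_simps power2_eq_square)
qed

lemma repr_move:
  assumes "repr L \<sigma>" "e 1 < n" "e 2 < n" "s \<in> {1, -1}"
  shows "same_but {4,6} \<sigma> (run n e (s_move q s) \<sigma>)"
    "repr (move (of_int s * (1 / (real_of_int q * real n ^ 3))) (e 1) (e 2) L) (run n e (s_move q s) \<sigma>)"
proof -
  define h where "h = q * int n ^ 3"
  have h: "0 < h" using q_pos n_ge_1 by (simp add: h_def)
  have tq: "tv n e' \<tau> (tq q) = h" for e' \<tau> by (simp add: tq_def h_def power3_eq_cube)
  \<comment> \<open>The row has already been overwritten by its multiple, so the old entry is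
    recovered by dividing by \<open>h\<close>.\<close>
  let ?L = "\<lambda>i j. if j = e 2 then h * \<sigma> 4 i (e 2) + s * (h * \<sigma> 4 i (e 1) div h) else h * \<sigma> 4 i j"
  let ?f = "\<lambda>m. \<sigma>(4 := \<lambda>i j. if i < m \<and> (j < n \<or> j = e 2) then ?L i j else \<sigma> 4 i j)"
  let ?row = "SFor 4 LN (SSet 4 (TV 3) (TV 4) (TMul (tq q) (tL 3 4)))"
  let ?set = "SSet 4 (TV 3) (TV 2) (TAdd (tL 3 2) (TMul (TC s) (TDiv (tL 3 1) (tq q))))"
  have "run n e (SFor 3 LN (SSeq ?row ?set)) \<sigma> = ?f n"
    unfolding run.simps(5)[of _ _ 3] ln_of.simps
  proof (rule fold_upt_invariant[where P = "\<lambda>m \<tau>. \<tau> = ?f m"], goal_cases)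
    case (2 i \<tau>)
    have "run n (e(3 := i)) ?row \<tau> = \<tau>(4 := \<lambda>i' j. if i' = i \<and> j < ln_of n LN then h * \<sigma> 4 i j else \<tau> 4 i' j)"
      by (rule run_row) (use 2 in \<open>auto simp: tq\<close>)
    then show ?case
      unfolding run.simps(3) 2 using assms(2,3) by (auto simp: fun_eq_iff less_Suc_eq tq)
  qed (simp add: fun_eq_iff)
  then have run: "run n e (s_move q s) \<sigma> = (?f n)(6 := (\<sigma> 6)(0 := (\<sigma> 6 0)(0 := h * \<sigma> 6 0 0)))"
    unfolding s_move_def run.simps(3) by (simp add: tq)
  show "same_but {4,6} \<sigma> (run n e (s_move q s) \<sigma>)" unfolding run by (simp add: same_but_def)
  have hr: "real_of_int q * real n ^ 3 = of_int h" by (simp add: h_def)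
  show "repr (move (of_int s * (1 / (real_of_int q * real n ^ 3))) (e 1) (e 2) L) (run n e (s_move q s) \<sigma>)"
    unfolding run hr repr_def using assms h by (auto simp: repr_def move_def field_simps)
qed

lemma repr_step:
  assumes "data \<sigma>" "repr L \<sigma>" "e 1 < n" "e 2 < n"
  shows "same_but {4,6} \<sigma> (run n e (s_step lam c q) \<sigma>) \<and> repr (step (e 1) (e 2) L) (run n e (s_step lam c q) \<sigma>)"
proof -
  define W where "W = real_of_int (tv n e \<sigma> tW)"
  define x where "x = S L (e 1) (e 2) + (if e 1 = e 2 then 1 / (of_int c * real n) else 0)"
  have W: "0 < W" using assms(2) M_pos' unfolding W_def tv_W[OF assms(1)] by (simp add: repr_def)
  have cn: "0 < of_int c * (real n)\<^sup>2" using c n_ge_1 by simp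
  have U: "real_of_int (tv n e \<sigma> (tU lam c)) = of_int c * (real n)\<^sup>2 * W * x"
    unfolding tv_U[OF assms] W_def x_def ..
  have "0 < tv n e \<sigma> (TSub (tU lam c) tW) \<longleftrightarrow> W < real_of_int (tv n e \<sigma> (tU lam c))"
    by (simp add: W_def)
  also have "\<dots> \<longleftrightarrow> 1 / (of_int c * (real n)\<^sup>2) < x" unfolding U using W cn by (simp add: field_simps)
  finally have 1: "0 < tv n e \<sigma> (TSub (tU lam c) tW) \<longleftrightarrow> 1 / (of_int c * (real n)\<^sup>2) < x" .
  have "0 < tv n e \<sigma> (TSub (TSub (TC 0) (tU lam c)) tW) \<longleftrightarrow> real_of_int (tv n e \<sigma> (tU lam c)) < - W"
    by (simp add: W_def) linarith
  also have "\<dots> \<longleftrightarrow> x < - (1 / (of_int c * (real n)\<^sup>2))" unfolding U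
    using mult_less_cancel_left_pos[OF W, of "of_int c * (real n)\<^sup>2 * x" "- 1"] cn by (simp add: field_simps)
  finally have 2: "0 < tv n e \<sigma> (TSub (TSub (TC 0) (tU lam c)) tW) \<longleftrightarrow> x < - (1 / (of_int c * (real n)\<^sup>2))" .
  show ?thesis
    unfolding s_step_def run.simps(4) 1 2 step_def x_def[symmetric]
    using repr_move[OF assms(2-4), of 1] repr_move[OF assms(2-4), of "-1"] assms(2) by simp
qed

lemma repr_sweep:
  assumes "data \<sigma>" "repr L \<sigma>"
  shows "same_but {4,6} \<sigma> (run n e (s_sweep lam c q) \<sigma>) \<and> repr (sweep L) (run n e (s_sweep lam c q) \<sigma>)"
proof -
  let ?row = "SFor 2 LN (SIf (TSub (TAdd (TV 1) (TC 1)) (TV 2)) (s_step lam c q) SSkip)"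
  have row: "same_but {4,6} \<sigma> (run n e ?row \<sigma>) \<and> repr (fold (\<lambda>b. step (e 1) b) [0..<Suc (e 1)] L) (run n e ?row \<sigma>)"
    if "data \<sigma>" "repr L \<sigma>" "e 1 < n" for e \<sigma> L
  proof -
    have "same_but {4,6} \<sigma> (run n e ?row \<sigma>) \<and> repr (fold (\<lambda>b. step (e 1) b) [0..<min n (Suc (e 1))] L) (run n e ?row \<sigma>)"
      unfolding run.simps(5) ln_of.simps
    \<comment> \<open>The loop runs up to \<open>n\<close>, whereas \<open>sweep\<close> ends with
      \<open>b = a\<close>; the minimum lets the invariant stand still during the idle
      iterations.\<close>
    proof (rule fold_upt_invariant[where P = "\<lambda>m \<tau>. same_but {4,6} \<sigma> \<tau> \<and> repr (fold (\<lambda>b. step (e 1) b) [0..<min m (Suc (e 1))] L) \<tau>"], goal_cases)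
      case (2 b \<tau>)
      show ?case
      proof (cases "b < Suc (e 1)")
        case True
        have "same_but {4,6} \<tau> (run n (e(2 := b)) (s_step lam c q) \<tau>) \<and>
            repr (step (e 1) b (fold (\<lambda>b. step (e 1) b) [0..<b] L)) (run n (e(2 := b)) (s_step lam c q) \<tau>)"
          using repr_step[of \<tau> "fold (\<lambda>b. step (e 1) b) [0..<b] L" "e(2 := b)"] 2 that True
            data_same_but[OF that(1), of "{4,6}" \<tau>] by (simp add: min_def split: if_splits)
        then show ?thesis using True 2 by (auto simp: min_def intro: same_but_trans)
      next
        case False
        then have "min b (Suc (e 1)) = Suc (e 1)" "min (Suc b) (Suc (e 1)) = Suc (e 1)" by auto
        then show ?thesis using 2 False by (simp only: run.simps tv.simps) simp
      qed
    qed (use that in simp)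
    moreover have "min n (Suc (e 1)) = Suc (e 1)" using that(3) by simp
    ultimately show ?thesis by simp
  qed
  show ?thesis
    unfolding s_sweep_def run.simps(5)[of _ _ 1] ln_of.simps sweep_def
  proof (rule fold_upt_invariant[where P = "\<lambda>m \<tau>. same_but {4,6} \<sigma> \<tau> \<and> repr (fold (\<lambda>a. fold (\<lambda>b. step a b) [0..<Suc a]) [0..<m] L) \<tau>"], goal_cases)
    case (2 a \<tau>)
    then show ?case using row[of \<tau> _ "e(1 := a)"] data_same_but[OF assms(1), of "{4,6}" \<tau>]
      by (auto intro: same_but_trans simp del: run.simps)
  qed (use assms in simp)
qed

end

text \<open>The counter may start anywhere, so the statement can be iterated, and nested loops
  multiply the number of repetitions.\<close>

definition advances :: "nat \<Rightarrow> (nat \<Rightarrow> state \<Rightarrow> bool) \<Rightarrow> st \<Rightarrow> nat \<Rightarrow> bool" where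
  "advances n P s r \<longleftrightarrow> (\<forall>m \<tau> e. P m \<tau> \<longrightarrow> P (m + r) (run n e s \<tau>))"

lemma advances_for: "advances n P s r \<Longrightarrow> advances n P (SFor x l s) (ln_of n l * r)"
  unfolding advances_def run.simps(5)
proof (intro allI impI)
  fix m \<tau> e
  assume "\<forall>m \<tau> e. P m \<tau> \<longrightarrow> P (m + r) (run n e s \<tau>)" "P m \<tau>"
  then show "P (m + ln_of n l * r) (fold (\<lambda>i. run n (e(x := i)) s) [0..<ln_of n l] \<tau>)"
    by (intro fold_upt_invariant[where P = "\<lambda>i. P (m + i * r)"]) (auto simp: add.assoc[symmetric] add.commute[of r])
qed

context algo
begin

lemma repr_solve:
  assumes "data \<sigma>"
  shows "same_but {4,6} \<sigma> (run n e (s_solve lam c q k) \<sigma>) \<and>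
    repr ((sweep ^^ (k * n ^ 5)) L0) (run n e (s_solve lam c q k) \<sigma>)"
proof -
  let ?I = "\<lambda>m \<tau>. same_but {4,6} \<sigma> \<tau> \<and> repr ((sweep ^^ m) L0) \<tau>"
  have "advances n ?I (s_sweep lam c q) 1"
    unfolding advances_def
  proof (intro allI impI)
    fix m \<tau> e assume "?I m \<tau>"
    then show "?I (m + 1) (run n e (s_sweep lam c q) \<tau>)"
      using repr_sweep[of \<tau> "(sweep ^^ m) L0" e] data_same_but[OF assms, of "{4,6}" \<tau>]
      by (auto intro: same_but_trans)
  qed
  then have "advances n ?I (s_power k (s_sweep lam c q)) (k * n ^ 5)"
    unfolding s_power_def
  proof -
    assume "advances n ?I (s_sweep lam c q) 1"
    from advances_for[OF advances_for[OF advances_for[OF advances_for[OF advances_for[OF advances_for[OF this]]]]], of 10 LN 11 LN 12 LN 13 LN 14 LN 15 "LC k"]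
    show "advances n ?I (SFor 10 LN (SFor 11 LN (SFor 12 LN (SFor 13 LN (SFor 14 LN (SFor 15 (LC k) (s_sweep lam c q))))))) (k * n ^ 5)"
      by (simp only: ln_of.simps numeral_eq_Suc pred_numeral_simps power_Suc power_0 BitM.simps) (simp add: mult_ac)
  qed
  moreover have "?I 0 (run n e s_init \<sigma>)" using repr_init by simp
  ultimately have "?I (0 + k * n ^ 5) (run n e (s_power k (s_sweep lam c q)) (run n e s_init \<sigma>))"
    unfolding advances_def by blast
  then show ?thesis unfolding s_solve_def by simp
qed

end

section \<open>The program for the dimension reduction\<close>

type_synonym mtm = "nat \<Rightarrow> nat \<Rightarrow> tm"

definition tgr :: "nat \<Rightarrow> mtm \<Rightarrow> nat \<Rightarrow> nat \<Rightarrow> tm" where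
  "tgr k X x y = TSum 7 (LC k) (TMul (X x 7) (X y 7))"

definition terr :: "nat \<Rightarrow> mtm \<Rightarrow> tm \<Rightarrow> tm" where
  "terr k X ta = TSub (tgr k X 5 6) (TSum 7 LN (TIf (TSub ta (TV 7)) (TMul (tL 5 7) (tL 6 7)) (TC 0)))"

definition ttail :: "tm \<Rightarrow> nat \<Rightarrow> tm" where
  "ttail ta x = TSum 7 LN (TIf (TSub ta (TV 7)) (TC 0) (TMul (tL x 7) (tL x 7)))"

definition tcw :: tm where
  "tcw = TAdd (TAdd (TMul (tA 5 6) tM) (TMul (td 5) (td 6))) (TIf (teq (TV 5) (TV 6)) (TMul (td 5) tM) (TC 0))"

definition tpot :: "nat \<Rightarrow> mtm \<Rightarrow> tm \<Rightarrow> tm" where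
  "tpot k X ta = TSum 5 LN (TSum 6 LN (TMul tcw
     (TAdd (TMul (TC (int k)) (TMul (terr k X ta) (terr k X ta)))
        (TMul (TC 2) (TAdd (TAdd (TMul (tgr k X 5 5) (ttail ta 6)) (TMul (tgr k X 6 6) (ttail ta 5)))
           (TMul (ttail ta 5) (ttail ta 6)))))))"

definition tcur :: mtm where
  "tcur x y = TA 7 (TV x) (TV y)"

text \<open>A candidate is evaluated inside the potential without being stored, so a rejected one
  leaves nothing to undo.\<close>

definition tcand :: "int \<Rightarrow> mtm" where
  "tcand s x y = TAdd (tcur x y) (TIf (teq (TV y) (TV 2)) (TMul (TC s) (tL x 1)) (TC 0))"

text \<open>Cell 8 is set by the first acceptable candidate and blocks the later ones. For integers,
  \<open>1 + old - new > 0\<close> says that the potential does not increase.\<close>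

definition s_bucket :: "nat \<Rightarrow> int \<Rightarrow> st" where
  "s_bucket k s = SIf (TSub (TC 1) (TA 8 (TC 0) (TC 0)))
     (SIf (TAdd (TC 1) (TSub (tpot k tcur (TV 1)) (tpot k (tcand s) (TAdd (TV 1) (TC 1)))))
        (SSeq (SFor 3 LN (SSet 7 (TV 3) (TV 2) (TAdd (tcur 3 2) (TMul (TC s) (tL 3 1)))))
           (SSet 8 (TC 0) (TC 0) (TC 1)))
        SSkip) SSkip"

definition s_reduce :: "nat \<Rightarrow> st" where
  "s_reduce k = SSeq (SFor 3 LN (SFor 4 (LC k) (SSet 7 (TV 3) (TV 4) (TC 0))))
     (SFor 1 LN (SSeq (SSet 8 (TC 0) (TC 0) (TC 0)) (SFor 2 (LC k) (SSeq (s_bucket k 1) (s_bucket k (- 1))))))"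

lemma wft_pot:
  assumes X: "\<And>x y S. {1,2,x,y} \<subseteq> S \<Longrightarrow> wft S (X x y)" and ta: "\<And>S. {1,2} \<subseteq> S \<Longrightarrow> wft S ta"
  shows "wft {1,2} (tpot k X ta)"
proof -
  have "wft {1,2,5,6} (tgr k X x y)" if "x \<in> {5,6}" "y \<in> {5,6}" for x y
    using that by (auto simp: tgr_def intro!: X)
  moreover have "wft {1,2,5,6} (terr k X ta)" "wft {1,2,5,6} (ttail ta 5)" "wft {1,2,5,6} (ttail ta 6)"
    by (auto simp: tgr_def terr_def ttail_def ok_arr_def intro!: X ta)
  moreover have "wft {1,2,5,6} tcw" by (simp add: tcw_def teq_def ok_arr_def)
  moreover have "insert 6 (insert 5 {1,2}) = {1,2,5,6 :: nat}" by auto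
  ultimately show ?thesis unfolding tpot_def by simp
qed

lemma wfs_reduce: "wfs {4..} {} (s_reduce k)"
proof -
  have cur: "wft {1,2} (tpot k tcur (TV 1))"
    by (rule wft_pot) (auto simp: tcur_def ok_arr_def)
  have cand: "wft {1,2} (tpot k (tcand s) (TAdd (TV 1) (TC 1)))" for s
    by (rule wft_pot) (auto simp: tcand_def tcur_def teq_def ok_arr_def)
  have "wfs {4..} {1,2} (s_bucket k s)" for s
    using cur cand[of s] by (simp add: s_bucket_def ok_arr_def tcur_def)
  then show ?thesis by (simp add: s_reduce_def ok_arr_def insert_commute)
qed

lemma pot_cong:
  assumes "\<And>i b. i < n \<Longrightarrow> b < k \<Longrightarrow> S i b = S' i b"
  shows "pot n k c L a S = pot n k c L a S'"
proof -
  have "gram k S i j = gram k S' i j" if "i < n" "j < n" for i j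
    unfolding gram_def using assms that by (intro sum.cong) auto
  then show ?thesis unfolding pot_def pair_pot_def bucket_err_def by (intro dbl_cong) auto
qed

context algo
begin

abbreviation cM :: "nat \<Rightarrow> nat \<Rightarrow> real" where
  "cM i j \<equiv> (of_int M)\<^sup>2 * cw i j"

lemma tv_pot:
  fixes \<sigma> :: state and e :: env and X :: mtm and S :: "nat \<Rightarrow> nat \<Rightarrow> real" and a k :: nat
  defines "L \<equiv> (\<lambda>i j. real_of_int (\<sigma> 4 i j))"
  assumes data: "data \<sigma>" and a: "a \<le> n"
    and X: "\<And>e' x y. e' 1 = e 1 \<Longrightarrow> e' 2 = e 2 \<Longrightarrow> real_of_int (tv n e' \<sigma> (X x y)) = S (e' x) (e' y)"
    and ta: "\<And>e'. e' 1 = e 1 \<Longrightarrow> e' 2 = e 2 \<Longrightarrow> tv n e' \<sigma> ta = int a"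
  shows "real_of_int (tv n e \<sigma> (tpot k X ta)) = pot n k cM L a S"
proof -
  have gr: "real_of_int (tv n e' \<sigma> (tgr k X x y)) = gram k S (e' x) (e' y)"
    if "e' 1 = e 1" "e' 2 = e 2" "x \<noteq> 7" "y \<noteq> 7" for e' x y
    using that by (simp add: tgr_def gram_def X)
  have tl: "real_of_int (tv n e' \<sigma> (ttail ta x)) = tail n L a (e' x)"
    if "e' 1 = e 1" "e' 2 = e 2" "x \<noteq> 7" for e' x
  proof -
    have "real_of_int (tv n e' \<sigma> (ttail ta x)) = (\<Sum>z<n. if z < a then 0 else (L (e' x) z)\<^sup>2)"
      using that by (simp add: ttail_def ta L_def power2_eq_square if_distrib cong: if_cong)
    also have "\<dots> = (\<Sum>z\<in>{a..<n}. (L (e' x) z)\<^sup>2)"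
      by (rule sum.mono_neutral_cong_right) auto
    finally show ?thesis by (simp only: tail_def)
  qed
  have er: "real_of_int (tv n e' \<sigma> (terr k X ta)) = bucket_err k L a S (e' 5) (e' 6)"
    if "e' 1 = e 1" "e' 2 = e 2" for e'
  proof -
    have "real_of_int (tv n e' \<sigma> (terr k X ta)) = gram k S (e' 5) (e' 6) - (\<Sum>z<n. if z < a then L (e' 5) z * L (e' 6) z else 0)"
      using that by (simp add: terr_def ta L_def gr if_distrib cong: if_cong)
    also have "(\<Sum>z<n. if z < a then L (e' 5) z * L (e' 6) z else 0) = (\<Sum>z<a. L (e' 5) z * L (e' 6) z)"
      by (rule sum.mono_neutral_cong_right) (use a in auto)
    finally show ?thesis by (simp only: bucket_err_def gram_def)
  qed
  have cw: "real_of_int (tv n e' \<sigma> tcw) = cM (e' 5) (e' 6)" if "e' 5 < n" "e' 6 < n" for e'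
    using data that M_pos' by (simp add: tcw_def data_def cw_def p_eq field_simps power2_eq_square)
  show ?thesis
    unfolding pot_def dbl_def pair_pot_def
    by (simp add: tpot_def gr tl er cw power2_eq_square)
qed

text \<open>While the flag is 0, all candidates in \<open>X\<close> have failed at the same matrix.
  Once all \<open>2 * k\<close> of them are tried, \<open>pot_choice\<close> excludes this case, so
  one has been accepted.\<close>

definition tried :: "nat \<Rightarrow> state \<Rightarrow> nat \<Rightarrow> (nat \<times> int) set \<Rightarrow> state \<Rightarrow> bool" where
  "tried k \<sigma> a X \<tau> \<longleftrightarrow> same_but {7,8} \<sigma> \<tau> \<and>
    (let L = \<lambda>i j. real_of_int (\<sigma> 4 i j); S = \<lambda>i b. real_of_int (\<sigma> 7 i b) in
     if \<tau> 8 0 0 = 0 then \<tau> 7 = \<sigma> 7 \<and>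
       (\<forall>(b,s)\<in>X. \<not> pot n k cM L (Suc a) (bucket_add L a b (of_int s) S) \<le> pot n k cM L a S)
     else \<tau> 8 0 0 = 1 \<and> pot n k cM L (Suc a) (\<lambda>i b. real_of_int (\<tau> 7 i b)) \<le> pot n k cM L a S)"

lemma tried_bucket:
  assumes "data \<sigma>" "tried k \<sigma> a X \<tau>" "e 1 = a" "e 2 = b" "a < n"
  shows "tried k \<sigma> a (insert (b, s) X) (run n e (s_bucket k s) \<tau>)"
proof (cases "\<tau> 8 0 0 = 0")
  case False
  then show ?thesis using assms(2) by (simp add: s_bucket_def tried_def Let_def)
next
  case True
  define L where "L = (\<lambda>i j. real_of_int (\<sigma> 4 i j))"
  define S where "S = (\<lambda>i b. real_of_int (\<sigma> 7 i b))"
  have same: "same_but {7,8} \<sigma> \<tau>" "\<tau> 7 = \<sigma> 7" "\<tau> 4 = \<sigma> 4"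
    using assms(2) True by (simp_all add: tried_def same_but_def Let_def)
  have data: "data \<tau>" using data_same_but[OF assms(1) same(1)] by simp
  have cur: "real_of_int (tv n e \<tau> (tpot k tcur (TV 1))) = pot n k cM L a S"
    using tv_pot[OF data, of a e tcur S "TV 1" k] assms(3,5) by (simp add: tcur_def S_def L_def same)
  have cand: "real_of_int (tv n e \<tau> (tpot k (tcand s) (TAdd (TV 1) (TC 1)))) = pot n k cM L (Suc a) (bucket_add L a b (of_int s) S)"
  proof -
    have X: "real_of_int (tv n e' \<tau> (tcand s x y)) = bucket_add L a b (of_int s) S (e' x) (e' y)"
      if "e' 1 = e 1" "e' 2 = e 2" for e' x y
      using that assms(3,4) by (simp add: tcand_def tcur_def S_def L_def same bucket_add_def)
    have ta: "tv n e' \<tau> (TAdd (TV 1) (TC 1)) = int (Suc a)" if "e' 1 = e 1" "e' 2 = e 2" for e'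
      using that assms(3) by simp
    note pot = tv_pot[OF data, where a = "Suc a" and e = e and X = "tcand s" and k = k and
        S = "bucket_add L a b (of_int s) S" and ta = "TAdd (TV 1) (TC 1)"]
    have "Suc a \<le> n" using assms(5) by simp
    from pot[OF this X ta] show ?thesis unfolding same(3) L_def[symmetric] .
  qed
  have test: "0 < tv n e \<tau> (TAdd (TC 1) (TSub (tpot k tcur (TV 1)) (tpot k (tcand s) (TAdd (TV 1) (TC 1))))) \<longleftrightarrow>
      pot n k cM L (Suc a) (bucket_add L a b (of_int s) S) \<le> pot n k cM L a S"
    unfolding cur[symmetric] cand[symmetric] by (simp only: of_int_le_iff tv.simps) linarith
  have run: "run n e (s_bucket k s) \<tau> = (if pot n k cM L (Suc a) (bucket_add L a b (of_int s) S) \<le> pot n k cM L a S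
      then run n e (SSeq (SFor 3 LN (SSet 7 (TV 3) (TV 2) (TAdd (tcur 3 2) (TMul (TC s) (tL 3 1)))))
           (SSet 8 (TC 0) (TC 0) (TC 1))) \<tau> else \<tau>)"
    unfolding s_bucket_def run.simps(4) test using True by simp
  show ?thesis
  proof (cases "pot n k cM L (Suc a) (bucket_add L a b (of_int s) S) \<le> pot n k cM L a S")
    case False
    then show ?thesis using run assms(2) True by (simp add: tried_def Let_def L_def S_def)
  next
    case le: True
    let ?f = "\<lambda>i b'. if i < ln_of n LN \<and> b' = b then \<tau> 7 i b + s * \<tau> 4 i a else \<tau> 7 i b'"
    have "run n e (SFor 3 LN (SSet 7 (TV 3) (TV 2) (TAdd (tcur 3 2) (TMul (TC s) (tL 3 1))))) \<tau> = \<tau>(7 := ?f)"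
      by (rule run_column) (use assms(3,4) in \<open>auto simp: tcur_def\<close>)
    then have "run n e (s_bucket k s) \<tau> = \<tau>(7 := ?f, 8 := (\<tau> 8)(0 := (\<tau> 8 0)(0 := 1)))"
      unfolding run using le by (simp add: fun_eq_iff)
    moreover have "pot n k cM L (Suc a) (\<lambda>i b'. real_of_int (?f i b')) = pot n k cM L (Suc a) (bucket_add L a b (of_int s) S)"
      by (rule pot_cong) (auto simp: bucket_add_def L_def S_def same)
    ultimately show ?thesis using le same(1) by (simp add: tried_def Let_def same_but_def L_def S_def)
  qed
qed

lemma reduce_correct:
  fixes \<sigma> \<tau> :: state and e :: env and L S :: "nat \<Rightarrow> nat \<Rightarrow> real" and k :: nat
  assumes "data \<sigma>" "0 < k"
  defines "\<tau> \<equiv> run n e (s_reduce k) \<sigma>"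
  defines "L \<equiv> \<lambda>i j. real_of_int (\<sigma> 4 i j)" and "S \<equiv> \<lambda>i b. real_of_int (\<tau> 7 i b)"
  shows "same_but {7,8} \<sigma> \<tau> \<and> pot n k cM L n S \<le> pot n k cM L 0 (\<lambda>_ _. 0)"
  unfolding S_def
proof -
  let ?S = "\<lambda>\<tau> i b. real_of_int (\<tau> 7 i b)"
  let ?I = "\<lambda>a \<tau>. same_but {7,8} \<sigma> \<tau> \<and> pot n k cM L a (?S \<tau>) \<le> pot n k cM L 0 (\<lambda>_ _. 0)"
  define \<rho> where "\<rho> = run n e (SFor 3 LN (SFor 4 (LC k) (SSet 7 (TV 3) (TV 4) (TC 0)))) \<sigma>"
  have \<rho>: "\<rho> = \<sigma>(7 := \<lambda>i j. if i < ln_of n LN \<and> j < ln_of n (LC k) then 0 else \<sigma> 7 i j)"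
    unfolding \<rho>_def by (rule run_matrix) auto
  have "pot n k cM L 0 (?S \<rho>) = pot n k cM L 0 (\<lambda>_ _. 0)"
    by (rule pot_cong) (simp add: \<rho>)
  then have init: "?I 0 \<rho>" by (simp add: \<rho> same_but_def)
  have step: "?I (Suc a) (run n (e(1 := a)) (SSeq (SSet 8 (TC 0) (TC 0) (TC 0))
      (SFor 2 (LC k) (SSeq (s_bucket k 1) (s_bucket k (- 1))))) \<tau>)"
    if "?I a \<tau>" "a < n" for a \<tau>
  proof -
    define \<tau>0 where "\<tau>0 = \<tau>(8 := (\<tau> 8)(0 := (\<tau> 8 0)(0 := 0)))"
    define \<tau>1 where "\<tau>1 = run n (e(1 := a)) (SFor 2 (LC k) (SSeq (s_bucket k 1) (s_bucket k (- 1)))) \<tau>0"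
    have s0: "same_but {7,8} \<sigma> \<tau>0" using that(1) by (simp add: \<tau>0_def same_but_def)
    have data: "data \<tau>0" using data_same_but[OF assms(1) s0] by simp
    have t0: "tried k \<tau>0 a {} \<tau>0" by (simp add: tried_def Let_def) (simp add: \<tau>0_def)
    have "tried k \<tau>0 a ({..<k} \<times> {1, -1}) \<tau>1"
      unfolding \<tau>1_def run.simps(5) ln_of.simps
    proof (rule fold_upt_invariant[where P = "\<lambda>b \<tau>. tried k \<tau>0 a ({..<b} \<times> {1, -1}) \<tau>"], goal_cases)
      case (2 b \<tau>)
      have "{..<Suc b} \<times> {1, -1} = insert (b, -1) (insert (b, 1 :: int) ({..<b} \<times> {1, -1}))" by auto
      then show ?case
        using tried_bucket[OF data tried_bucket[OF data 2(2), of "e(1 := a, 2 := b)" b 1], of "e(1 := a, 2 := b)" b "-1"] that(2)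
        by simp
    qed (use t0 in simp)
    moreover have "(\<lambda>i j. real_of_int (\<tau>0 4 i j)) = L" using s0 by (simp add: L_def same_but_def)
    moreover have "0 \<le> cM i j" for i j by (simp add: cw_nonneg)
    from pot_choice[of cM a n k L "?S \<tau>0", OF this that(2) assms(2)]
    have "\<exists>b<k. \<exists>s\<in>{1, -1 :: int}. pot n k cM L (Suc a) (bucket_add L a b (of_int s) (?S \<tau>0)) \<le> pot n k cM L a (?S \<tau>0)"
      by auto
    ultimately have "same_but {7,8} \<tau>0 \<tau>1" "pot n k cM L (Suc a) (?S \<tau>1) \<le> pot n k cM L a (?S \<tau>0)"
      unfolding tried_def Let_def by (auto split: if_splits)
    moreover have "?S \<tau>0 = ?S \<tau>" by (simp add: \<tau>0_def)
    ultimately show ?thesis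
      using that s0 unfolding run.simps(3) by (auto simp: \<tau>1_def \<tau>0_def intro: same_but_trans simp del: run.simps(5))
  qed
  show "same_but {7,8} \<sigma> \<tau> \<and> pot n k cM L n (?S \<tau>) \<le> pot n k cM L 0 (\<lambda>_ _. 0)"
    unfolding \<tau>_def s_reduce_def run.simps(3) \<rho>_def[symmetric] run.simps(5)[of _ _ 1] ln_of.simps
    by (rule fold_upt_invariant[where P = ?I]) (use init step in \<open>auto simp only: run.simps(3)\<close>)
qed

end

section \<open>The program for the rounding\<close>

definition tdot :: "nat \<Rightarrow> nat \<Rightarrow> (nat \<Rightarrow> int) \<Rightarrow> tm" where
  "tdot k x \<gamma> = foldr (\<lambda>b t. TAdd (TMul (TC (\<gamma> b)) (TA 7 (TV x) (TC (int b)))) t) [0..<k] (TC 0)"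

text \<open>One bit per hyperplane, so that two labels are equal just when all three hyperplanes
  agree on the two vertices.\<close>

definition tlabel :: "nat \<Rightarrow> nat \<Rightarrow> (nat \<Rightarrow> int) \<times> (nat \<Rightarrow> int) \<times> (nat \<Rightarrow> int) \<Rightarrow> tm" where
  "tlabel k x = (\<lambda>(\<gamma>1, \<gamma>2, \<gamma>3). TAdd (TIf (tdot k x \<gamma>1) (TC 4) (TC 0))
     (TAdd (TIf (tdot k x \<gamma>2) (TC 2) (TC 0)) (TIf (tdot k x \<gamma>3) (TC 1) (TC 0))))"

definition tQ :: "nat \<Rightarrow> tm" where
  "tQ a = TSum 5 LN (TSum 6 LN (TIf (teq (TA a (TV 5) (TC 0)) (TA a (TV 6) (TC 0)))
     (TSub (TMul (tA 5 6) tM) (TMul (td 5) (td 6))) (TC 0)))"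

definition s_improve :: "nat \<Rightarrow> (nat \<Rightarrow> int) \<times> (nat \<Rightarrow> int) \<times> (nat \<Rightarrow> int) \<Rightarrow> st" where
  "s_improve k g = SSeq (SFor 3 LN (SSet 9 (TV 3) (TC 0) (tlabel k 3 g)))
     (SIf (TSub (tQ 9) (tQ 10)) (SFor 3 LN (SSet 10 (TV 3) (TC 0) (TA 9 (TV 3) (TC 0)))) SSkip)"

text \<open>The triples are unrolled into the program text, like the coefficients in
  \<open>tdot\<close>: both are constants, independent of the graph.\<close>

definition s_round :: "nat \<Rightarrow> ((nat \<Rightarrow> int) \<times> (nat \<Rightarrow> int) \<times> (nat \<Rightarrow> int)) list \<Rightarrow> st" where
  "s_round k gs = foldr (\<lambda>g s. SSeq (s_improve k g) s) gs SSkip"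

lemma wfs_round: "wfs {4..} {} (s_round k gs)"
proof -
  have dot: "wft X (tdot k x \<gamma>)" if "x \<in> X" for X x \<gamma>
  proof -
    have "wft X (foldr (\<lambda>b t. TAdd (TMul (TC (\<gamma> b)) (TA 7 (TV x) (TC (int b)))) t) bs (TC 0))" for bs
      using that by (induction bs) (simp_all add: ok_arr_def)
    then show ?thesis by (simp add: tdot_def)
  qed
  have "wfs {4..} {} (s_improve k g)" for g
    by (cases g) (simp add: s_improve_def tQ_def tlabel_def teq_def ok_arr_def dot)
  then show ?thesis unfolding s_round_def by (induction gs) simp_all
qed

lemma tv_dot: "tv n e \<sigma> (tdot k x \<gamma>) = (\<Sum>b<k. \<gamma> b * \<sigma> 7 (e x) b)"
proof -
  have "tv n e \<sigma> (foldr (\<lambda>b t. TAdd (TMul (TC (\<gamma> b)) (TA 7 (TV x) (TC (int b)))) t) bs (TC 0)) =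
      (\<Sum>b\<leftarrow>bs. \<gamma> b * \<sigma> 7 (e x) b)" for bs
    by (induction bs) simp_all
  then show ?thesis by (simp add: tdot_def interv_sum_list_conv_sum_set_nat atLeast0LessThan)
qed

context algo
begin

definition labelling_quality :: "(nat \<Rightarrow> 'a) \<Rightarrow> real" where
  "labelling_quality f = dbl n (\<lambda>i j. (of_int (A i j) / of_int M - p i * p j) * of_bool (f i = f j))"

lemma tv_Q:
  assumes "data \<sigma>"
  shows "real_of_int (tv n e \<sigma> (tQ a)) = (of_int M)\<^sup>2 * labelling_quality (\<lambda>i. \<sigma> a i 0)"
proof -
  have "real_of_int (tv n e \<sigma> (tQ a)) = dbl n (\<lambda>i j. if \<sigma> a i 0 = \<sigma> a j 0 then of_int (A i j) * of_int M - of_int (d i) * of_int (d j) else 0)"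
    unfolding dbl_def using assms by (simp add: tQ_def data_def if_distrib cong: if_cong)
  also have "\<dots> = dbl n (\<lambda>i j. (of_int M)\<^sup>2 * ((of_int (A i j) / of_int M - p i * p j) * of_bool (\<sigma> a i 0 = \<sigma> a j 0)))"
    using M_pos' by (intro dbl_cong) (simp add: p_eq field_simps power2_eq_square)
  finally show ?thesis by (simp only: dbl_cmult labelling_quality_def)
qed

lemma improve_correct:
  fixes \<sigma> \<tau> :: state and e :: env and k :: nat and \<gamma>1 \<gamma>2 \<gamma>3 :: "nat \<Rightarrow> int"
  assumes "data \<sigma>"
  defines "\<tau> \<equiv> run n e (s_improve k (\<gamma>1, \<gamma>2, \<gamma>3)) \<sigma>"
  shows "same_but {9,10} \<sigma> \<tau> \<and> quality k (\<lambda>i b. real_of_int (\<sigma> 7 i b)) \<gamma>1 \<gamma>2 \<gamma>3 \<le> labelling_quality (\<lambda>i. \<tau> 10 i 0) \<and>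
    labelling_quality (\<lambda>i. \<sigma> 10 i 0) \<le> labelling_quality (\<lambda>i. \<tau> 10 i 0)"
proof -
  let ?S = "\<lambda>i b. real_of_int (\<sigma> 7 i b)"
  let ?f = "\<lambda>i. 4 * of_bool (hpos k \<gamma>1 (?S i)) + (2 * of_bool (hpos k \<gamma>2 (?S i)) + of_bool (hpos k \<gamma>3 (?S i))) :: int"
  define \<rho> where "\<rho> = \<sigma>(9 := \<lambda>i j. if i < ln_of n LN \<and> j = 0 then ?f i else \<sigma> 9 i j)"
  have hp: "0 < (\<Sum>b<k. \<gamma> b * \<sigma> 7 i b) \<longleftrightarrow> hpos k \<gamma> (?S i)" for \<gamma> i
    unfolding hpos_def by (simp only: of_int_mult[symmetric] of_int_sum[symmetric] of_int_0_less_iff)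
  have 1: "run n e (SFor 3 LN (SSet 9 (TV 3) (TC 0) (tlabel k 3 (\<gamma>1, \<gamma>2, \<gamma>3)))) \<sigma> = \<rho>"
    unfolding \<rho>_def by (rule run_column) (auto simp: tlabel_def tv_dot hp)
  have s\<rho>: "same_but {9,10} \<sigma> \<rho>" by (simp add: \<rho>_def same_but_def)
  have data: "data \<rho>" using data_same_but[OF assms(1) s\<rho>] by simp
  have q\<rho>: "labelling_quality (\<lambda>i. \<rho> 9 i 0) = quality k ?S \<gamma>1 \<gamma>2 \<gamma>3"
    unfolding labelling_quality_def quality_def
    by (intro dbl_cong arg_cong[where f = "(*) _"]) (simp add: \<rho>_def agree_def)
  have M2: "0 < (real_of_int M)\<^sup>2" using M_pos' by simp
  have "0 < tv n e \<rho> (TSub (tQ 9) (tQ 10)) \<longleftrightarrow> real_of_int (tv n e \<rho> (tQ 10)) < real_of_int (tv n e \<rho> (tQ 9))"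
    by simp
  also have "\<dots> \<longleftrightarrow> labelling_quality (\<lambda>i. \<rho> 10 i 0) < labelling_quality (\<lambda>i. \<rho> 9 i 0)"
    unfolding tv_Q[OF data] using M2 by simp
  finally have test: "0 < tv n e \<rho> (TSub (tQ 9) (tQ 10)) \<longleftrightarrow> labelling_quality (\<lambda>i. \<rho> 10 i 0) < labelling_quality (\<lambda>i. \<rho> 9 i 0)" .
  let ?\<rho>' = "\<rho>(10 := \<lambda>i j. if i < ln_of n LN \<and> j = 0 then \<rho> 9 i 0 else \<rho> 10 i j)"
  have 2: "run n e (SFor 3 LN (SSet 10 (TV 3) (TC 0) (TA 9 (TV 3) (TC 0)))) \<rho> = ?\<rho>'"
    by (rule run_column) auto
  have \<tau>: "\<tau> = (if labelling_quality (\<lambda>i. \<rho> 10 i 0) < labelling_quality (\<lambda>i. \<rho> 9 i 0) then ?\<rho>' else \<rho>)"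
    unfolding \<tau>_def s_improve_def run.simps(3,4) 1 test 2 by simp
  have "labelling_quality (\<lambda>i. ?\<rho>' 10 i 0) = labelling_quality (\<lambda>i. \<rho> 9 i 0)"
    unfolding labelling_quality_def by (rule dbl_cong) simp
  moreover have "\<rho> 10 = \<sigma> 10" by (simp add: \<rho>_def)
  moreover have "same_but {9,10} \<sigma> \<tau>" using s\<rho> by (simp add: \<tau> same_but_def)
  ultimately show ?thesis using q\<rho> by (simp add: \<tau>)
qed

text \<open>The stored labelling never gets worse, so it is enough that the triple is tried once.
  The initial contents of array 10 form a labelling like any other.\<close>

lemma round_correct:
  assumes "data \<sigma>" "(\<gamma>1, \<gamma>2, \<gamma>3) \<in> set gs"
  shows "quality k (\<lambda>i b. real_of_int (\<sigma> 7 i b)) \<gamma>1 \<gamma>2 \<gamma>3 \<le> labelling_quality (\<lambda>i. run n e (s_round k gs) \<sigma> 10 i 0)"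
proof -
  have mono: "labelling_quality (\<lambda>i. \<sigma> 10 i 0) \<le> labelling_quality (\<lambda>i. run n e (s_round k gs) \<sigma> 10 i 0)"
    if "data \<sigma>" for gs \<sigma>
    using that
  proof (induction gs arbitrary: \<sigma>)
    case (Cons g gs)
    obtain \<gamma>1 \<gamma>2 \<gamma>3 where g: "g = (\<gamma>1, \<gamma>2, \<gamma>3)" by (cases g)
    note imp = improve_correct[OF Cons.prems, of e k \<gamma>1 \<gamma>2 \<gamma>3, folded g]
    then have "data (run n e (s_improve k g) \<sigma>)" using data_same_but[OF Cons.prems, of "{9,10}"] by simp
    from Cons.IH[OF this] imp show ?case by (simp add: s_round_def)
  qed (simp add: s_round_def)
  show ?thesis
    using assms
  proof (induction gs arbitrary: \<sigma>)
    case (Cons g gs)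
    obtain \<delta>1 \<delta>2 \<delta>3 where g: "g = (\<delta>1, \<delta>2, \<delta>3)" by (cases g)
    note imp = improve_correct[OF Cons.prems(1), of e k \<delta>1 \<delta>2 \<delta>3, folded g]
    define \<tau> where "\<tau> = run n e (s_improve k g) \<sigma>"
    have s: "same_but {9,10} \<sigma> \<tau>" using imp by (simp add: \<tau>_def)
    have data: "data \<tau>" using data_same_but[OF Cons.prems(1) s] by simp
    have run: "run n e (s_round k (g # gs)) \<sigma> = run n e (s_round k gs) \<tau>" by (simp add: s_round_def \<tau>_def)
    show ?case
    proof (cases "(\<gamma>1, \<gamma>2, \<gamma>3) = g")
      case True
      then show ?thesis using imp mono[OF data, of gs] g unfolding run \<tau>_def by auto
    next
      case False
      then have "(\<gamma>1, \<gamma>2, \<gamma>3) \<in> set gs" using Cons.prems(2) by simp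
      from Cons.IH[OF data this] show ?thesis using s unfolding run by (simp add: same_but_def)
    qed
  qed simp
qed

end

section \<open>Reading the input\<close>

definition tnum :: "nat \<Rightarrow> nat \<Rightarrow> tm" where
  "tnum x y = TA 0 (TAdd (TC 1) (TMul (TC 2) (TAdd (TMul (TV x) TN) (TV y)))) (TC 0)"

definition tden :: "nat \<Rightarrow> nat \<Rightarrow> tm" where
  "tden x y = TA 0 (TAdd (TC 2) (TMul (TC 2) (TAdd (TMul (TV x) TN) (TV y)))) (TC 0)"

text \<open>Modularity does not change when all weights are multiplied by a common factor. So the
  adjacency matrix is made integral by the product of all denominators, whose bit length is at most
  the sum of theirs.\<close>

definition s_load :: st where
  "s_load = SSeq (SSet 5 (TC 0) (TC 0) (TC 1))
    (SSeq (SFor 3 LN (SFor 4 LN (SSet 5 (TC 0) (TC 0) (TMul (TA 5 (TC 0) (TC 0)) (tden 3 4)))))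
    (SSeq (SFor 3 LN (SFor 4 LN (SSet 11 (TV 3) (TV 4) (TDiv (TMul (tnum 3 4) (TA 5 (TC 0) (TC 0))) (tden 3 4)))))
    (SSeq (SFor 3 LN (SSet 12 (TV 3) (TC 0) (TSum 5 LN (tA 3 5))))
      (SSet 13 (TC 0) (TC 0) (TSum 5 LN (td 5))))))"

lemma wfs_load: "wfs {4..} {} s_load"
  by (simp add: s_load_def tnum_def tden_def ok_arr_def)

definition is_input :: "nat \<Rightarrow> (nat \<Rightarrow> nat \<Rightarrow> int) \<Rightarrow> (nat \<Rightarrow> nat \<Rightarrow> int) \<Rightarrow> state \<Rightarrow> bool" where
  "is_input n num den \<sigma> \<longleftrightarrow> (\<forall>i<n. \<forall>j<n. \<sigma> 0 (1 + 2 * (i * n + j)) 0 = num i j \<and> \<sigma> 0 (2 + 2 * (i * n + j)) 0 = den i j)"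

lemma tv_input:
  assumes "is_input n num den \<sigma>" "e x < n" "e y < n"
  shows "tv n e \<sigma> (tnum x y) = num (e x) (e y)" "tv n e \<sigma> (tden x y) = den (e x) (e y)"
proof -
  have "nat (1 + 2 * (int (e x) * int n + int (e y))) = 1 + 2 * (e x * n + e y)"
    "nat (2 + 2 * (int (e x) * int n + int (e y))) = 2 + 2 * (e x * n + e y)"
    by (simp_all add: nat_add_distrib nat_mult_distrib)
  then show "tv n e \<sigma> (tnum x y) = num (e x) (e y)" "tv n e \<sigma> (tden x y) = den (e x) (e y)"
    using assms unfolding tnum_def tden_def is_input_def by simp_all
qed

lemma run_prod:
  assumes "is_input n num den \<sigma>" "\<sigma> 5 0 0 = 1"
  shows "run n e (SFor 3 LN (SFor 4 LN (SSet 5 (TC 0) (TC 0) (TMul (TA 5 (TC 0) (TC 0)) (tden 3 4))))) \<sigma> =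
    \<sigma>(5 := (\<sigma> 5)(0 := (\<sigma> 5 0)(0 := \<Prod>i<n. \<Prod>j<n. den i j)))"
proof -
  let ?s = "SSet 5 (TC 0) (TC 0) (TMul (TA 5 (TC 0) (TC 0)) (tden 3 4))"
  let ?u = "\<lambda>v. \<sigma>(5 := (\<sigma> 5)(0 := (\<sigma> 5 0)(0 := v)))"
  have inp: "is_input n num den (?u v)" for v using assms(1) by (simp add: is_input_def)
  have inner: "run n (e(3 := i)) (SFor 4 LN ?s) (?u v) = ?u (v * (\<Prod>j<n. den i j))" if "i < n" for i v
    unfolding run.simps(5) ln_of.simps
  proof (rule fold_upt_invariant[where P = "\<lambda>j \<tau>. \<tau> = ?u (v * (\<Prod>j'<j. den i j'))"], goal_cases)
    case (2 j \<tau>)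
    then show ?case using tv_input(2)[OF inp, of "e(3 := i, 4 := j)" 3 4] that by (simp add: mult_ac)
  qed simp
  show ?thesis
    unfolding run.simps(5)[of _ _ 3] ln_of.simps
  proof (rule fold_upt_invariant[where P = "\<lambda>i \<tau>. \<tau> = ?u (\<Prod>i'<i. \<Prod>j<n. den i' j)"], goal_cases)
    case 1
    show ?case using assms(2) by (simp add: fun_eq_iff)
  next
    case (2 i \<tau>)
    then show ?case using inner by simp
  qed
qed

lemma run_load:
  fixes num den A :: "nat \<Rightarrow> nat \<Rightarrow> int" and \<sigma> \<tau> :: state and e :: env and n :: nat
  assumes inp: "is_input n num den \<sigma>"
    and A: "\<And>i j. i < n \<Longrightarrow> j < n \<Longrightarrow> A i j = num i j * (\<Prod>i<n. \<Prod>j<n. den i j) div den i j"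
  defines "\<tau> \<equiv> run n e s_load \<sigma>"
  shows "(\<forall>i<n. \<forall>j<n. \<tau> 11 i j = A i j) \<and> (\<forall>i<n. \<tau> 12 i 0 = (\<Sum>j<n. A i j)) \<and> \<tau> 13 0 0 = (\<Sum>i<n. \<Sum>j<n. A i j)"
proof -
  let ?D = "\<Prod>i<n. \<Prod>j<n. den i j"
  let ?\<sigma> = "\<sigma>(5 := (\<sigma> 5)(0 := (\<sigma> 5 0)(0 := 1)))"
  let ?\<sigma>1 = "?\<sigma>(5 := (?\<sigma> 5)(0 := (?\<sigma> 5 0)(0 := ?D)))"
  have 0: "is_input n num den ?\<sigma>" using inp by (simp add: is_input_def)
  have 1: "run n e (SSet 5 (TC 0) (TC 0) (TC 1)) \<sigma> = ?\<sigma>" by simp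
  have 1: "run n e (SFor 3 LN (SFor 4 LN (SSet 5 (TC 0) (TC 0) (TMul (TA 5 (TC 0) (TC 0)) (tden 3 4))))) (run n e (SSet 5 (TC 0) (TC 0) (TC 1)) \<sigma>) = ?\<sigma>1"
    unfolding 1 by (rule run_prod[OF 0]) simp
  have inp1: "is_input n num den (?\<sigma>1(11 := f))" for f using inp by (simp add: is_input_def)
  let ?\<sigma>2 = "?\<sigma>1(11 := \<lambda>i j. if i < ln_of n LN \<and> j < ln_of n LN then A i j else ?\<sigma>1 11 i j)"
  have 2: "run n e (SFor 3 LN (SFor 4 LN (SSet 11 (TV 3) (TV 4) (TDiv (TMul (tnum 3 4) (TA 5 (TC 0) (TC 0))) (tden 3 4))))) ?\<sigma>1 = ?\<sigma>2"
  proof (rule run_matrix)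
    fix i j f assume "i < ln_of n LN" "j < ln_of n LN"
    then show "tv n (e(3 := i, 4 := j)) (?\<sigma>1(11 := f)) (TDiv (TMul (tnum 3 4) (TA 5 (TC 0) (TC 0))) (tden 3 4)) = A i j"
      using A[of i j] tv_input[OF inp1, of "e(3 := i, 4 := j)" 3 4 f] by simp
  qed simp
  let ?\<sigma>3 = "?\<sigma>2(12 := \<lambda>i j. if i < ln_of n LN \<and> j = 0 then (\<Sum>j<n. A i j) else ?\<sigma>2 12 i j)"
  have 3: "run n e (SFor 3 LN (SSet 12 (TV 3) (TC 0) (TSum 5 LN (tA 3 5)))) ?\<sigma>2 = ?\<sigma>3"
    by (rule run_column) auto
  have 4: "run n e (SSet 13 (TC 0) (TC 0) (TSum 5 LN (td 5))) ?\<sigma>3 = ?\<sigma>3(13 := (?\<sigma>3 13)(0 := (?\<sigma>3 13 0)(0 := \<Sum>i<n. \<Sum>j<n. A i j)))"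
    by simp
  have "\<tau> = ?\<sigma>3(13 := (?\<sigma>3 13)(0 := (?\<sigma>3 13 0)(0 := \<Sum>i<n. \<Sum>j<n. A i j)))"
    unfolding \<tau>_def s_load_def run.simps(3) 1 2 3 4 ..
  then show ?thesis by simp
qed

section \<open>The complete algorithm and its error budget\<close>

definition s_main :: "int \<Rightarrow> int \<Rightarrow> int \<Rightarrow> nat \<Rightarrow> nat \<Rightarrow> ((nat \<Rightarrow> int) \<times> (nat \<Rightarrow> int) \<times> (nat \<Rightarrow> int)) list \<Rightarrow> st" where
  "s_main lam c q T k gs = SSeq s_load (SSeq (s_solve lam c q T) (SSeq (s_reduce k) (s_round k gs)))"

lemma wfs_main: "wfs {4..} {} (s_main lam c q T k gs)"
  by (simp add: s_main_def wfs_load wfs_solve wfs_reduce wfs_round)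

context algo
begin

lemma labelling_quality_R: "labelling_quality f = R (\<lambda>i j. of_bool (f i = f j))"
proof -
  have "phi (of_bool P) = of_bool P" for P by (simp add: phi_def)
  then show ?thesis
    unfolding labelling_quality_def R_def dbl_diff[symmetric] by (simp add: left_diff_distrib)
qed

lemma labelling_quality_le_1: "labelling_quality f \<le> 1"
proof -
  have "labelling_quality f \<le> dbl n (\<lambda>i j. of_int (A i j) / of_int M)"
    unfolding labelling_quality_def
  proof (rule dbl_mono)
    fix i j
    have "0 \<le> real_of_int (A i j) / real_of_int M" "0 \<le> p i * p j" by (rule w_nonneg) (simp add: p_nonneg)
    then show "(real_of_int (A i j) / real_of_int M - p i * p j) * of_bool (f i = f j) \<le> real_of_int (A i j) / real_of_int M"
      by auto
  qed
  then show ?thesis by (simp only: w_sum)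
qed

lemma quality_scale:
  fixes S :: "nat \<Rightarrow> nat \<Rightarrow> real"
  assumes "0 < z"
  shows "quality k (\<lambda>i b. S i b / z) \<gamma>1 \<gamma>2 \<gamma>3 = quality k S \<gamma>1 \<gamma>2 \<gamma>3"
  using assms by (simp add: quality_def agree_def hpos_scale)

end

text \<open>
  The potential of the local search lies in an interval of length \<open>5\<close> and grows by at least
  \<open>1 / (10^19 n\<^sup>3) * 1 / (10^5 n\<^sup>2)\<close> in every sweep that changes \<open>L\<close>, so \<open>10^25 n^5\<close> sweeps suffice.
\<close>

locale modularity_algo = algo n A "10^12" "10^5" "10^19" for n A
begin

abbreviation "T \<equiv> 10^25 * n ^ 5 :: nat"
abbreviation "X \<equiv> gram n ((sweep ^^ T) L0)"

text \<open>Origin of the constants: \<open>10^12\<close> brings the diagonal within 1/100000 of 1,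
  because \<open>5 / (10^12 - 1/2)\<close> is at most the square of 1/100000; \<open>10^5\<close>
  makes \<open>n * (\<mu> + \<tau>)\<close> at most 1/50000; and
  \<open>10^19 = 100 * 10^12 * 10^5\<close> is the least admissible step parameter.\<close>

lemma solution:
  shows "R (\<lambda>i j. of_bool (f i = f j)) \<le> R X + 1/50000"
    and "i < n \<Longrightarrow> \<bar>X i i - 1\<bar> \<le> 1/100000"
    and "i < n \<Longrightarrow> j < n \<Longrightarrow> \<bar>X i j\<bar> \<le> 101/100"
proof -
  have n: "1 \<le> real n" using n_ge_1 by simp
  have T: "5 < real T * (1 / (real_of_int (10^19) * real n ^ 3) * (1 / (real_of_int (10^5) * (real n)\<^sup>2)))"
  proof -
    have "real T * (1 / (real_of_int (10^19) * real n ^ 3) * (1 / (real_of_int (10^5) * (real n)\<^sup>2))) = 10"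
    proof -
      have "(s * (a * b)) * (1 / (t * a) * (1 / (u * b))) = s / (t * u)" if "a \<noteq> 0" "b \<noteq> 0" for s t u a b :: real
        using that by simp
      from this[of "real n ^ 3" "(real n)\<^sup>2" "10^25" "10^19" "10^5"] show ?thesis
        using n by (simp flip: power_add)
    qed
    then show ?thesis by simp
  qed
  note sc = solver_correct[OF T]
  have "real n * (1 / (real_of_int (10^5) * real n) + 1 / (real_of_int (10^5) * (real n)\<^sup>2)) \<le> 1/50000"
    using n by (simp add: field_simps power2_eq_square)
  with sc(2)[of f] show "R (\<lambda>i j. of_bool (f i = f j)) \<le> R X + 1/50000" by linarith
  show d: "\<bar>X i i - 1\<bar> \<le> 1/100000" if "i < n" for i
  proof -
    have "(X i i - 1)\<^sup>2 \<le> (\<Sum>i<n. (X i i - 1)\<^sup>2)" using that by (intro member_le_sum) auto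
    also have "\<dots> \<le> 5 / (real_of_int (10^12) - 1/2)" by (rule sc(3))
    also have "\<dots> \<le> (1/100000)\<^sup>2" by (simp add: power2_eq_square)
    finally show ?thesis using abs_le_square_iff[of "X i i - 1" "1/100000"] by simp
  qed
  show "\<bar>X i j\<bar> \<le> 101/100" if "i < n" "j < n"
  proof -
    have "\<bar>x\<bar> \<le> 101/100" if "\<bar>x\<bar> \<le> (a + b) / 2" "\<bar>a - 1\<bar> \<le> 1/100000" "\<bar>b - 1\<bar> \<le> 1/100000" for x a b :: real
      using that unfolding abs_le_iff by argo
    from this[OF abs_gram_le d[OF that(1)] d[OF that(2)]] show ?thesis .
  qed
qed

text \<open>The program works with integral multiples of \<open>cw\<close> and \<open>L\<close>,
  whose common factor \<open>M\<^sup>2 Z^4\<close> cancels. As \<open>cw\<close> has total 3 and the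
  squared norms are at most 2, the mean squared error is at most
  \<open>2 / k * 4 * 3 = 24 / 10^12\<close>; with \<open>t = 1/100000\<close> the mean error is at
  most \<open>1.62 / 10^5\<close>.\<close>

lemma reduction_error:
  fixes Z :: real and L S :: "nat \<Rightarrow> nat \<Rightarrow> real"
  assumes k: "k = 10^12" and Z: "0 < Z"
    and L: "\<And>i j. i < n \<Longrightarrow> j < n \<Longrightarrow> L i j = Z * (sweep ^^ T) L0 i j"
    and pot: "pot n k cM L n S \<le> pot n k cM L 0 (\<lambda>_ _. 0)"
  shows "dbl n (\<lambda>i j. cw i j * \<bar>gram k (\<lambda>i b. S i b / Z) i j - X i j\<bar>) \<le> 1/50000"
proof -
  have gL: "gram n L i j = Z\<^sup>2 * X i j" if "i < n" "j < n" for i j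
    unfolding gram_def sum_distrib_left using that L by (intro sum.cong) (auto simp: power2_eq_square)
  have gS: "gram k S i j = Z\<^sup>2 * gram k (\<lambda>i b. S i b / Z) i j" for i j
    unfolding gram_def sum_distrib_left using Z by (intro sum.cong) (auto simp: power2_eq_square)
  have "0 < k" using k by simp
  from pot_final[OF this pot]
  have "dbl n (\<lambda>i j. ((of_int M)\<^sup>2 * Z ^ 4) * (cw i j * (gram k (\<lambda>i b. S i b / Z) i j - X i j)\<^sup>2)) \<le>
      2 / k * dbl n (\<lambda>i j. ((of_int M)\<^sup>2 * Z ^ 4) * (cw i j * (X i i * X j j)))"
  proof -
    have sq: "m * c * (Z\<^sup>2 * x - Z\<^sup>2 * y)\<^sup>2 = (m * Z ^ 4) * (c * (x - y)\<^sup>2)" for m c x y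
      by (simp add: power2_eq_square power4_eq_xxxx algebra_simps)
    have "dbl n (\<lambda>i j. cM i j * (gram k S i j - gram n L i j)\<^sup>2) =
        dbl n (\<lambda>i j. ((of_int M)\<^sup>2 * Z ^ 4) * (cw i j * (gram k (\<lambda>i b. S i b / Z) i j - X i j)\<^sup>2))"
      unfolding gS by (rule dbl_cong) (simp only: gL sq)
    moreover have "dbl n (\<lambda>i j. cM i j * (gram n L i i * gram n L j j)) =
        dbl n (\<lambda>i j. ((of_int M)\<^sup>2 * Z ^ 4) * (cw i j * (X i i * X j j)))"
      by (rule dbl_cong) (simp add: gL power2_eq_square power4_eq_xxxx mult_ac)
    ultimately show ?thesis using pot_final[OF \<open>0 < k\<close> pot] by simp
  qed
  then have "((of_int M)\<^sup>2 * Z ^ 4) * dbl n (\<lambda>i j. cw i j * (gram k (\<lambda>i b. S i b / Z) i j - X i j)\<^sup>2) \<le>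
      ((of_int M)\<^sup>2 * Z ^ 4) * (2 / k * dbl n (\<lambda>i j. cw i j * (X i i * X j j)))"
    unfolding dbl_cmult by (simp only: mult_ac)
  then have "dbl n (\<lambda>i j. cw i j * (gram k (\<lambda>i b. S i b / Z) i j - X i j)\<^sup>2) \<le> 2 / k * dbl n (\<lambda>i j. cw i j * (X i i * X j j))"
    using Z M_pos' by (subst (asm) mult_le_cancel_left_pos) simp_all
  also have "dbl n (\<lambda>i j. cw i j * (X i i * X j j)) \<le> dbl n (\<lambda>i j. 4 * cw i j)"
  proof (rule dbl_mono)
    fix i j assume "i < n" "j < n"
    then have "\<bar>X i i * X j j\<bar> \<le> 2 * 2" unfolding abs_mult using solution(3)[of i i] solution(3)[of j j] by (intro mult_mono) auto
    then have "X i i * X j j \<le> 4" by (simp add: abs_le_iff)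
    from mult_left_mono[OF this cw_nonneg] show "cw i j * (X i i * X j j) \<le> 4 * cw i j" by (simp add: mult.commute)
  qed
  then have "2 / k * dbl n (\<lambda>i j. cw i j * (X i i * X j j)) \<le> 2 / k * 12"
    by (intro mult_left_mono) (simp_all add: dbl_cmult cw_sum)
  finally have "dbl n (\<lambda>i j. cw i j * (gram k (\<lambda>i b. S i b / Z) i j - X i j)\<^sup>2) \<le> 24 / 10^12" by (simp add: k)
  from mean_error[OF this, of "1/100000"] show ?thesis by simp
qed

lemma main_correct:
  assumes acc: "accurate k (1/100000) \<Gamma> m" and k: "k = 10^12"
    and gs: "\<Gamma> \<times> \<Gamma> \<times> insert (\<lambda>_. 0) \<Gamma> \<subseteq> set gs"
    and data: "data (run n e s_load \<sigma>)"
  shows "383/500 * labelling_quality f - 117/500 <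
    labelling_quality (\<lambda>i. run n e (s_main (10^12) (10^5) (10^19) (10^25) k gs) \<sigma> 10 i 0)"
proof -
  define \<sigma>0 where "\<sigma>0 = run n e s_load \<sigma>"
  define \<sigma>1 where "\<sigma>1 = run n e (s_solve (10^12) (10^5) (10^19) (10^25)) \<sigma>0"
  define \<sigma>2 where "\<sigma>2 = run n e (s_reduce k) \<sigma>1"
  have d0: "data \<sigma>0" using data by (simp only: \<sigma>0_def)
  have s1: "same_but {4,6} \<sigma>0 \<sigma>1" and r1: "repr ((sweep ^^ T) L0) \<sigma>1"
    using repr_solve[OF d0] unfolding \<sigma>1_def by blast+
  have d1: "data \<sigma>1" using data_same_but[OF d0 s1] by simp
  have k0: "0 < k" using k by simp
  define L where "L = (\<lambda>i j. real_of_int (\<sigma>1 4 i j))"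
  define S' where "S' = (\<lambda>i b. real_of_int (\<sigma>2 7 i b))"
  define Z where "Z = real_of_int (\<sigma>1 6 0 0)"
  have s2: "same_but {7,8} \<sigma>1 \<sigma>2" and pot: "pot n k cM L n S' \<le> pot n k cM L 0 (\<lambda>_ _. 0)"
    using reduce_correct[OF d1 k0] unfolding \<sigma>2_def L_def S'_def by blast+
  have d2: "data \<sigma>2" using data_same_but[OF d1 s2] by simp
  have Z: "0 < Z" using r1 by (simp add: repr_def Z_def)
  have err: "dbl n (\<lambda>i j. cw i j * \<bar>gram k (\<lambda>i b. S' i b / Z) i j - X i j\<bar>) \<le> 1/50000"
    by (rule reduction_error[OF k Z _ pot]) (use r1 in \<open>simp add: repr_def L_def Z_def\<close>)
  obtain \<gamma>1 \<gamma>2 \<gamma>3 where g: "\<gamma>1 \<in> \<Gamma>" "\<gamma>2 \<in> \<Gamma>" "\<gamma>3 \<in> insert (\<lambda>_. 0) \<Gamma>"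
    "383/500 * R X - 117/500 + 1/2000 - 6 * (1/100000 + 1/50000 + 1/100000) \<le> quality k (\<lambda>i b. S' i b / Z) \<gamma>1 \<gamma>2 \<gamma>3"
    using rounding[OF acc _ err solution(2,3)] by auto
  have "383/500 * labelling_quality f - 117/500 < quality k (\<lambda>i b. S' i b / Z) \<gamma>1 \<gamma>2 \<gamma>3"
  proof -
    \<comment> \<open>Of the reserve 1/2000 the rounding takes 6/25000 and the optimality gap of the
      solver \<open>383/500 / 50000\<close>.\<close>
    have loss: "6 * (1/100000 + 1/50000 + 1/100000) = (6/25000 :: real)" by simp
    show ?thesis using g(4)[unfolded loss] solution(1)[of f] unfolding labelling_quality_R by argo
  qed
  also have "\<dots> \<le> labelling_quality (\<lambda>i. run n e (s_round k gs) \<sigma>2 10 i 0)"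
    unfolding quality_scale[OF Z] S'_def using gs g(1-3) by (intro round_correct[OF d2]) auto
  finally show ?thesis
    unfolding s_main_def run.simps(3) \<sigma>2_def \<sigma>1_def \<sigma>0_def .
qed

end

section \<open>Graphs\<close>

lemma nth_concat_uniform:
  assumes "\<And>xs. xs \<in> set xss \<Longrightarrow> length xs = m" "i < length xss" "j < m"
  shows "concat xss ! (i * m + j) = xss ! i ! j"
  using assms
proof (induction xss arbitrary: i)
  case (Cons xs xss)
  then show ?case by (cases i) (auto simp: nth_append)
qed simp

lemma length_concat_uniform:
  assumes "\<And>xs. xs \<in> set xss \<Longrightarrow> length xs = m"
  shows "length (concat xss) = length xss * m"
  using assms by (induction xss) auto

locale input_graph =
  fixes H :: "nat wgraph" and n :: nat
  assumes graph: "weighted_graph H" and verts: "verts H = {..<n}"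
begin

definition num :: "nat \<Rightarrow> nat \<Rightarrow> int" where "num i j = fst (quotient_of (adj H i j))"
definition den :: "nat \<Rightarrow> nat \<Rightarrow> int" where "den i j = snd (quotient_of (adj H i j))"
definition D :: int where "D = (\<Prod>i<n. \<Prod>j<n. den i j)"
definition A :: "nat \<Rightarrow> nat \<Rightarrow> int" where "A i j = num i j * D div den i j"

lemma adj_nonneg: "0 \<le> adj H i j"
  using graph by (auto simp: adj_def weighted_graph_def)

lemma adj_sym: "adj H i j = adj H j i"
  by (simp add: adj_def insert_commute)

lemma den_pos: "0 < den i j"
  unfolding den_def by (rule quotient_of_denom_pos')

lemma D_pos: "0 < D"
  unfolding D_def by (intro prod_pos ballI den_pos)

lemma adj_eq: "adj H i j = of_int (num i j) / of_int (den i j)"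
  unfolding num_def den_def by (rule quotient_of_div) simp

lemma num_nonneg: "0 \<le> num i j"
  using adj_nonneg[of i j] den_pos[of i j] unfolding adj_eq by (simp add: zero_le_divide_iff)

lemma A_nonneg: "0 \<le> A i j"
  unfolding A_def using num_nonneg den_pos[of i j] D_pos by (simp add: pos_imp_zdiv_nonneg_iff)

lemma A_sym: "A i j = A j i"
  by (simp add: A_def num_def den_def adj_sym[of i j])

lemma A_eq: "i < n \<Longrightarrow> j < n \<Longrightarrow> (of_int (A i j) :: rat) = of_int D * adj H i j"
proof -
  assume "i < n" "j < n"
  then have "den i j dvd (\<Prod>j<n. den i j)" "(\<Prod>j<n. den i j) dvd D"
    unfolding D_def by (auto intro!: dvd_prodI)
  then have "den i j dvd D" by (rule dvd_trans)
  then obtain c where "D = den i j * c" ..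
  then show ?thesis using den_pos[of i j] by (simp add: A_def adj_eq)
qed

lemma sum_A: "i < n \<Longrightarrow> (of_int (\<Sum>j<n. A i j) :: rat) = of_int D * wdegree H i"
  by (simp add: wdegree_def verts sum_distrib_left A_eq)

lemma sum_sum_A: "(of_int (\<Sum>i<n. \<Sum>j<n. A i j) :: rat) = of_int D * (2 * total_weight H)"
proof -
  have "(of_int (\<Sum>i<n. \<Sum>j<n. A i j) :: rat) = (\<Sum>i<n. of_int D * wdegree H i)"
    unfolding of_int_sum[of "\<lambda>i. \<Sum>j<n. A i j"] by (intro sum.cong refl) (simp only: sum_A lessThan_iff)
  then show ?thesis by (simp add: total_weight_def verts flip: sum_distrib_left)
qed

lemma sum_A_pos: "0 < (\<Sum>i<n. \<Sum>j<n. A i j)"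
proof -
  have "(0 :: rat) < of_int D * (2 * total_weight H)"
    using D_pos graph by (simp add: weighted_graph_def)
  then show ?thesis unfolding sum_sum_A[symmetric] by (simp only: of_int_0_less_iff)
qed

sublocale alg: modularity_algo n A
  by unfold_locales (simp_all add: A_nonneg A_sym sum_A_pos)

text \<open>The common denominator \<open>D\<close> cancels. Only the relation of lying in one
  community enters, so labels of any type will do: memory cells for the output, sets of vertices for
  an optimal partition.\<close>

lemma modularity_eq:
  assumes "\<And>i j. i < n \<Longrightarrow> j < n \<Longrightarrow> (\<exists>X\<in>C. i \<in> X \<and> j \<in> X) \<longleftrightarrow> f i = f j"
  shows "real_of_rat (modularity H C) = alg.labelling_quality f"
proof -
  let ?b = "\<lambda>i j. of_bool (f i = f j)"
  have r: "real_of_rat (of_int k) = of_int k" for k by simp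
  have D: "real_of_int D \<noteq> 0" and M: "real_of_int alg.M \<noteq> 0" using D_pos alg.M_pos' by simp_all
  have adj: "real_of_rat (adj H i j) = of_int (A i j) / of_int D" if "i < n" "j < n" for i j
    using arg_cong[OF A_eq[OF that], of real_of_rat] D unfolding of_rat_mult r by (simp add: field_simps)
  have deg: "real_of_rat (wdegree H i) = of_int (alg.d i) / of_int D" if "i < n" for i
    using arg_cong[OF sum_A[OF that], of real_of_rat] D unfolding of_rat_mult r alg.d_def by (simp add: field_simps)
  have tot: "real_of_rat (2 * total_weight H) = of_int alg.M / of_int D"
    using arg_cong[OF sum_sum_A, of real_of_rat] D unfolding of_rat_mult[of "of_int D"] r alg.M_def alg.d_def
    by (simp add: field_simps)
  have "real_of_rat (modularity H C) = 1 / real_of_rat (2 * total_weight H) *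
      (\<Sum>i<n. \<Sum>j<n. (real_of_rat (adj H i j) - real_of_rat (wdegree H i) * real_of_rat (wdegree H j) / real_of_rat (2 * total_weight H)) *
        real_of_rat (of_bool (\<exists>X\<in>C. i \<in> X \<and> j \<in> X)))"
    unfolding modularity_def verts
    by (simp only: of_rat_mult of_rat_divide of_rat_sum of_rat_diff of_rat_1)
  also have "\<dots> = 1 / (of_int alg.M / of_int D) * (\<Sum>i<n. \<Sum>j<n. (of_int (A i j) / of_int D -
      of_int (alg.d i) / of_int D * (of_int (alg.d j) / of_int D) / (of_int alg.M / of_int D)) * ?b i j)"
    unfolding tot
    by (intro arg_cong[where f = "(*) _"] sum.cong refl) (auto simp: adj deg assms)
  also have "\<dots> = dbl n (\<lambda>i j. 1 / (of_int alg.M / of_int D) * ((of_int (A i j) / of_int D -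
      of_int (alg.d i) / of_int D * (of_int (alg.d j) / of_int D) / (of_int alg.M / of_int D)) * ?b i j))"
    by (simp only: dbl_def sum_distrib_left)
  also have "\<dots> = alg.labelling_quality f"
    unfolding alg.labelling_quality_def
    using D M by (intro dbl_cong) (simp add: alg.p_eq field_simps power2_eq_square)
  finally show ?thesis .
qed

lemma output_partition:
  "community_structure H (output_communities H m)"
  "i < n \<Longrightarrow> j < n \<Longrightarrow> (\<exists>X\<in>output_communities H m. i \<in> X \<and> j \<in> X) \<longleftrightarrow> m (int i) = m (int j)"
  by (auto simp: community_structure_def output_communities_def verts partition_on_def disjoint_def)

lemma modularity_opt: "\<exists>f :: nat \<Rightarrow> nat set. real_of_rat (modularity_opt H) = alg.labelling_quality f"
proof -
  have "finite {C. community_structure H C}"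
    unfolding community_structure_def by (rule finitely_many_partition_on) (simp add: verts)
  moreover have "{C. community_structure H C} \<noteq> {}" using output_partition(1) by blast
  ultimately have "modularity_opt H \<in> modularity H ` {C. community_structure H C}"
    unfolding modularity_opt_def by (intro Max_in) auto
  then obtain C where C: "partition_on {..<n} C" "modularity_opt H = modularity H C"
    by (auto simp: community_structure_def verts)
  \<comment> \<open>For a vertex of a part \<open>X\<close> this union of parts is \<open>X\<close>
    itself, by disjointness.\<close>
  define f where "f i = {j. \<exists>X\<in>C. i \<in> X \<and> j \<in> X}" for i
  have f: "f i = X" if "X \<in> C" "i \<in> X" for i X
    using that partition_onD2[OF C(1)] by (auto simp: f_def disjoint_def)
  have "(\<exists>X\<in>C. i \<in> X \<and> j \<in> X) \<longleftrightarrow> f i = f j" if "i < n" "j < n" for i j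
  proof -
    have "i \<in> \<Union>C" "j \<in> \<Union>C" using that partition_onD1[OF C(1)] by auto
    then obtain X Y where "X \<in> C" "i \<in> X" "Y \<in> C" "j \<in> Y" by blast
    then show ?thesis using f by metis
  qed
  then show ?thesis using modularity_eq[of C f] C(2) by auto
qed

lemma encode_eq: "encode_graph H = int n # concat (concat (map (\<lambda>i. map (\<lambda>j. [num i j, den i j]) [0..<n]) [0..<n]))"
  by (simp add: encode_graph_def Let_def verts num_def den_def)

lemma is_input: "is_input n num den (init (encode_graph H))"
proof -
  let ?ps = "concat (map (\<lambda>i. map (\<lambda>j. [num i j, den i j]) [0..<n]) [0..<n])"
  have len: "length ?ps = n * n" by (subst length_concat_uniform[where m = n]) auto
  have len2: "length (concat ?ps) = n * n * 2" by (subst length_concat_uniform[where m = 2]) (auto simp: len)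
  have ent: "concat ?ps ! (2 * (i * n + j) + b) = [num i j, den i j] ! b \<and> 2 * (i * n + j) + b < length (concat ?ps)"
    if "i < n" "j < n" "b < 2" for i j b
  proof -
    have "i * n + j < i * n + n" using that by simp
    also have "\<dots> = Suc i * n" by simp
    also have "\<dots> \<le> n * n" using that by (intro mult_right_mono) auto
    finally have lt: "i * n + j < n * n" .
    have "?ps ! (i * n + j) = [num i j, den i j]"
      using that by (subst nth_concat_uniform) auto
    moreover have "concat ?ps ! ((i * n + j) * 2 + b) = ?ps ! (i * n + j) ! b"
      by (rule nth_concat_uniform) (use that lt len in auto)
    ultimately show ?thesis using lt that unfolding len2 by (simp add: mult.commute)
  qed
  have ld: "init (x # c) 0 (Suc t) 0 = c ! t" if "t < length c" for x c t
    using that by (simp add: init_def load_input_def nat_add_distrib)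
  show ?thesis
    unfolding is_input_def encode_eq
  proof (intro allI impI)
    fix i j assume "i < n" "j < n"
    with ent[of i j 0] ent[of i j 1] show
      "init (int n # concat ?ps) 0 (1 + 2 * (i * n + j)) 0 = num i j \<and> init (int n # concat ?ps) 0 (2 + 2 * (i * n + j)) 0 = den i j"
      using ld[of "2 * (i * n + j)" "concat ?ps" "int n"] ld[of "2 * (i * n + j) + 1" "concat ?ps" "int n"]
      by simp
  qed
qed

lemma n_le_length: "n \<le> length (encode_graph H)"
proof -
  have "length (encode_graph H) = Suc (n * n * 2)"
    unfolding encode_eq by (simp, subst length_concat_uniform[where m = 2], force, subst length_concat_uniform[where m = n]) auto
  moreover have "n \<le> n * n" by (cases n) auto
  ultimately show ?thesis by linarith
qed

lemma algorithm_correct: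
  assumes acc: "accurate k (1/100000) \<Gamma> \<mu>" and k: "k = 10^12"
    and gs: "\<Gamma> \<times> \<Gamma> \<times> insert (\<lambda>_. 0) \<Gamma> \<subseteq> set gs"
    and m: "\<And>i. i < n \<Longrightarrow> m (int i) = run n (\<lambda>_. 0) (s_main (10^12) (10^5) (10^19) (10^25) k gs) (init (encode_graph H)) 10 i 0"
  shows "383/500 * modularity_opt H - 117/500 < modularity H (output_communities H m)" "modularity_opt H \<le> 1"
proof -
  let ?best = "\<lambda>i. run n (\<lambda>_. 0) (s_main (10^12) (10^5) (10^19) (10^25) k gs) (init (encode_graph H)) 10 i 0"
  obtain f :: "nat \<Rightarrow> nat set" where f: "real_of_rat (modularity_opt H) = alg.labelling_quality f"
    using modularity_opt by blast
  have "alg.data (run n (\<lambda>_. 0) s_load (init (encode_graph H)))"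
    using run_load[OF is_input, of A "\<lambda>_. 0"] unfolding alg.data_def alg.d_def alg.M_def by (simp add: A_def D_def)
  from alg.main_correct[OF acc k gs this, of f]
  have "383/500 * alg.labelling_quality f - 117/500 < alg.labelling_quality ?best" .
  also have "\<dots> = real_of_rat (modularity H (output_communities H m))"
    using m by (intro modularity_eq[symmetric]) (simp add: output_partition(2))
  finally have "real_of_rat (383/500 * modularity_opt H - 117/500) < real_of_rat (modularity H (output_communities H m))"
    unfolding f[symmetric] by (simp add: of_rat_diff of_rat_mult of_rat_divide)
  then show "383/500 * modularity_opt H - 117/500 < modularity H (output_communities H m)"
    by (simp only: of_rat_less)
  have "real_of_rat (modularity_opt H) \<le> real_of_rat 1"
    using alg.labelling_quality_le_1[of f] by (simp add: f)
  then show "modularity_opt H \<le> 1" by (simp only: of_rat_less_eq)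
qed

end

theorem theorem3:
  fixes \<kappa> :: rat
  assumes "\<kappa> = 0.766"
  shows "\<exists>alg :: prog. solves_in_polytime alg encode_graph input_graphs
    (\<lambda>G m. let C = output_communities G m in
       community_structure G C \<and>
       modularity G C > \<kappa> * modularity_opt G - (1 - \<kappa>) \<and>
       modularity G C > modularity_opt G - 2 * (1 - \<kappa>))"
proof -
  define k :: nat where "k = 10^12"
  \<comment> \<open>A numeral type of this cardinality supplies the space on which Lebesgue measure
    is used; the program sees only the number \<open>k\<close>.\<close>
  have k: "k = CARD(1000000000000)" by (simp add: k_def)
  obtain \<Gamma> \<mu> where acc: "accurate k (1/100000) \<Gamma> \<mu>"
    using hyperplane_family[where 'k = 1000000000000, of "1/100000"] unfolding accurate_def k by auto
  then have "finite (\<Gamma> \<times> \<Gamma> \<times> insert (\<lambda>_. 0) \<Gamma>)" by (simp add: accurate_def)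
  then obtain gs where gs: "set gs = \<Gamma> \<times> \<Gamma> \<times> insert (\<lambda>_. 0) \<Gamma>" using finite_list by blast
  let ?s = "s_main (10^12) (10^5) (10^19) (10^25) k gs"
  have "solves_in_polytime (program ?s 10) encode_graph input_graphs
    (\<lambda>G m. let C = output_communities G m in
       community_structure G C \<and>
       modularity G C > \<kappa> * modularity_opt G - (1 - \<kappa>) \<and>
       modularity G C > modularity_opt G - 2 * (1 - \<kappa>))"
  proof (rule program_polytime[where num = "\<lambda>G. card (verts G)" and rest = "\<lambda>G. tl (encode_graph G)", OF wfs_main])
    fix G m assume "G \<in> input_graphs"
    then obtain n where "input_graph G n" by (auto simp: input_graphs_def input_graph_def)
    then interpret input_graph G n .
    have card: "card (verts G) = n" by (simp add: verts)
    show "encode_graph G = int (card (verts G)) # tl (encode_graph G)" by (simp add: card encode_eq)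
    show "card (verts G) \<le> length (encode_graph G)" using n_le_length by (simp add: card)
    assume m: "\<And>i. i < card (verts G) \<Longrightarrow> m (int i) = run (card (verts G)) (\<lambda>_. 0) ?s (init (encode_graph G)) 10 i 0"
    have 1: "383/500 * modularity_opt G - 117/500 < modularity G (output_communities G m)" and 2: "modularity_opt G \<le> 1"
      using algorithm_correct[OF acc k_def eq_refl[OF gs[symmetric]], of m] m by (simp_all add: card)
    show "let C = output_communities G m in
       community_structure G C \<and>
       modularity G C > \<kappa> * modularity_opt G - (1 - \<kappa>) \<and>
       modularity G C > modularity_opt G - 2 * (1 - \<kappa>)"
      using output_partition(1)[of m] 1 2 unfolding Let_def assms by simp
  qed simp
  then show ?thesis by blast
qed

end
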